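(* Let $Z_t=\sum_{j=1}^{N_t}X_j$, $t\ge0$, be a compound Poisson process, where $N$ is a homogeneous Poisson process with intensity $\lambda=1$, independent of the i.i.d. real random variables $(X_j)$ with Lebesgue density $f$. For sampling rate $\Delta=\Delta_n>0$ one observes the increments $Y_{j\Delta}=Z_{j\Delta}-Z_{(j-1)\Delta}$, $j=1,\dots,n$. Assume that $\mathbb{E}[X_1^2]<\infty$, that $\Delta\le\frac14\log(n\Delta)$ for all sufficiently large $n$, and that $n\Delta\to\infty$ as $n\to\infty$. Then, for all sufficiently large $n$ and for any $m\ge0$, the estimator $\hat f_{m,\Delta}$ defined in the context satisfies $$\mathbb{E}\big[\|\hat f_{m,\Delta}-f\|^2\big]\le\|f_m-f\|^2+\frac{2}{n\Delta}\int_{-m}^m\frac{du}{|\varphi_\Delta(u)|^2}+2\cdot5^2\,\mathbb{E}[X_1^2]\frac{m}{n\Delta}+2^3\cdot5^2\,\frac{m^2}{(n\Delta)^2}.$$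
   Context: $\|g\|^2=\int_{\mathbb{R}}|g(x)|^2dx$. $\varphi$ is the characteristic function of $X_1$, $\varphi_\Delta$ that of $Z_\Delta$, so $\varphi_\Delta(u)=\exp(\Delta(\varphi(u)-1))$. $f_m$ is the function with Fourier transform $\varphi\,\mathbf 1_{[-m,m]}$, i.e. $f_m(x)=\frac1{2\pi}\int_{-m}^m e^{-iux}\varphi(u)\,du$. Let $\hat\varphi_{\Delta,n}(u)=\frac1n\sum_{j=1}^n e^{iuY_{j\Delta}}$, with derivative $\hat\varphi_{\Delta,n}'(u)=\frac1n\sum_{j=1}^n iY_{j\Delta}e^{iuY_{j\Delta}}$, and $$\mathrm{Log}(\hat\varphi_{\Delta,n}(u))=\int_0^u\frac{\hat\varphi_{\Delta,n}'(z)}{\hat\varphi_{\Delta,n}(z)}\,dz,\qquad \hat\varphi_n(u)=1+\frac1\Delta\mathrm{Log}(\hat\varphi_{\Delta,n}(u)),$$ $$\tilde\varphi_n(u)=\hat\varphi_n(u)\,\mathbf 1_{\{|\hat\varphi_n(u)|\le4\}},\qquad \hat f_{m,\Delta}(x)=\frac1{2\pi}\int_{-m}^m e^{-iux}\,\tilde\varphi_n(u)\,du.$$ If $\hat\varphi_{\Delta,n}$ vanishes at some point between $0$ and $u$ so that $\mathrm{Log}(\hat\varphi_{\Delta,n}(u))$ is not defined, one sets $\tilde\varphi_n(u)=0$. *)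

theory Defs
  imports "HOL-Probability.Probability"
begin

text \<open>
  Homogeneous Poisson process, given by its counting variables \<^term>\<open>N t\<close> for \<^prop>\<open>t \<ge> 0\<close>.
  Values of \<^term>\<open>N t\<close> at negative times are irrelevant. Increments are taken in \<^typ>\<open>int\<close>
  because subtraction on \<^typ>\<open>nat\<close> truncates. The path properties are only required almost surely.
\<close>

locale poisson_process = prob_space M for M :: "'a measure" +
  fixes rate :: real and N :: "real \<Rightarrow> 'a \<Rightarrow> nat"
  assumes rate_pos: "0 < rate"
    and N_measurable: "0 \<le> t \<Longrightarrow> N t \<in> measurable M (count_space UNIV)"
    and N_paths: "AE \<omega> in M. N 0 \<omega> = 0 \<and> mono_on {0..} (\<lambda>t. N t \<omega>)
                    \<and> (\<forall>t\<ge>0. continuous (at_right t) (\<lambda>s. N s \<omega>))"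
    and N_increment_distr: "0 \<le> s \<Longrightarrow> s < t \<Longrightarrow>
          distr M (count_space UNIV) (\<lambda>\<omega>. int (N t \<omega>) - int (N s \<omega>))
            = measure_pmf (map_pmf int (poisson_pmf (rate * (t - s))))"
    and N_indep_increments: "\<And>\<tau> :: nat \<Rightarrow> real. 0 \<le> \<tau> 0 \<Longrightarrow> mono \<tau> \<Longrightarrow>
          indep_vars (\<lambda>_. count_space UNIV)
            (\<lambda>i \<omega>. int (N (\<tau> (Suc i)) \<omega>) - int (N (\<tau> i) \<omega>)) UNIV"

text \<open>
  The jumps are \<open>X 1, X 2, \<dots>\<close>; the variable \<^term>\<open>X 0\<close> is unused.
  Independence of the processes \<open>N\<close> and \<open>X\<close> is that of the \<open>\<sigma>\<close>-algebras they generate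
  (\<open>indep_var\<close> does not apply, as their values have different types).
\<close>

locale compound_poisson = poisson_process M rate N
  for M :: "'a measure" and rate :: real and N :: "real \<Rightarrow> 'a \<Rightarrow> nat" +
  fixes X :: "nat \<Rightarrow> 'a \<Rightarrow> real"
  assumes X_indep: "indep_vars (\<lambda>_. borel) X {1..}"
    and X_ident: "1 \<le> j \<Longrightarrow> distr M borel (X j) = distr M borel (X 1)"
    and N_X_indep: "indep_set
          (sets (vimage_algebra (space M) (\<lambda>\<omega>. \<lambda>t\<in>{0..}. N t \<omega>) (\<Pi>\<^sub>M t\<in>{0..}. count_space UNIV)))
          (sets (vimage_algebra (space M) (\<lambda>\<omega>. \<lambda>j\<in>{1..}. X j \<omega>) (\<Pi>\<^sub>M j\<in>{1..}. borel)))"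

definition compound_sum :: "(real \<Rightarrow> 'a \<Rightarrow> nat) \<Rightarrow> (nat \<Rightarrow> 'a \<Rightarrow> real) \<Rightarrow> real \<Rightarrow> 'a \<Rightarrow> real" where
  "compound_sum N X t \<omega> = (\<Sum>j\<in>{1..N t \<omega>}. X j \<omega>)"

text \<open>The observation \<open>Y\<^sub>j\<^sub>\<Delta>\<close>, used for \<^prop>\<open>(1::nat) \<le> j\<close>, of a process \<^term>\<open>Z\<close>.\<close>

definition increment :: "(real \<Rightarrow> 'a \<Rightarrow> real) \<Rightarrow> real \<Rightarrow> 'a \<Rightarrow> nat \<Rightarrow> real" where
  "increment Z \<Delta> \<omega> j = Z (real j * \<Delta>) \<omega> - Z ((real j - 1) * \<Delta>) \<omega>"

text \<open>The function with Fourier transform \<open>\<psi>\<close> restricted to \<open>[-m, m]\<close>.\<close>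

definition fourier_cutoff :: "(real \<Rightarrow> complex) \<Rightarrow> real \<Rightarrow> real \<Rightarrow> complex" where
  "fourier_cutoff \<psi> m x = 1 / (2 * pi) * (CLBINT u=-m..m. iexp (- (u * x)) * \<psi> u)"

text \<open>
  Empirical quantities computed from a sample \<open>y 1, \<dots>, y n\<close>. The interval integral in
  \<open>emp_Log\<close> is oriented, so that it is also the intended one for negative \<open>u\<close>.
\<close>

definition emp_char :: "(nat \<Rightarrow> real) \<Rightarrow> nat \<Rightarrow> real \<Rightarrow> complex" where
  "emp_char y n u = 1 / n * (\<Sum>j=1..n. iexp (u * y j))"

definition emp_char' :: "(nat \<Rightarrow> real) \<Rightarrow> nat \<Rightarrow> real \<Rightarrow> complex" where
  "emp_char' y n u = 1 / n * (\<Sum>j=1..n. \<i> * y j * iexp (u * y j))"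

definition emp_Log :: "(nat \<Rightarrow> real) \<Rightarrow> nat \<Rightarrow> real \<Rightarrow> complex" where
  "emp_Log y n u = (CLBINT z=ereal 0..ereal u. emp_char' y n z / emp_char y n z)"

definition phi_hat :: "real \<Rightarrow> (nat \<Rightarrow> real) \<Rightarrow> nat \<Rightarrow> real \<Rightarrow> complex" where
  "phi_hat \<Delta> y n u = 1 + 1 / \<Delta> * emp_Log y n u"

definition phi_tilde :: "real \<Rightarrow> (nat \<Rightarrow> real) \<Rightarrow> nat \<Rightarrow> real \<Rightarrow> complex" where
  "phi_tilde \<Delta> y n u =
     (if (\<exists>z\<in>closed_segment 0 u. emp_char y n z = 0) then 0
      else if cmod (phi_hat \<Delta> y n u) \<le> 4 then phi_hat \<Delta> y n u else 0)"

definition f_hat :: "real \<Rightarrow> (nat \<Rightarrow> real) \<Rightarrow> nat \<Rightarrow> real \<Rightarrow> real \<Rightarrow> complex" where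
  "f_hat \<Delta> y n m = fourier_cutoff (phi_tilde \<Delta> y n) m"

text \<open>
  Squared \<open>L\<^sup>2\<close> norm with values in \<^typ>\<open>ennreal\<close>: it is infinite
  for functions that are not square integrable.
\<close>

definition L2_norm_sq :: "(real \<Rightarrow> complex) \<Rightarrow> ennreal" where
  "L2_norm_sq g = (\<integral>\<^sup>+x. ennreal ((cmod (g x))\<^sup>2) \<partial>lborel)"

end

theory Submission
  imports Defs "HOL-Real_Asymp.Real_Asymp"
begin

text \<open>
  Write \<open>f_m\<close> for the cutoff of \<open>f\<close> at frequency \<open>m\<close>. The Fourier transforms of \<open>f_hat\<close> and \<open>f_m\<close> vanish
  outside \<open>[-m, m]\<close>, where the transform of \<open>f_m - f\<close> vanishes. Pythagoras and Plancherel split the loss: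
  \[ \|\hat f - f\|^2 = \|f_m - f\|^2 + \frac1{2\pi} \int_{-m}^m |\tilde\varphi(u) - \varphi(u)|^2 du . \]
  Only ``at most'' is proved (\<open>L2_risk_le\<close>). If \<open>f\<close> is not square integrable, the bias term is
  infinite and nothing remains to be shown.

  To bound the second term, let \<open>R\<close> be the quotient of the empirical characteristic function of the
  increments by the true one, \<open>\<phi>\<^sub>\<Delta> = exp (\<Delta> (\<phi> - 1))\<close>. As long as \<open>R\<close> stays within distance
  \<open>2/5\<close> of \<open>1\<close> on the whole way from \<open>0\<close> to \<open>u\<close>, the distinguished logarithm of the empirical
  characteristic function is \<open>\<Delta> (\<phi> - 1) + Ln R\<close> with the principal branch (\<open>emp_Log_eq\<close>). Hence the
  error is at most \<open>5/(3\<Delta>) |R(u) - 1|\<close> there. Since the mean of \<open>|R(u) - 1|\<^sup>2\<close> is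
  \<open>(1 - |\<phi>\<^sub>\<Delta>(u)|\<^sup>2) / (n |\<phi>\<^sub>\<Delta>(u)|\<^sup>2)\<close> and \<open>1 - |\<phi>\<^sub>\<Delta>|\<^sup>2 \<le> 4\<Delta>\<close>, this part of the error produces
  the variance term. Off this good event the error is at most \<open>4 + 1 = 5\<close>, because of the truncation,
  so what is left to bound is the probability of the bad event.

  The deviation of the empirical characteristic function is controlled on a grid by Hoeffding's
  inequality (\<open>emp_deviation_le\<close>). Between grid points it is Lipschitz with constant at most
  \<open>(\<Sum> |Y\<^sub>j|) / n\<close> plus a term of order \<open>\<Delta>\<close>. That sum is at most the total variation of the
  path up to time \<open>T = n\<Delta>\<close>, which has mean \<open>T E|X|\<close> and variance \<open>T E X\<^sup>2\<close>; Chebyshev's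
  inequality gives the term \<open>E X\<^sup>2 m / T\<close> (\<open>prob_total_variation_le\<close>).

  The delicate point is that the probability in Hoeffding's inequality must be smaller than a certain
  power of \<open>T\<close>. The bound
  \<open>|\<phi>\<^sub>\<Delta>| \<ge> exp (-2\<Delta>) \<ge> T powr (-1/2)\<close> alone would not suffice, as the empirical characteristic function
  fluctuates on the scale \<open>n powr (-1/2)\<close>. But \<open>Re \<phi> \<ge> \<delta> - 1\<close> for some \<open>\<delta> > 0\<close>
  (\<open>Re_char_bounded_below\<close>), and so \<open>|\<phi>\<^sub>\<Delta>|\<close> exceeds the fluctuations by a positive power of \<open>T\<close>, up to
  logarithms. Here the square integrability of \<open>f\<close> enters a second time: if \<open>\<phi>(u)\<close> is close to \<open>-1\<close>, then
  \<open>\<phi>\<close> is close to \<open>1\<close> near many multiples of \<open>2u\<close>, contrary to Bessel's inequality.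
\<close>

section \<open>Plancherel's identity for bounded functions of compact support\<close>

text \<open>
  This is \<open>2 \<pi>\<close> times the inverse Fourier transform of \<open>H\<close>.
\<close>

definition fourier :: "(real \<Rightarrow> complex) \<Rightarrow> real \<Rightarrow> complex" where
  "fourier H x = (\<integral>u. H u * iexp (- (u * x)) \<partial>lborel)"

lemma gaussian_fourier:
  assumes "0 < (\<sigma>::real)"
  shows "(\<integral>x. complex_of_real (exp (- (\<sigma> * x)\<^sup>2 / 2)) * iexp (- (t * x)) \<partial>lborel) =
    complex_of_real (2 * pi * normal_density 0 \<sigma> t)"
proof -
  have "(\<integral>x. complex_of_real (exp (- (\<sigma> * x)\<^sup>2 / 2)) * iexp (- (t * x)) \<partial>lborel) =
    (1 / \<sigma>) *\<^sub>R (\<integral>x. complex_of_real (exp (- x\<^sup>2 / 2)) * iexp (- (t / \<sigma>) * x) \<partial>lborel)"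
    using assms lborel_integral_real_affine[of \<sigma> "\<lambda>x. complex_of_real (exp (- x\<^sup>2 / 2)) * iexp (- (t / \<sigma>) * x)" 0]
    by (simp add: algebra_simps)
  also have "(\<integral>x. complex_of_real (exp (- x\<^sup>2 / 2)) * iexp (- (t / \<sigma>) * x) \<partial>lborel)
     = complex_of_real (sqrt (2 * pi)) * (\<integral>x. std_normal_density x *\<^sub>R iexp (- (t / \<sigma>) * x) \<partial>lborel)"
    by (subst integral_mult_right_zero[symmetric])
       (auto intro!: Bochner_Integration.integral_cong simp: std_normal_density_def scaleR_conv_of_real field_simps)
  also have "(\<integral>x. std_normal_density x *\<^sub>R iexp (- (t / \<sigma>) * x) \<partial>lborel) = char std_normal_distribution (- (t / \<sigma>))"
    unfolding char_def by (subst integral_density) auto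
  also have "\<dots> = exp (- (t / \<sigma>)\<^sup>2 / 2)"
    by (simp add: char_std_normal_distribution)
  finally show ?thesis
    using assms
    by (simp add: normal_density_def scaleR_conv_of_real field_simps real_sqrt_mult power2_eq_square
          flip: of_real_mult of_real_divide)
qed

lemma integrable_indicator_Icc: "integrable lborel (indicator {a..b} :: real \<Rightarrow> real)"
  by (rule integrable_real_indicator) (use emeasure_bounded_finite[of "{a..b}"] in \<open>simp_all add: top.not_eq_extremum\<close>)

lemma borel_measurable_cnj [measurable (raw)]:
  "g \<in> borel_measurable M \<Longrightarrow> (\<lambda>x. cnj (g x)) \<in> borel_measurable M"
  by (rule borel_measurable_continuous_on[OF continuous_on_cnj[OF continuous_on_id]])

text \<open>
  Such functions belong to \<open>L\<^sup>1\<close> and \<open>L\<^sup>2\<close> at the same time: their Fourier integral converges at every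
  point, while Plancherel's identity compares their \<open>L\<^sup>2\<close> norms.
\<close>

locale bounded_support =
  fixes H :: "real \<Rightarrow> complex" and m B :: real
  assumes H_meas [measurable]: "H \<in> borel_measurable borel"
    and H_bound: "\<And>u. cmod (H u) \<le> B"
    and H_support: "\<And>u. m < \<bar>u\<bar> \<Longrightarrow> H u = 0"
begin

lemma B_nonneg: "0 \<le> B"
  using H_bound[of 0] norm_ge_zero order_trans by blast

lemma norm_H_le: "cmod (H u) \<le> B * indicator {-m..m} u"
  using H_bound[of u] H_support[of u] by (auto simp: indicator_def)

lemma integrable_H: "integrable lborel H"
  by (rule Bochner_Integration.integrable_bound[where f = "\<lambda>u. B * indicator {-m..m} u"])
     (use norm_H_le B_nonneg in \<open>auto simp: integrable_indicator_Icc\<close>)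

lemma integrable_H_sq: "integrable lborel (\<lambda>u. (cmod (H u))\<^sup>2)"
proof (rule Bochner_Integration.integrable_bound[where f = "\<lambda>u. B * (B * indicator {-m..m} u)"])
  show "AE u in lborel. norm ((cmod (H u))\<^sup>2) \<le> norm (B * (B * indicator {-m..m} u))"
    using norm_H_le H_bound B_nonneg by (auto simp: power2_eq_square intro!: AE_I2 mult_mono)
qed (auto simp: integrable_indicator_Icc)

lemma integrable_HH: "integrable (lborel \<Otimes>\<^sub>M lborel) (\<lambda>(u, v). H u * cnj (H v))"
  by (intro lborel_pair.Fubini_integrable)
    (auto simp: norm_mult intro!: integrable_mult_right integrable_mult_left integrable_norm integrable_H)

lemma integrable_fourier: "integrable lborel (\<lambda>u. H u * iexp (- (u * x)))"
  by (rule Bochner_Integration.integrable_bound[OF integrable_H]) (auto simp: norm_mult)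

lemma fourier_measurable [measurable]: "fourier H \<in> borel_measurable borel"
  unfolding fourier_def[abs_def] by measurable

lemma norm_fourier_le: "cmod (fourier H x) \<le> (\<integral>u. cmod (H u) \<partial>lborel)"
  unfolding fourier_def
  by (rule order_trans[OF integral_norm_bound]) (simp add: norm_mult)

text \<open>
  The Gaussian weight makes Fubini's theorem applicable. After exchanging the integrals it turns into a
  normal density that concentrates on the diagonal as \<open>\<sigma>\<close> tends to \<open>0\<close>; Plancherel's identity is the limit.
\<close>

lemma gaussian_fourier_norm:
  assumes "0 < \<sigma>"
  shows "(\<integral>x. (cmod (fourier H x))\<^sup>2 * exp (- (\<sigma> * x)\<^sup>2 / 2) \<partial>lborel) =
    2 * pi * (\<integral>p. Re (H (fst p) * cnj (H (snd p))) * normal_density 0 \<sigma> (fst p - snd p) \<partial>(lborel \<Otimes>\<^sub>M lborel))"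
    (is "_ = 2 * pi * ?R")
    and "integrable (lborel \<Otimes>\<^sub>M lborel) (\<lambda>p. Re (H (fst p) * cnj (H (snd p))) * normal_density 0 \<sigma> (fst p - snd p))"
    and "integrable lborel (\<lambda>x. (cmod (fourier H x))\<^sup>2 * exp (- (\<sigma> * x)\<^sup>2 / 2))"
proof -
  let ?P = "lborel \<Otimes>\<^sub>M lborel :: (real \<times> real) measure"
  let ?w = "\<lambda>x. complex_of_real (exp (- (\<sigma> * x)\<^sup>2 / 2))"
  let ?K = "\<lambda>p. H (fst p) * cnj (H (snd p))"
  interpret PP: pair_sigma_finite ?P "lborel :: real measure"
    by (intro pair_sigma_finite.intro sigma_finite_lborel lborel_pair.sigma_finite_measure_axioms
        lborel.sigma_finite_measure_axioms | (simp add: lborel_prod sigma_finite_lborel; fail))+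
  have K: "integrable ?P ?K"
    using integrable_HH by (simp add: case_prod_beta')
  have w_real: "integrable lborel (\<lambda>x. exp (- (\<sigma> * x)\<^sup>2 / 2))"
  proof -
    have "integrable lborel (\<lambda>x. sqrt (2 * pi) / \<sigma> * normal_density 0 (1 / \<sigma>) x)"
      using assms by (intro integrable_mult_right integrable_normal_density) auto
    then show ?thesis
      using assms by (simp add: normal_density_def field_simps real_sqrt_mult real_sqrt_divide)
  qed
  then have w: "integrable lborel ?w" by simp
  have prod_int: "integrable (?P \<Otimes>\<^sub>M lborel) (\<lambda>(p, x). ?K p * (?w x * iexp (- ((fst p - snd p) * x))))"
  proof (rule PP.Fubini_integrable)
    show "integrable ?P (\<lambda>p. \<integral>x. norm (case (p, x) of (p, x) \<Rightarrow> ?K p * (?w x * iexp (- ((fst p - snd p) * x)))) \<partial>lborel)"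
      using integrable_norm[OF K] by (simp add: norm_mult del: of_real_mult of_real_minus of_real_diff)
    have "integrable lborel (\<lambda>x. ?K p * (?w x * iexp (- ((fst p - snd p) * x))))" for p
      by (intro integrable_mult_right, rule Bochner_Integration.integrable_bound[OF w])
         (auto simp: norm_mult simp del: of_real_mult of_real_minus of_real_diff)
    then show "AE p in ?P. integrable lborel (\<lambda>x. case (p, x) of (p, x) \<Rightarrow> ?K p * (?w x * iexp (- ((fst p - snd p) * x))))"
      by simp
  qed measurable
  have norm_sq: "complex_of_real ((cmod (fourier H x))\<^sup>2) = (\<integral>p. ?K p * iexp (- ((fst p - snd p) * x)) \<partial>?P)" for x
  proof -
    let ?g = "\<lambda>u. H u * iexp (- (u * x))"
    have "complex_of_real ((cmod (fourier H x))\<^sup>2) = (\<integral>u. ?g u \<partial>lborel) * (\<integral>v. cnj (?g v) \<partial>lborel)"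
      unfolding fourier_def by (simp only: Bochner_Integration.integral_cnj complex_norm_square)
    also have "\<dots> = (\<integral>p. ?g (fst p) * cnj (?g (snd p)) \<partial>?P)"
    proof -
      have "integrable ?P (\<lambda>(u, v). ?g u * cnj (?g v))"
        by (intro lborel_pair.Fubini_integrable)
          (auto simp del: of_real_mult of_real_minus complex_cnj_mult
            intro!: integrable_mult_right integrable_mult_left integrable_norm integrable_fourier
            simp: norm_mult[of "?g _" "cnj _"] complex_mod_cnj integrable_cnj)
      then show ?thesis
        by (subst lborel_pair.integral_fst'[symmetric])
           (simp_all add: case_prod_beta' integral_mult_right integrable_fourier integrable_cnj
              del: of_real_mult of_real_minus complex_cnj_mult)
    qed
    also have "\<dots> = (\<integral>p. ?K p * iexp (- ((fst p - snd p) * x)) \<partial>?P)"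
      by (intro Bochner_Integration.integral_cong refl)
         (simp add: exp_cnj algebra_simps flip: exp_add)
    finally show ?thesis .
  qed
  have "complex_of_real (\<integral>x. (cmod (fourier H x))\<^sup>2 * exp (- (\<sigma> * x)\<^sup>2 / 2) \<partial>lborel)
      = (\<integral>x. complex_of_real ((cmod (fourier H x))\<^sup>2) * ?w x \<partial>lborel)"
    by (simp flip: integral_complex_of_real)
  also have "\<dots> = (\<integral>x. (\<integral>p. ?K p * (?w x * iexp (- ((fst p - snd p) * x))) \<partial>?P) \<partial>lborel)"
    unfolding norm_sq
    by (subst integral_mult_left_zero[symmetric]) (simp add: algebra_simps)
  also have "\<dots> = (\<integral>p. (\<integral>x. ?K p * (?w x * iexp (- ((fst p - snd p) * x))) \<partial>lborel) \<partial>?P)"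
    using PP.Fubini_integral[OF prod_int] by simp
  also have "\<dots> = (\<integral>p. ?K p * complex_of_real (2 * pi * normal_density 0 \<sigma> (fst p - snd p)) \<partial>?P)"
    by (simp only: integral_mult_right_zero gaussian_fourier[OF assms])
  finally have eq: "complex_of_real (\<integral>x. (cmod (fourier H x))\<^sup>2 * exp (- (\<sigma> * x)\<^sup>2 / 2) \<partial>lborel) =
      (\<integral>p. ?K p * complex_of_real (2 * pi * normal_density 0 \<sigma> (fst p - snd p)) \<partial>?P)" .
  have int: "integrable ?P (\<lambda>p. ?K p * complex_of_real (2 * pi * normal_density 0 \<sigma> (fst p - snd p)))"
    using PP.integrable_fst'[OF prod_int]
    by (simp only: integral_mult_right_zero gaussian_fourier[OF assms] prod.case)
  have "(\<integral>x. (cmod (fourier H x))\<^sup>2 * exp (- (\<sigma> * x)\<^sup>2 / 2) \<partial>lborel) =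
     (\<integral>p. Re (?K p * complex_of_real (2 * pi * normal_density 0 \<sigma> (fst p - snd p))) \<partial>?P)"
    using arg_cong[OF eq, of Re] integral_Re[OF int] by simp
  also have "\<dots> = (\<integral>p. 2 * pi * (Re (?K p) * normal_density 0 \<sigma> (fst p - snd p)) \<partial>?P)"
    by (intro Bochner_Integration.integral_cong refl) (simp add: algebra_simps)
  finally show "(\<integral>x. (cmod (fourier H x))\<^sup>2 * exp (- (\<sigma> * x)\<^sup>2 / 2) \<partial>lborel) = 2 * pi * ?R"
    by simp
  have "integrable ?P (\<lambda>p. Re (?K p * complex_of_real (2 * pi * normal_density 0 \<sigma> (fst p - snd p))))"
    using int by (rule integrable_Re)
  also have "(\<lambda>p. Re (?K p * complex_of_real (2 * pi * normal_density 0 \<sigma> (fst p - snd p)))) =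
     (\<lambda>p. 2 * pi * (Re (?K p) * normal_density 0 \<sigma> (fst p - snd p)))"
    by (rule ext) (simp add: algebra_simps)
  finally show "integrable ?P (\<lambda>p. Re (?K p) * normal_density 0 \<sigma> (fst p - snd p))"
    by simp
  show "integrable lborel (\<lambda>x. (cmod (fourier H x))\<^sup>2 * exp (- (\<sigma> * x)\<^sup>2 / 2))"
    by (rule Bochner_Integration.integrable_bound[OF integrable_mult_right[OF w_real, of "(\<integral>u. cmod (H u) \<partial>lborel)\<^sup>2"]])
       (auto intro!: mult_right_mono power_mono norm_fourier_le)
qed

lemma
  fixes \<sigma> :: real assumes "0 < \<sigma>"
  shows integrable_norm_sq_conv_normal:
      "integrable (lborel \<Otimes>\<^sub>M lborel) (\<lambda>p. (cmod (H (fst p)))\<^sup>2 * normal_density 0 \<sigma> (fst p - snd p))" (is "integrable ?P ?f")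
    and integral_norm_sq_conv_normal:
      "(\<integral>p. (cmod (H (fst p)))\<^sup>2 * normal_density 0 \<sigma> (fst p - snd p) \<partial>(lborel \<Otimes>\<^sub>M lborel)) = (\<integral>u. (cmod (H u))\<^sup>2 \<partial>lborel)"
proof -
  have n: "normal_density 0 \<sigma> (u - v) = normal_density u \<sigma> v" for u v
    by (simp add: normal_density_def power2_commute)
  show int: "integrable ?P ?f"
  proof (rule lborel_pair.Fubini_integrable)
    show "integrable lborel (\<lambda>u. \<integral>v. norm (?f (u, v)) \<partial>lborel)"
      using assms integrable_H_sq by (simp add: n abs_mult)
    show "AE u in lborel. integrable lborel (\<lambda>v. ?f (u, v))"
      using assms by (simp add: n)
  qed measurable
  show "integral\<^sup>L ?P ?f = (\<integral>u. (cmod (H u))\<^sup>2 \<partial>lborel)"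
    using assms by (subst lborel_pair.integral_fst'[OF int, symmetric]) (simp add: n)
qed

text \<open>
  The half of Plancherel's identity that needs no regularity of \<open>H\<close>. By
  \<open>2 Re (a cnj b) \<le> |a|\<^sup>2 + |b|\<^sup>2\<close> the smoothed kernel has integral at most \<open>\<integral>|H|\<^sup>2\<close> for every \<open>\<sigma>\<close>, and
  Fatou's lemma removes the weight. The estimator is covered although its truncated transform may jump.
\<close>

lemma fourier_L2_le:
  "(\<integral>\<^sup>+x. ennreal ((cmod (fourier H x))\<^sup>2) \<partial>lborel) \<le> ennreal (2 * pi * (\<integral>u. (cmod (H u))\<^sup>2 \<partial>lborel))"
proof -
  let ?P = "lborel \<Otimes>\<^sub>M lborel :: (real \<times> real) measure"
  let ?I = "\<integral>u. (cmod (H u))\<^sup>2 \<partial>lborel"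
  define \<sigma> where "\<sigma> k = 1 / real (Suc k)" for k
  have \<sigma>: "0 < \<sigma> k" for k by (simp add: \<sigma>_def)
  have \<sigma>_lim: "\<sigma> \<longlonglongrightarrow> 0"
    unfolding \<sigma>_def by (rule LIMSEQ_Suc[OF lim_1_over_n])
  have bound: "(\<integral>\<^sup>+x. ennreal ((cmod (fourier H x))\<^sup>2 * exp (- (\<sigma> k * x)\<^sup>2 / 2)) \<partial>lborel) \<le> ennreal (2 * pi * ?I)" for k
  proof -
    let ?n = "\<lambda>p. normal_density 0 (\<sigma> k) (fst p - snd p)"
    have sym: "(\<lambda>p. (cmod (H (snd p)))\<^sup>2 * ?n p) = (\<lambda>(u, v). (cmod (H (fst (v, u))))\<^sup>2 * ?n (v, u))"
      by (auto simp: fun_eq_iff normal_density_def power2_commute)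
    have int2: "integrable ?P (\<lambda>p. (cmod (H (snd p)))\<^sup>2 * ?n p)"
      unfolding sym using lborel_pair.integrable_product_swap[OF integrable_norm_sq_conv_normal[OF \<sigma>]] .
    have I2: "(\<integral>p. (cmod (H (snd p)))\<^sup>2 * ?n p \<partial>?P) = ?I"
      unfolding sym
      by (subst lborel_pair.integral_product_swap) (auto simp: integral_norm_sq_conv_normal[OF \<sigma>])
    have "(\<integral>p. Re (H (fst p) * cnj (H (snd p))) * ?n p \<partial>?P)
       \<le> (\<integral>p. 1 / 2 * ((cmod (H (fst p)))\<^sup>2 * ?n p) + 1 / 2 * ((cmod (H (snd p)))\<^sup>2 * ?n p) \<partial>?P)"
    proof (rule integral_mono)
      fix p :: "real \<times> real"
      have "Re (H (fst p) * cnj (H (snd p))) \<le> cmod (H (fst p)) * cmod (H (snd p))"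
        using complex_Re_le_cmod[of "H (fst p) * cnj (H (snd p))"] by (simp add: norm_mult)
      also have "\<dots> \<le> 1 / 2 * (cmod (H (fst p)))\<^sup>2 + 1 / 2 * (cmod (H (snd p)))\<^sup>2"
        using sum_squares_bound[of "cmod (H (fst p))" "cmod (H (snd p))"] by simp
      finally have "Re (H (fst p) * cnj (H (snd p))) \<le> 1 / 2 * (cmod (H (fst p)))\<^sup>2 + 1 / 2 * (cmod (H (snd p)))\<^sup>2" .
      from mult_right_mono[OF this normal_density_nonneg, of 0 "\<sigma> k" "fst p - snd p"]
      show "Re (H (fst p) * cnj (H (snd p))) * ?n p \<le>
          1 / 2 * ((cmod (H (fst p)))\<^sup>2 * ?n p) + 1 / 2 * ((cmod (H (snd p)))\<^sup>2 * ?n p)"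
        by (simp only: distrib_right mult.assoc)
    qed (intro gaussian_fourier_norm(2)[OF \<sigma>] int2 integrable_norm_sq_conv_normal[OF \<sigma>]
          Bochner_Integration.integrable_add integrable_mult_right)+
    also have "\<dots> = ?I"
      by (subst Bochner_Integration.integral_add)
         (auto intro!: int2 integrable_norm_sq_conv_normal[OF \<sigma>] integrable_mult_right
           simp: I2 integral_norm_sq_conv_normal[OF \<sigma>])
    finally have "(\<integral>x. (cmod (fourier H x))\<^sup>2 * exp (- (\<sigma> k * x)\<^sup>2 / 2) \<partial>lborel) \<le> 2 * pi * ?I"
      unfolding gaussian_fourier_norm(1)[OF \<sigma>] by simp
    then show ?thesis
      by (subst nn_integral_eq_integral[OF gaussian_fourier_norm(3)[OF \<sigma>]]) (auto intro!: ennreal_leI)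
  qed
  have lim: "(\<lambda>k. ennreal ((cmod (fourier H x))\<^sup>2 * exp (- (\<sigma> k * x)\<^sup>2 / 2))) \<longlonglongrightarrow> ennreal ((cmod (fourier H x))\<^sup>2)" for x
  proof -
    have "(\<lambda>k. (cmod (fourier H x))\<^sup>2 * exp (- (\<sigma> k * x)\<^sup>2 / 2)) \<longlonglongrightarrow> (cmod (fourier H x))\<^sup>2 * exp (- (0 * x)\<^sup>2 / 2)"
      by (intro tendsto_intros \<sigma>_lim) auto
    then show ?thesis by simp
  qed
  have "(\<integral>\<^sup>+x. ennreal ((cmod (fourier H x))\<^sup>2) \<partial>lborel)
      = (\<integral>\<^sup>+x. liminf (\<lambda>k. ennreal ((cmod (fourier H x))\<^sup>2 * exp (- (\<sigma> k * x)\<^sup>2 / 2))) \<partial>lborel)"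
    by (intro nn_integral_cong lim_imp_Liminf[OF _ lim, symmetric]) simp
  also have "\<dots> \<le> liminf (\<lambda>k. \<integral>\<^sup>+x. ennreal ((cmod (fourier H x))\<^sup>2 * exp (- (\<sigma> k * x)\<^sup>2 / 2)) \<partial>lborel)"
    by (rule nn_integral_liminf) measurable
  also have "\<dots> \<le> ennreal (2 * pi * ?I)"
    by (intro Liminf_le always_eventually allI bound trivial_limit_sequentially)
  finally show ?thesis .
qed

text \<open>
  The substitution \<open>v = u + \<sigma> z\<close> moves \<open>\<sigma>\<close> from the normal density into the argument of \<open>H\<close>, where
  continuity and dominated convergence take care of it.
\<close>

lemma fourier_L2_ge:
  assumes cont: "AE u in lborel. isCont H u"
  shows "ennreal (2 * pi * (\<integral>u. (cmod (H u))\<^sup>2 \<partial>lborel)) \<le> (\<integral>\<^sup>+x. ennreal ((cmod (fourier H x))\<^sup>2) \<partial>lborel)"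
proof -
  let ?P = "lborel \<Otimes>\<^sub>M lborel :: (real \<times> real) measure"
  let ?I = "\<integral>u. (cmod (H u))\<^sup>2 \<partial>lborel"
  let ?R = "\<lambda>\<sigma>. \<integral>p. Re (H (fst p) * cnj (H (snd p))) * normal_density 0 \<sigma> (fst p - snd p) \<partial>?P"
  define \<sigma> where "\<sigma> k = 1 / real (Suc k)" for k
  have \<sigma>: "0 < \<sigma> k" for k by (simp add: \<sigma>_def)
  have \<sigma>_lim: "\<sigma> \<longlonglongrightarrow> 0"
    unfolding \<sigma>_def by (rule LIMSEQ_Suc[OF lim_1_over_n])
  let ?z = "\<lambda>k u z. Re (H u * cnj (H (u + \<sigma> k * z))) * std_normal_density z"
  have R_eq: "?R (\<sigma> k) = (\<integral>u. (\<integral>z. ?z k u z \<partial>lborel) \<partial>lborel)" for k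
  proof -
    have "?R (\<sigma> k) = (\<integral>u. (\<integral>v. Re (H u * cnj (H v)) * normal_density 0 (\<sigma> k) (u - v) \<partial>lborel) \<partial>lborel)"
      by (subst lborel_pair.integral_fst'[OF gaussian_fourier_norm(2)[OF \<sigma>], symmetric]) simp
    also have "\<dots> = (\<integral>u. (\<integral>z. ?z k u z \<partial>lborel) \<partial>lborel)"
    proof (rule Bochner_Integration.integral_cong[OF refl])
      fix u
      have dens: "\<sigma> k * normal_density 0 (\<sigma> k) (u - (u + \<sigma> k * z)) = std_normal_density z" for z
        using \<sigma>[of k] by (simp add: normal_density_def real_sqrt_mult power_mult_distrib)
      have "(\<integral>v. Re (H u * cnj (H v)) * normal_density 0 (\<sigma> k) (u - v) \<partial>lborel) =
          \<sigma> k * (\<integral>z. Re (H u * cnj (H (u + \<sigma> k * z))) * normal_density 0 (\<sigma> k) (u - (u + \<sigma> k * z)) \<partial>lborel)"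
        using \<sigma>[of k] by (subst lborel_integral_real_affine[of "\<sigma> k" _ u]) (simp_all del: times_complex.simps)
      also have "\<dots> = (\<integral>z. ?z k u z \<partial>lborel)"
        unfolding dens[symmetric] integral_mult_right_zero[symmetric] by (simp only: mult.left_commute)
      finally show "(\<integral>v. Re (H u * cnj (H v)) * normal_density 0 (\<sigma> k) (u - v) \<partial>lborel) = (\<integral>z. ?z k u z \<partial>lborel)" .
    qed
    finally show ?thesis .
  qed
  have zB: "\<bar>?z k u z\<bar> \<le> cmod (H u) * B * std_normal_density z" for k u z
  proof -
    have "\<bar>Re (H u * cnj (H (u + \<sigma> k * z)))\<bar> \<le> cmod (H u) * cmod (H (u + \<sigma> k * z))"
      using abs_Re_le_cmod[of "H u * cnj (H (u + \<sigma> k * z))"] by (simp add: norm_mult)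
    also have "\<dots> \<le> cmod (H u) * B"
      by (intro mult_left_mono H_bound) auto
    finally show ?thesis by (simp add: abs_mult mult_right_mono)
  qed
  have inner: "(\<lambda>k. \<integral>z. ?z k u z \<partial>lborel) \<longlonglongrightarrow> (cmod (H u))\<^sup>2" if "isCont H u" for u
  proof -
    have "(\<lambda>k. \<integral>z. ?z k u z \<partial>lborel) \<longlonglongrightarrow> (\<integral>z. Re (H u * cnj (H u)) * std_normal_density z \<partial>lborel)"
    proof (rule integral_dominated_convergence[where w = "\<lambda>z. cmod (H u) * B * std_normal_density z"])
      have "(\<lambda>k. ?z k u z) \<longlonglongrightarrow> Re (H u * cnj (H u)) * std_normal_density z" for z
      proof -
        have "(\<lambda>k. u + \<sigma> k * z) \<longlonglongrightarrow> u + 0 * z" by (intro tendsto_intros \<sigma>_lim)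
        then have "(\<lambda>k. H (u + \<sigma> k * z)) \<longlonglongrightarrow> H u"
          by (intro isCont_tendsto_compose[OF that]) simp
        then show ?thesis by (intro tendsto_intros)
      qed
      then show "AE z in lborel. (\<lambda>k. ?z k u z) \<longlonglongrightarrow> Re (H u * cnj (H u)) * std_normal_density z" by simp
      show "AE z in lborel. norm (?z k u z) \<le> cmod (H u) * B * std_normal_density z" for k
        using zB by (intro AE_I2) (simp only: real_norm_def)
    qed (auto simp del: times_complex.simps)
    also have "(\<integral>z. Re (H u * cnj (H u)) * std_normal_density z \<partial>lborel) = (cmod (H u))\<^sup>2"
      by (simp only: integral_mult_right_zero complex_norm_square[symmetric]) simp
    finally show ?thesis .
  qed
  have "(\<lambda>k. \<integral>u. (\<integral>z. ?z k u z \<partial>lborel) \<partial>lborel) \<longlonglongrightarrow> ?I"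
  proof (rule integral_dominated_convergence[where w = "\<lambda>u. cmod (H u) * B"])
    show "AE u in lborel. norm (\<integral>z. ?z k u z \<partial>lborel) \<le> cmod (H u) * B" for k
    proof (rule AE_I2)
      fix u
      have "norm (\<integral>z. ?z k u z \<partial>lborel) \<le> (\<integral>z. cmod (H u) * B * std_normal_density z \<partial>lborel)"
      proof (rule Bochner_Integration.integral_norm_bound_integral)
        show int_b: "integrable lborel (\<lambda>z. cmod (H u) * B * std_normal_density z)" by auto
        show "integrable lborel (?z k u)"
          by (rule Bochner_Integration.integrable_bound[OF int_b], measurable)
             (intro AE_I2, subst real_norm_def, rule order_trans[OF zB abs_ge_self[of "cmod (H u) * B * _", unfolded real_norm_def[symmetric]]])
        show "norm (?z k u z) \<le> cmod (H u) * B * std_normal_density z" for z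
          using zB by (simp only: real_norm_def)
      qed
      then show "norm (\<integral>z. ?z k u z \<partial>lborel) \<le> cmod (H u) * B" by simp
    qed
    show "AE u in lborel. (\<lambda>k. \<integral>z. ?z k u z \<partial>lborel) \<longlonglongrightarrow> (cmod (H u))\<^sup>2"
      using cont by eventually_elim (rule inner)
    show "integrable lborel (\<lambda>u. cmod (H u) * B)"
      using integrable_H by simp
  qed measurable
  then have "(\<lambda>k. ennreal (2 * pi * ?R (\<sigma> k))) \<longlonglongrightarrow> ennreal (2 * pi * ?I)"
    unfolding R_eq by (intro tendsto_intros)
  moreover have "ennreal (2 * pi * ?R (\<sigma> k)) \<le> (\<integral>\<^sup>+x. ennreal ((cmod (fourier H x))\<^sup>2) \<partial>lborel)" for k
  proof -
    have "ennreal (2 * pi * ?R (\<sigma> k)) = (\<integral>\<^sup>+x. ennreal ((cmod (fourier H x))\<^sup>2 * exp (- (\<sigma> k * x)\<^sup>2 / 2)) \<partial>lborel)"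
      unfolding gaussian_fourier_norm(1)[OF \<sigma>, symmetric]
      by (rule nn_integral_eq_integral[OF gaussian_fourier_norm(3)[OF \<sigma>], symmetric]) simp
    also have "\<dots> \<le> (\<integral>\<^sup>+x. ennreal ((cmod (fourier H x))\<^sup>2) \<partial>lborel)"
      by (intro nn_integral_mono ennreal_leI) (simp add: mult_left_le)
    finally show ?thesis .
  qed
  ultimately show ?thesis
    by (intro LIMSEQ_le_const2) auto
qed

text \<open>
  Parseval's identity against an integrable function, by Fubini's theorem.
\<close>

lemma integral_mult_fourier:
  assumes f: "integrable lborel (f :: real \<Rightarrow> real)"
  shows "(\<integral>x. complex_of_real (f x) * fourier H x \<partial>lborel) =
    (\<integral>u. H u * cnj (\<integral>x. complex_of_real (f x) * iexp (u * x) \<partial>lborel) \<partial>lborel)"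
proof -
  let ?F = "\<lambda>x u. complex_of_real (f x) * (H u * iexp (- (u * x)))"
  have f_meas [measurable]: "f \<in> borel_measurable borel"
    using f by (auto dest: borel_measurable_integrable)
  have int: "integrable (lborel \<Otimes>\<^sub>M lborel) (\<lambda>(x, u). ?F x u)"
  proof (rule lborel_pair.Fubini_integrable)
    show "integrable lborel (\<lambda>x. \<integral>u. norm (case (x, u) of (x, u) \<Rightarrow> ?F x u) \<partial>lborel)"
      using integrable_mult_left[OF integrable_abs[OF f]] by (simp add: norm_mult del: of_real_mult of_real_minus)
    show "AE x in lborel. integrable lborel (\<lambda>u. case (x, u) of (x, u) \<Rightarrow> ?F x u)"
      using integrable_fourier by (simp del: of_real_mult of_real_minus)
  qed measurable
  have "(\<integral>x. complex_of_real (f x) * fourier H x \<partial>lborel) = (\<integral>x. (\<integral>u. ?F x u \<partial>lborel) \<partial>lborel)"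
    unfolding fourier_def by (simp only: integral_mult_right_zero)
  also have "\<dots> = (\<integral>u. (\<integral>x. ?F x u \<partial>lborel) \<partial>lborel)"
    using lborel_pair.Fubini_integral[OF int] by simp
  also have "\<dots> = (\<integral>u. H u * cnj (\<integral>x. complex_of_real (f x) * iexp (u * x) \<partial>lborel) \<partial>lborel)"
    unfolding Bochner_Integration.integral_cnj[symmetric] integral_mult_right_zero[symmetric]
    by (intro Bochner_Integration.integral_cong refl) (simp add: exp_cnj algebra_simps)
  finally show ?thesis .
qed

lemma integrable_fourier_sq: "integrable lborel (\<lambda>x. (cmod (fourier H x))\<^sup>2)"
  by (rule integrableI_nonneg) (use le_less_trans[OF fourier_L2_le ennreal_less_top] in auto)

lemma integral_fourier_sq_le:
  "(\<integral>x. (cmod (fourier H x))\<^sup>2 \<partial>lborel) \<le> 2 * pi * (\<integral>u. (cmod (H u))\<^sup>2 \<partial>lborel)"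
  using fourier_L2_le by (subst (asm) nn_integral_eq_integral[OF integrable_fourier_sq]) auto

lemma integral_fourier_sq_eq:
  assumes "AE u in lborel. isCont H u"
  shows "(\<integral>x. (cmod (fourier H x))\<^sup>2 \<partial>lborel) = 2 * pi * (\<integral>u. (cmod (H u))\<^sup>2 \<partial>lborel)"
proof (rule antisym[OF integral_fourier_sq_le])
  show "2 * pi * (\<integral>u. (cmod (H u))\<^sup>2 \<partial>lborel) \<le> (\<integral>x. (cmod (fourier H x))\<^sup>2 \<partial>lborel)"
    using fourier_L2_ge[OF assms] by (subst (asm) nn_integral_eq_integral[OF integrable_fourier_sq]) auto
qed

lemma L2_distance_fourier:
  fixes f :: "real \<Rightarrow> real"
  assumes f: "integrable lborel f" and f2: "integrable lborel (\<lambda>x. (f x)\<^sup>2)"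
  defines "\<phi> \<equiv> \<lambda>u. \<integral>x. complex_of_real (f x) * iexp (u * x) \<partial>lborel"
  shows "integrable lborel (\<lambda>x. (cmod (1 / (2 * pi) * fourier H x - f x))\<^sup>2)" (is ?int)
    and "(\<integral>x. (cmod (1 / (2 * pi) * fourier H x - f x))\<^sup>2 \<partial>lborel) =
      1 / (4 * pi\<^sup>2) * (\<integral>x. (cmod (fourier H x))\<^sup>2 \<partial>lborel)
      - 1 / pi * Re (\<integral>u. H u * cnj (\<phi> u) \<partial>lborel) + (\<integral>x. (f x)\<^sup>2 \<partial>lborel)" (is ?eq)
proof -
  let ?g = "\<lambda>x. complex_of_real (f x) * fourier H x"
  have [measurable]: "f \<in> borel_measurable borel"
    using f by (auto dest: borel_measurable_integrable)
  have g: "integrable lborel ?g"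
    by (rule Bochner_Integration.integrable_bound[OF integrable_mult_right[OF f, of "\<integral>u. cmod (H u) \<partial>lborel"]], measurable)
       (auto simp: norm_mult abs_mult mult.commute intro!: AE_I2 mult_left_mono norm_fourier_le)
  have expand: "(cmod (1 / (2 * pi) * fourier H x - f x))\<^sup>2 =
      1 / (4 * pi\<^sup>2) * (cmod (fourier H x))\<^sup>2 - 1 / pi * Re (?g x) + (f x)\<^sup>2" for x
    unfolding cmod_power2 by (simp add: power2_eq_square field_simps)
  show ?int
    unfolding expand
    by (intro Bochner_Integration.integrable_add Bochner_Integration.integrable_diff integrable_mult_right
        integrable_Re g f2 integrable_fourier_sq)
  have "(\<integral>x. (cmod (1 / (2 * pi) * fourier H x - f x))\<^sup>2 \<partial>lborel) =
      1 / (4 * pi\<^sup>2) * (\<integral>x. (cmod (fourier H x))\<^sup>2 \<partial>lborel)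
      - 1 / pi * (\<integral>x. Re (?g x) \<partial>lborel) + (\<integral>x. (f x)\<^sup>2 \<partial>lborel)"
    unfolding expand using integrable_Re[OF g] f2 integrable_fourier_sq
    by (simp del: times_complex.simps Re_complex_of_real)
  also have "(\<integral>x. Re (?g x) \<partial>lborel) = Re (\<integral>u. H u * cnj (\<phi> u) \<partial>lborel)"
    unfolding integral_Re[OF g] integral_mult_fourier[OF f] \<phi>_def ..
  finally show ?eq .
qed

end

lemma fourier_cutoff_eq:
  assumes "0 \<le> m"
  shows "fourier_cutoff \<psi> m x = 1 / (2 * pi) * fourier (\<lambda>u. indicator {-m<..<m} u *\<^sub>R \<psi> u) x"
proof -
  have "(CLBINT u=-m..m. iexp (- (u * x)) * \<psi> u) = (CLBINT u:{-m<..<m}. iexp (- (u * x)) * \<psi> u)"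
    using assms by (simp add: interval_lebesgue_integral_def)
  also have "\<dots> = fourier (\<lambda>u. indicator {-m<..<m} u *\<^sub>R \<psi> u) x"
    unfolding fourier_def set_lebesgue_integral_def
    by (intro Bochner_Integration.integral_cong refl) (simp add: mult.commute scaleR_conv_of_real)
  finally show ?thesis
    unfolding fourier_cutoff_def by simp
qed

lemma bounded_support_cutoff:
  assumes "\<psi> \<in> borel_measurable borel" "\<And>u. cmod (\<psi> u) \<le> B"
  shows "bounded_support (\<lambda>u. indicator {-m<..<m} u *\<^sub>R \<psi> u) m B"
proof
  show "cmod (indicator {-m<..<m} u *\<^sub>R \<psi> u) \<le> B" for u
    using assms(2)[of u] order_trans[OF norm_ge_zero assms(2)[of u]] by (auto simp: indicator_def)
qed (use assms in \<open>auto simp: indicator_def\<close>)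

lemma AE_isCont_cutoff:
  fixes m :: real
  assumes "\<And>u. isCont \<psi> u"
  shows "AE u in lborel. isCont (\<lambda>u. indicator {-m<..<m} u *\<^sub>R \<psi> u :: complex) u"
proof -
  have "{-m, m :: real} \<in> null_sets lborel"
    by (intro finite_imp_null_set_lborel) auto
  then have "AE u in lborel. u \<notin> {-m, m}"
    by (rule AE_not_in)
  then show ?thesis
  proof eventually_elim
    case (elim u)
    show ?case
    proof (cases "u \<in> {-m<..<m}")
      case True
      have "eventually (\<lambda>v. v \<in> {-m<..<m}) (nhds u)"
        using True by (intro eventually_nhds_in_open) auto
      then have "eventually (\<lambda>v. indicator {-m<..<m} v *\<^sub>R \<psi> v = \<psi> v) (nhds u)"
        by eventually_elim simp
      from isCont_cong[OF this] show ?thesis using assms by simp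
    next
      case False
      then have "u \<in> - {-m..m}" using elim by auto
      then have "eventually (\<lambda>v. v \<in> - {-m..m}) (nhds u)"
        by (intro eventually_nhds_in_open) auto
      then have "eventually (\<lambda>v. indicator {-m<..<m} v *\<^sub>R \<psi> v = 0) (nhds u)"
        by eventually_elim auto
      from isCont_cong[OF this] show ?thesis by simp
    qed
  qed
qed

locale density_transform =
  fixes f :: "real \<Rightarrow> real" and \<phi> :: "real \<Rightarrow> complex"
  assumes f_integrable: "integrable lborel f"
    and transform: "\<And>u. \<phi> u = (\<integral>x. complex_of_real (f x) * iexp (u * x) \<partial>lborel)"
    and \<phi>_cont: "\<And>u. isCont \<phi> u"
    and \<phi>_bound: "\<And>u. cmod (\<phi> u) \<le> 1"
begin

lemma \<phi>_measurable [measurable]: "\<phi> \<in> borel_measurable borel"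
  by (intro borel_measurable_continuous_onI continuous_at_imp_continuous_on ballI \<phi>_cont)

lemma f_measurable [measurable]: "f \<in> borel_measurable borel"
  using f_integrable by (auto dest: borel_measurable_integrable)

abbreviation cut :: "real \<Rightarrow> (real \<Rightarrow> complex) \<Rightarrow> real \<Rightarrow> complex" where
  "cut m \<psi> \<equiv> \<lambda>u. indicator {-m<..<m} u *\<^sub>R \<psi> u"

lemma cutoff_phi: "bounded_support (cut m \<phi>) m 1"
  by (rule bounded_support_cutoff[OF \<phi>_measurable \<phi>_bound])

lemma inner_cut: "Re (\<integral>u. cut m \<phi> u * cnj (\<phi> u) \<partial>lborel) = (\<integral>u. (cmod (cut m \<phi> u))\<^sup>2 \<partial>lborel)"
proof -
  have "(\<integral>u. cut m \<phi> u * cnj (\<phi> u) \<partial>lborel) = (\<integral>u. complex_of_real ((cmod (cut m \<phi> u))\<^sup>2) \<partial>lborel)"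
    unfolding complex_norm_square by (intro Bochner_Integration.integral_cong refl) (auto simp: indicator_def)
  then show ?thesis by (simp only: integral_complex_of_real Re_complex_of_real)
qed

text \<open>
  Bessel's inequality: the squared distance of \<open>f\<close> from its band-limited part is nonnegative.
\<close>

lemma integral_phi_sq_le:
  assumes f2: "integrable lborel (\<lambda>x. (f x)\<^sup>2)"
  shows "(\<integral>u. (cmod (cut m \<phi> u))\<^sup>2 \<partial>lborel) \<le> 2 * pi * (\<integral>x. (f x)\<^sup>2 \<partial>lborel)"
proof -
  interpret bounded_support "cut m \<phi>" m 1 by (rule cutoff_phi)
  let ?I = "\<integral>u. (cmod (cut m \<phi> u))\<^sup>2 \<partial>lborel" and ?F = "\<integral>x. (cmod (fourier (cut m \<phi>) x))\<^sup>2 \<partial>lborel"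
  have "0 \<le> (\<integral>x. (cmod (1 / (2 * pi) * fourier (cut m \<phi>) x - f x))\<^sup>2 \<partial>lborel)"
    by simp
  also have "\<dots> = 1 / (4 * pi\<^sup>2) * ?F - 1 / pi * ?I + (\<integral>x. (f x)\<^sup>2 \<partial>lborel)"
    by (simp only: L2_distance_fourier(2)[OF f_integrable f2] transform[symmetric] inner_cut)
  also have "1 / (4 * pi\<^sup>2) * ?F \<le> 1 / (4 * pi\<^sup>2) * (2 * pi * ?I)"
    by (intro mult_left_mono integral_fourier_sq_le) auto
  finally show ?thesis by (simp add: field_simps power2_eq_square)
qed

text \<open>
  The band-limited part is square integrable, so its difference to \<open>f\<close> is so only if \<open>f\<close> is.
\<close>

lemma L2_not_finite:
  assumes m: "0 \<le> m" and f2: "\<not> integrable lborel (\<lambda>x. (f x)\<^sup>2)"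
  shows "L2_norm_sq (\<lambda>x. fourier_cutoff \<phi> m x - complex_of_real (f x)) = \<infinity>"
proof (rule ccontr)
  interpret bounded_support "cut m \<phi>" m 1 by (rule cutoff_phi)
  let ?g = "\<lambda>x. 1 / (2 * pi) * fourier (cut m \<phi>) x"
  assume "L2_norm_sq (\<lambda>x. fourier_cutoff \<phi> m x - complex_of_real (f x)) \<noteq> \<infinity>"
  then have "integrable lborel (\<lambda>x. (cmod (?g x - f x))\<^sup>2)"
    by (intro integrableI_nonneg) (auto simp: L2_norm_sq_def fourier_cutoff_eq[OF m] top.not_eq_extremum)
  then have int: "integrable lborel (\<lambda>x. 2 * ((cmod (fourier (cut m \<phi>) x))\<^sup>2 / (4 * pi\<^sup>2)) + 2 * (cmod (?g x - f x))\<^sup>2)"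
    using integrable_fourier_sq by (auto simp del: of_real_mult)
  have "integrable lborel (\<lambda>x. (f x)\<^sup>2)"
  proof (rule Bochner_Integration.integrable_bound[OF int], measurable, rule AE_I2)
    fix x
    have "(f x)\<^sup>2 = (cmod (?g x - (?g x - f x)))\<^sup>2" by simp
    also have "\<dots> \<le> (cmod (?g x) + cmod (?g x - f x))\<^sup>2"
      by (intro power_mono norm_triangle_ineq4) auto
    also have "\<dots> \<le> 2 * (cmod (?g x))\<^sup>2 + 2 * (cmod (?g x - f x))\<^sup>2"
      using sum_squares_bound[of "cmod (?g x)" "cmod (?g x - f x)"] by (simp add: power2_sum)
    also have "(cmod (?g x))\<^sup>2 = (cmod (fourier (cut m \<phi>) x))\<^sup>2 / (4 * pi\<^sup>2)"
      by (simp add: norm_mult norm_divide power_divide power_mult_distrib)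
    finally show "norm ((f x)\<^sup>2) \<le> norm (2 * ((cmod (fourier (cut m \<phi>) x))\<^sup>2 / (4 * pi\<^sup>2)) + 2 * (cmod (?g x - f x))\<^sup>2)"
      by simp
  qed
  with f2 show False ..
qed

text \<open>
  Pythagoras. For \<open>\<psi>\<close> the upper half of Plancherel's identity suffices; equality is needed only for \<open>\<phi>\<close>,
  which is continuous. The inner products with \<open>f\<close> are computed by Parseval's identity, and completing the
  square on the Fourier side leaves the integral of \<open>|\<psi> - \<phi>|\<^sup>2\<close>.
\<close>

lemma L2_risk_le:
  assumes m: "0 \<le> m" and \<psi> [measurable]: "\<psi> \<in> borel_measurable borel" and B: "\<And>u. cmod (\<psi> u) \<le> B"
  shows "L2_norm_sq (\<lambda>x. fourier_cutoff \<psi> m x - complex_of_real (f x)) \<le>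
    L2_norm_sq (\<lambda>x. fourier_cutoff \<phi> m x - complex_of_real (f x)) +
    ennreal (1 / (2 * pi)) * (\<integral>\<^sup>+u. ennreal ((cmod (\<psi> u - \<phi> u))\<^sup>2) * indicator {-m<..<m} u \<partial>lborel)"
proof (cases "integrable lborel (\<lambda>x. (f x)\<^sup>2)")
  case False
  then show ?thesis using L2_not_finite[OF m] by simp
next
  case f2: True
  interpret P: bounded_support "cut m \<phi>" m 1 by (rule cutoff_phi)
  interpret H: bounded_support "cut m \<psi>" m B by (rule bounded_support_cutoff[OF \<psi> B])
  interpret D: bounded_support "cut m (\<lambda>u. \<psi> u - \<phi> u)" m "B + 1"
    by (rule bounded_support_cutoff) (use B \<phi>_bound norm_triangle_le_diff add_mono in \<open>auto, blast\<close>)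
  have L2: "L2_norm_sq (\<lambda>x. fourier_cutoff \<psi>' m x - complex_of_real (f x)) =
      ennreal (1 / (4 * pi\<^sup>2) * (\<integral>x. (cmod (fourier (cut m \<psi>') x))\<^sup>2 \<partial>lborel)
      - 1 / pi * Re (\<integral>u. cut m \<psi>' u * cnj (\<phi> u) \<partial>lborel) + (\<integral>x. (f x)\<^sup>2 \<partial>lborel))"
    if "bounded_support (cut m \<psi>') m B'" for \<psi>' B'
    unfolding L2_norm_sq_def fourier_cutoff_eq[OF m]
    by (subst nn_integral_eq_integral[OF bounded_support.L2_distance_fourier(1)[OF that f_integrable f2]])
       (simp_all only: bounded_support.L2_distance_fourier(2)[OF that f_integrable f2] transform[symmetric]
          AE_I2 zero_le_power2)
  let ?I\<phi> = "\<integral>u. (cmod (cut m \<phi> u))\<^sup>2 \<partial>lborel" and ?I\<psi> = "\<integral>u. (cmod (cut m \<psi> u))\<^sup>2 \<partial>lborel"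
  let ?ID = "\<integral>u. (cmod (cut m (\<lambda>u. \<psi> u - \<phi> u) u))\<^sup>2 \<partial>lborel"
  have prod: "integrable lborel (\<lambda>u. cut m \<psi> u * cnj (\<phi> u))"
    by (rule Bochner_Integration.integrable_bound[OF H.integrable_H])
       (auto simp: norm_mult intro!: AE_I2 mult_left_mono mult_left_le \<phi>_bound)
  have norm_diff_sq: "(cmod (a - b))\<^sup>2 = (cmod a)\<^sup>2 + (cmod b)\<^sup>2 - 2 * Re (a * cnj b)" for a b
    unfolding cmod_power2 by (simp add: power2_eq_square algebra_simps)
  have "?ID = (\<integral>u. (cmod (cut m \<psi> u))\<^sup>2 + (cmod (cut m \<phi> u))\<^sup>2 - 2 * Re (cut m \<psi> u * cnj (\<phi> u)) \<partial>lborel)"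
    by (intro Bochner_Integration.integral_cong refl)
       (auto simp: indicator_def norm_diff_sq)
  also have "\<dots> = ?I\<psi> + ?I\<phi> - 2 * Re (\<integral>u. cut m \<psi> u * cnj (\<phi> u) \<partial>lborel)"
    unfolding integral_Re[OF prod, symmetric] using integrable_Re[OF prod] H.integrable_H_sq P.integrable_H_sq
    by (simp del: times_complex.simps norm_scaleR)
  finally have ID: "?ID = ?I\<psi> + ?I\<phi> - 2 * Re (\<integral>u. cut m \<psi> u * cnj (\<phi> u) \<partial>lborel)" .
  have "L2_norm_sq (\<lambda>x. fourier_cutoff \<psi> m x - complex_of_real (f x)) \<le>
      ennreal (1 / (4 * pi\<^sup>2) * (2 * pi * ?I\<psi>) - 1 / pi * Re (\<integral>u. cut m \<psi> u * cnj (\<phi> u) \<partial>lborel) + (\<integral>x. (f x)\<^sup>2 \<partial>lborel))"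
    unfolding L2[OF H.bounded_support_axioms]
    by (intro ennreal_leI add_right_mono diff_right_mono mult_left_mono H.integral_fourier_sq_le) auto
  also have "1 / (4 * pi\<^sup>2) * (2 * pi * ?I\<psi>) - 1 / pi * Re (\<integral>u. cut m \<psi> u * cnj (\<phi> u) \<partial>lborel) + (\<integral>x. (f x)\<^sup>2 \<partial>lborel)
     = (1 / (4 * pi\<^sup>2) * (2 * pi * ?I\<phi>) - 1 / pi * ?I\<phi> + (\<integral>x. (f x)\<^sup>2 \<partial>lborel)) + 1 / (2 * pi) * ?ID"
    unfolding ID by (simp add: field_simps power2_eq_square)
  also have "ennreal \<dots> = L2_norm_sq (\<lambda>x. fourier_cutoff \<phi> m x - complex_of_real (f x)) + ennreal (1 / (2 * pi) * ?ID)"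
    unfolding L2[OF P.bounded_support_axioms] inner_cut P.integral_fourier_sq_eq[OF AE_isCont_cutoff[OF \<phi>_cont]]
    using integral_phi_sq_le[OF f2, of m]
    by (subst ennreal_plus) (auto simp: field_simps power2_eq_square)
  also have "ennreal (1 / (2 * pi) * ?ID) = ennreal (1 / (2 * pi)) * (\<integral>\<^sup>+u. ennreal ((cmod (\<psi> u - \<phi> u))\<^sup>2) * indicator {-m<..<m} u \<partial>lborel)"
  proof -
    have "(\<integral>\<^sup>+u. ennreal ((cmod (\<psi> u - \<phi> u))\<^sup>2) * indicator {-m<..<m} u \<partial>lborel) =
        (\<integral>\<^sup>+u. ennreal ((cmod (cut m (\<lambda>u. \<psi> u - \<phi> u) u))\<^sup>2) \<partial>lborel)"
      by (intro nn_integral_cong) (auto simp: indicator_def)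
    also have "\<dots> = ennreal ?ID"
      by (rule nn_integral_eq_integral[OF D.integrable_H_sq]) simp
    finally have e: "(\<integral>\<^sup>+u. ennreal ((cmod (\<psi> u - \<phi> u))\<^sup>2) * indicator {-m<..<m} u \<partial>lborel) = ennreal ?ID" .
    show ?thesis unfolding e by (rule ennreal_mult) auto
  qed
  finally show ?thesis .
qed

end

section \<open>Characteristic functions that stay away from $-1$\<close>

lemma abs_sin_mult_le: "\<bar>sin (real k * s)\<bar> \<le> real k * \<bar>sin s\<bar>"
proof (induction k)
  case (Suc k)
  have "sin (real (Suc k) * s) = sin (real k * s) * cos s + cos (real k * s) * sin s"
    by (simp add: algebra_simps sin_add)
  also have "\<bar>\<dots>\<bar> \<le> \<bar>sin (real k * s)\<bar> * \<bar>cos s\<bar> + \<bar>cos (real k * s)\<bar> * \<bar>sin s\<bar>"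
    using abs_triangle_ineq by (simp flip: abs_mult)
  also have "\<dots> \<le> \<bar>sin (real k * s)\<bar> * 1 + 1 * \<bar>sin s\<bar>"
    by (intro add_mono mult_left_mono mult_right_mono) auto
  finally show ?case using Suc by (simp add: algebra_simps)
qed simp

lemma one_minus_cos_mult_le: "1 - cos (real k * t) \<le> (real k)\<^sup>2 * (1 - cos t)"
proof -
  have half: "1 - cos x = 2 * (sin (x / 2))\<^sup>2" for x :: real
    using cos_double_sin[of "x / 2"] by simp
  have "(sin (real k * (t / 2)))\<^sup>2 \<le> (real k * \<bar>sin (t / 2)\<bar>)\<^sup>2"
    using abs_sin_mult_le[of k "t / 2"] by (metis abs_ge_zero power2_abs power_mono)
  then show ?thesis unfolding half by (simp add: power_mult_distrib)
qed

lemma one_minus_cos_double_le: "1 - cos (2 * t) \<le> 4 * (1 + cos (t::real))"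
proof -
  have "1 - cos (2 * t) = 2 * (1 - cos t) * (1 + cos t)"
    unfolding cos_double_cos by (simp add: algebra_simps power2_eq_square)
  also have "\<dots> \<le> 2 * 2 * (1 + cos t)"
  proof (intro mult_right_mono mult_left_mono)
    show "0 \<le> 1 + cos t" using cos_ge_minus_one[of t] by linarith
    show "1 - cos t \<le> 2" using cos_ge_minus_one[of t] by linarith
  qed auto
  finally show ?thesis by simp
qed

lemma exp_lipschitz_left_halfplane:
  assumes "Re a \<le> 0" "Re b \<le> 0"
  shows "cmod (exp a - exp b) \<le> cmod (a - b)"
proof -
  have "cmod (exp a - exp b) \<le> 1 * cmod (a - b)"
  proof (rule field_differentiable_bound[where S = "{z. Re z \<le> 0}" and f' = exp])
    show "convex {z. Re z \<le> 0}" by (rule convex_halfspace_Re_le)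
    show "(exp has_field_derivative exp z) (at z within {z. Re z \<le> 0})" for z :: complex
      by (rule DERIV_exp[THEN has_field_derivative_at_within])
  qed (use assms in auto)
  then show ?thesis by simp
qed

lemma cmod_iexp_diff_le: "cmod (iexp (u * x) - iexp (v * x)) \<le> \<bar>x\<bar> * \<bar>u - v\<bar>"
proof -
  have "cmod (iexp (u * x) - iexp (v * x)) \<le> cmod (\<i> * complex_of_real (u * x) - \<i> * complex_of_real (v * x))"
    by (rule exp_lipschitz_left_halfplane) auto
  also have "\<dots> = cmod (\<i> * complex_of_real ((u - v) * x))" by (simp add: algebra_simps)
  finally show ?thesis by (simp only: norm_mult norm_ii norm_of_real abs_mult) (simp add: mult.commute)
qed

context real_distribution
begin

lemma char_minus: "char M (- u) = cnj (char M u)"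
  unfolding char_def Bochner_Integration.integral_cnj[symmetric]
  by (intro Bochner_Integration.integral_cong refl) (simp add: exp_cnj)

lemma Re_char: "Re (char M u) = (\<integral>x. cos (u * x) \<partial>M)"
proof -
  have "integrable M (\<lambda>x. iexp (u * x))"
    by (rule integrable_const_bound[of _ 1]) auto
  then show ?thesis unfolding char_def
    by (subst integral_Re[symmetric]) (auto simp: Re_exp)
qed

lemma integrable_cos: "integrable M (\<lambda>x. cos (u * x))"
  by (rule integrable_const_bound[of _ 1]) auto

lemma one_minus_Re_char_mult_le:
  "1 - Re (char M (real k * u)) \<le> (real k)\<^sup>2 * (1 - Re (char M u))"
proof -
  have "1 - Re (char M (real k * u)) = (\<integral>x. 1 - cos (real k * (u * x)) \<partial>M)"
    using integrable_cos[of "real k * u"] prob_space unfolding Re_char by (simp add: mult.assoc)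
  also have "\<dots> \<le> (\<integral>x. (real k)\<^sup>2 * (1 - cos (u * x)) \<partial>M)"
    using integrable_cos[of "real k * u"] integrable_cos[of u]
    by (intro integral_mono one_minus_cos_mult_le) (auto simp: mult.assoc)
  also have "\<dots> = (real k)\<^sup>2 * (1 - Re (char M u))"
    using integrable_cos[of u] prob_space unfolding Re_char by simp
  finally show ?thesis .
qed

lemma one_minus_Re_char_double_le: "1 - Re (char M (2 * u)) \<le> 4 * (1 + Re (char M u))"
proof -
  have "1 - Re (char M (2 * u)) = (\<integral>x. 1 - cos (2 * (u * x)) \<partial>M)"
    using integrable_cos[of "2 * u"] prob_space unfolding Re_char by (simp add: mult.assoc)
  also have "\<dots> \<le> (\<integral>x. 4 * (1 + cos (u * x)) \<partial>M)"
    using integrable_cos[of "2 * u"] integrable_cos[of u]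
    by (intro integral_mono one_minus_cos_double_le) (auto simp: mult.assoc)
  also have "\<dots> = 4 * (1 + Re (char M u))"
    using integrable_cos[of u] prob_space unfolding Re_char by simp
  finally show ?thesis .
qed

lemma char_lipschitz:
  assumes "integrable M (\<lambda>x. \<bar>x\<bar>)"
  shows "cmod (char M u - char M v) \<le> (\<integral>x. \<bar>x\<bar> \<partial>M) * \<bar>u - v\<bar>"
proof -
  have int: "integrable M (\<lambda>x. iexp (t * x))" for t
    by (rule integrable_const_bound[of _ 1]) auto
  have "cmod (char M u - char M v) = cmod (\<integral>x. iexp (u * x) - iexp (v * x) \<partial>M)"
    unfolding char_def by (subst Bochner_Integration.integral_diff) (use int in auto)
  also have "\<dots> \<le> (\<integral>x. \<bar>x\<bar> * \<bar>u - v\<bar> \<partial>M)"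
    by (rule Bochner_Integration.integral_norm_bound_integral)
       (use cmod_iexp_diff_le int assms in \<open>auto simp del: of_real_mult\<close>)
  finally show ?thesis by simp
qed

text \<open>
  If \<open>Re \<phi>(u)\<close> is close to \<open>-1\<close>, then \<open>u X\<close> is mostly close to an odd multiple of \<open>\<pi>\<close>, so that \<open>\<phi>\<close> is close to
  \<open>1\<close> at \<open>2 k u\<close> for \<open>k = 1, \<dots>, L\<close>, and still at least \<open>1/2\<close> in modulus at distance \<open>r\<close> from these points
  by the Lipschitz bound. These \<open>L\<close> neighbourhoods are disjoint, because \<open>u\<close> itself cannot be near \<open>0\<close>. Together they
  contribute \<open>L r / 2\<close> to the integral of \<open>|\<phi>|\<^sup>2\<close>, which exceeds \<open>D\<close> if \<open>L\<close> is large.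
\<close>

lemma Re_char_bounded_below:
  assumes abs: "integrable M (\<lambda>x. \<bar>x\<bar>)"
    and L2: "\<And>m. (\<integral>\<^sup>+u. ennreal ((cmod (char M u))\<^sup>2) * indicator {-m<..<m} u \<partial>lborel) \<le> ennreal D"
  shows "\<exists>\<delta>>0. \<forall>u. \<delta> - 1 \<le> Re (char M u)"
proof -
  define \<mu> where "\<mu> = (\<integral>x. \<bar>x\<bar> \<partial>M)"
  have \<mu>: "0 \<le> \<mu>" by (simp add: \<mu>_def)
  define r where "r = 1 / (4 * (\<mu> + 1))"
  have r: "0 < r" "\<mu> * r \<le> 1 / 4" using \<mu> by (auto simp: r_def field_simps)
  obtain L :: nat where L: "2 * \<bar>D\<bar> / r < real L" using reals_Archimedean2 by blast
  define \<delta> where "\<delta> = 1 / (16 * (real L + 1)\<^sup>2)"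
  have \<delta>: "0 < \<delta>" "\<delta> \<le> 1" by (auto simp: \<delta>_def divide_le_eq intro: order_trans[of _ "(real L + 1)\<^sup>2"])
  have "\<delta> - 1 \<le> Re (char M u)" for u
  proof (rule ccontr)
    assume "\<not> \<delta> - 1 \<le> Re (char M u)"
    then have u: "1 + Re (char M u) < \<delta>" by simp
    have u_far: "r < \<bar>u\<bar>"
    proof (rule ccontr)
      assume "\<not> r < \<bar>u\<bar>"
      then have "\<mu> * \<bar>u\<bar> \<le> 1 / 4" using r mult_left_mono[of "\<bar>u\<bar>" r \<mu>] \<mu> by linarith
      moreover have "\<bar>Re (char M u) - 1\<bar> \<le> \<mu> * \<bar>u\<bar>"
        using char_lipschitz[OF abs, of u 0] abs_Re_le_cmod[of "char M u - char M 0"]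
        by (simp add: char_zero \<mu>_def)
      ultimately show False using u \<delta> by linarith
    qed
    define v where "v k = real k * (2 * u)" for k :: nat
    define J where "J k = {v k - r<..<v k + r}" for k
    have near: "1 / 2 \<le> cmod (char M w)" if k: "k \<in> {1..L}" and w: "w \<in> J k" for k w
    proof -
      have "1 - Re (char M (v k)) \<le> (real k)\<^sup>2 * (4 * (1 + Re (char M u)))"
        unfolding v_def using one_minus_Re_char_mult_le[of k "2 * u"]
          mult_left_mono[OF one_minus_Re_char_double_le[of u], of "(real k)\<^sup>2", OF zero_le_power2] by linarith
      also have "\<dots> \<le> (real L + 1)\<^sup>2 * (4 * \<delta>)"
        using k u abs_Re_le_cmod[of "char M u"] cmod_char_le_1[of u]
        by (intro mult_mono power_mono) auto
      also have "\<dots> = 1 / 4" by (simp add: \<delta>_def field_simps)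
      finally have 1: "3 / 4 \<le> Re (char M (v k))" by simp
      have "cmod (char M (v k) - char M w) \<le> \<mu> * \<bar>v k - w\<bar>"
        unfolding \<mu>_def by (rule char_lipschitz[OF abs])
      also have "\<dots> \<le> \<mu> * r" using w \<mu> by (intro mult_left_mono) (auto simp: J_def)
      finally have "cmod (char M (v k) - char M w) \<le> 1 / 4" using r by simp
      then show ?thesis
        using 1 complex_Re_le_cmod[of "char M (v k)"] norm_triangle_ineq2[of "char M (v k)" "char M w"] by linarith
    qed
    have disj: "disjoint_family_on J {1..L}"
      unfolding disjoint_family_on_def
    proof (intro ballI impI)
      fix j k :: nat assume "j \<noteq> k"
      have "2 * r < \<bar>v j - v k\<bar>"
      proof -
        have "1 * (2 * r) < \<bar>real j - real k\<bar> * (2 * \<bar>u\<bar>)"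
          using \<open>j \<noteq> k\<close> u_far r by (intro mult_le_less_imp_less) (auto simp: abs_if of_nat_diff)
        also have "\<dots> = \<bar>v j - v k\<bar>"
          unfolding v_def by (metis abs_mult abs_numeral left_diff_distrib)
        finally show ?thesis by simp
      qed
      then show "J j \<inter> J k = {}" by (auto simp: J_def)
    qed
    define m where "m = real L * (2 * \<bar>u\<bar>) + r"
    have inm: "w \<in> {-m<..<m}" if k: "k \<in> {1..L}" and w: "w \<in> J k" for k w
    proof -
      have "\<bar>v k\<bar> \<le> real L * (2 * \<bar>u\<bar>)"
        unfolding v_def abs_mult using k by (intro mult_mono) auto
      moreover have "\<bar>w - v k\<bar> < r" using w by (auto simp: J_def)
      ultimately show ?thesis unfolding m_def by (auto simp: abs_if split: if_splits)
    qed
    have "ennreal (real L * (r / 2)) = (\<integral>\<^sup>+w. (\<Sum>k\<in>{1..L}. ennreal (1 / 4) * indicator (J k) w) \<partial>lborel)"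
    proof -
      have "(\<integral>\<^sup>+w. ennreal (1 / 4) * indicator (J k) w \<partial>lborel) = ennreal (r / 2)" for k
        using r by (subst nn_integral_cmult_indicator) (auto simp: J_def simp flip: ennreal_mult')
      then have "(\<integral>\<^sup>+w. (\<Sum>k\<in>{1..L}. ennreal (1 / 4) * indicator (J k) w) \<partial>lborel) = (\<Sum>k\<in>{1..L}. ennreal (r / 2))"
        by (subst nn_integral_sum) (auto simp: J_def)
      also have "\<dots> = ennreal (\<Sum>k\<in>{1..L}. r / 2)"
        using r by (subst sum_ennreal) auto
      finally show ?thesis by simp
    qed
    also have "\<dots> \<le> (\<integral>\<^sup>+w. ennreal ((cmod (char M w))\<^sup>2) * indicator {-m<..<m} w \<partial>lborel)"
    proof (rule nn_integral_mono)
      fix w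
      have "(\<Sum>k\<in>{1..L}. ennreal (1 / 4) * indicator (J k) w) = ennreal (1 / 4) * indicator (\<Union>(J ` {1..L})) w"
        unfolding sum_distrib_left[symmetric] indicator_UN_disjoint[OF finite_atLeastAtMost disj] ..
      also have "\<dots> \<le> ennreal ((cmod (char M w))\<^sup>2) * indicator {-m<..<m} w"
      proof (cases "w \<in> \<Union>(J ` {1..L})")
        case True
        then obtain k where k: "k \<in> {1..L}" "w \<in> J k" by blast
        have "(1 / 2)\<^sup>2 \<le> (cmod (char M w))\<^sup>2" by (rule power_mono[OF near[OF k]]) simp
        then show ?thesis using inm[OF k] True by (auto simp: power2_eq_square intro!: ennreal_leI)
      qed auto
      finally show "(\<Sum>k\<in>{1..L}. ennreal (1 / 4) * indicator (J k) w) \<le> ennreal ((cmod (char M w))\<^sup>2) * indicator {-m<..<m} w" .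
    qed
    also have "\<dots> \<le> ennreal \<bar>D\<bar>" using order_trans[OF L2 ennreal_leI[OF abs_ge_self]] .
    finally have "real L * (r / 2) \<le> \<bar>D\<bar>" by simp
    with L r show False by (simp add: field_simps)
  qed
  with \<delta> show ?thesis by blast
qed

end

section \<open>Empirical characteristic functions of independent samples\<close>

lemma (in prob_space) integral_square_sum_centred:
  assumes "finite I" "indep_vars (\<lambda>_. borel) W I"
    and "\<And>i. i \<in> I \<Longrightarrow> integrable M (\<lambda>\<omega>. (W i \<omega>)\<^sup>2)"
    and "\<And>i. i \<in> I \<Longrightarrow> expectation (W i) = 0"
  shows "integrable M (\<lambda>\<omega>. (\<Sum>i\<in>I. W i \<omega>)\<^sup>2) \<and>
    expectation (\<lambda>\<omega>. (\<Sum>i\<in>I. W i \<omega> :: real)\<^sup>2) = (\<Sum>i\<in>I. expectation (\<lambda>\<omega>. (W i \<omega>)\<^sup>2))"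
  using assms
proof (induction I rule: finite_induct)
  case (insert i I)
  have indep: "indep_vars (\<lambda>_. borel) W I"
    using insert.prems(1) by (rule indep_vars_subset) auto
  have meas: "random_variable borel (W j)" if "j \<in> insert i I" for j
    using insert.prems(1) that by (auto simp: indep_vars_def)
  have int: "integrable M (W j)" if "j \<in> insert i I" for j
    using square_integrable_imp_integrable[OF meas[OF that] insert.prems(2)[OF that]] .
  let ?S = "\<lambda>\<omega>. \<Sum>j\<in>I. W j \<omega>"
  have IH: "integrable M (\<lambda>\<omega>. (?S \<omega>)\<^sup>2)" "expectation (\<lambda>\<omega>. (?S \<omega>)\<^sup>2) = (\<Sum>j\<in>I. expectation (\<lambda>\<omega>. (W j \<omega>)\<^sup>2))"
    using insert.IH[OF indep insert.prems(2,3)] by auto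
  have S_int: "integrable M ?S"
    by (intro Bochner_Integration.integrable_sum int) simp
  have ind: "indep_var borel (W i) borel ?S"
    using indep_vars_sum[OF insert.hyps insert.prems(1)] .
  have cross: "integrable M (\<lambda>\<omega>. W i \<omega> * ?S \<omega>)"
    by (rule indep_var_integrable[OF ind int S_int]) simp
  have cross0: "expectation (\<lambda>\<omega>. W i \<omega> * ?S \<omega>) = 0"
    using indep_var_lebesgue_integral[OF ind int S_int] insert.prems(3) by simp
  have expand: "(\<Sum>j\<in>insert i I. W j \<omega>)\<^sup>2 = (W i \<omega>)\<^sup>2 + 2 * (W i \<omega> * ?S \<omega>) + (?S \<omega>)\<^sup>2" for \<omega>
    using insert.hyps by (simp add: power2_sum)
  show ?case
    unfolding expand using insert.prems(2)[of i] IH cross cross0 insert.hyps by simp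
qed simp

locale iid_sample = prob_space M for M :: "'a measure" +
  fixes D :: "nat \<Rightarrow> 'a \<Rightarrow> real" and n :: nat and \<nu> :: "real measure"
  assumes indep: "indep_vars (\<lambda>_. borel) D {..<n}"
    and ident: "\<And>i. i < n \<Longrightarrow> distr M borel (D i) = \<nu>"
    and n_pos: "0 < n"
begin

lemma D_meas [measurable]: "i < n \<Longrightarrow> random_variable borel (D i)"
  using indep by (auto simp: indep_vars_def)

sublocale \<nu>: real_distribution \<nu>
  using ident[OF n_pos] D_meas[OF n_pos] by (metis real_distribution_distr)

lemma expectation_D:
  assumes "i < n" "g \<in> borel_measurable borel"
  shows "expectation (\<lambda>\<omega>. g (D i \<omega>) :: real) = (\<integral>x. g x \<partial>\<nu>)"
  unfolding ident[OF assms(1), symmetric]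
  using assms by (intro integral_distr[symmetric]) auto

definition emp :: "real \<Rightarrow> 'a \<Rightarrow> complex" where
  "emp u \<omega> = 1 / n * (\<Sum>i<n. iexp (u * D i \<omega>))"

lemma Re_emp: "Re (emp u \<omega>) = 1 / n * (\<Sum>i<n. cos (u * D i \<omega>))"
  and Im_emp: "Im (emp u \<omega>) = 1 / n * (\<Sum>i<n. sin (u * D i \<omega>))"
proof -
  have "emp u \<omega> = complex_of_real (1 / n) * (\<Sum>i<n. cis (u * D i \<omega>))"
    by (simp add: emp_def cis_conv_exp)
  then show "Re (emp u \<omega>) = 1 / n * (\<Sum>i<n. cos (u * D i \<omega>))"
    and "Im (emp u \<omega>) = 1 / n * (\<Sum>i<n. sin (u * D i \<omega>))"
    by simp_all
qed

lemma emp_measurable [measurable]: "emp u \<in> borel_measurable M"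
  unfolding emp_def[abs_def] by measurable

lemma Re_char_\<nu>: "Re (char \<nu> u) = (\<integral>x. cos (u * x) \<partial>\<nu>)"
  and Im_char_\<nu>: "Im (char \<nu> u) = (\<integral>x. sin (u * x) \<partial>\<nu>)"
proof -
  have "integrable \<nu> (\<lambda>x. iexp (u * x))"
    by (rule \<nu>.integrable_const_bound[of _ 1]) auto
  then show "Re (char \<nu> u) = (\<integral>x. cos (u * x) \<partial>\<nu>)" "Im (char \<nu> u) = (\<integral>x. sin (u * x) \<partial>\<nu>)"
    unfolding char_def
    by (subst integral_Re[symmetric] integral_Im[symmetric]; auto simp: Re_exp Im_exp)+
qed

lemma expectation_square_mean:
  assumes g [measurable]: "g \<in> borel_measurable borel" and bound: "\<And>x. \<bar>g x\<bar> \<le> (1::real)"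
  shows "integrable M (\<lambda>\<omega>. (1 / n * (\<Sum>i<n. g (D i \<omega>)) - (\<integral>x. g x \<partial>\<nu>))\<^sup>2)"
    and "expectation (\<lambda>\<omega>. (1 / n * (\<Sum>i<n. g (D i \<omega>)) - (\<integral>x. g x \<partial>\<nu>))\<^sup>2) =
      1 / n * ((\<integral>x. (g x)\<^sup>2 \<partial>\<nu>) - (\<integral>x. g x \<partial>\<nu>)\<^sup>2)"
proof -
  let ?e = "\<integral>x. g x \<partial>\<nu>"
  let ?W = "\<lambda>i \<omega>. g (D i \<omega>) - ?e"
  have g_int: "integrable \<nu> g" by (rule \<nu>.integrable_const_bound[of _ 1]) (use bound in auto)
  have g2_int: "integrable \<nu> (\<lambda>x. (g x)\<^sup>2)"
    by (rule \<nu>.integrable_const_bound[of _ 1]) (use bound in \<open>auto simp: abs_square_le_1\<close>)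
  have W: "indep_vars (\<lambda>_. borel) ?W {..<n}"
    using indep by (rule indep_vars_compose2) simp
  have sq: "integrable M (\<lambda>\<omega>. (?W i \<omega>)\<^sup>2)" if "i \<in> {..<n}" for i
  proof (rule integrable_const_bound[of _ "(1 + \<bar>?e\<bar>)\<^sup>2"])
    have "\<bar>?W i \<omega>\<bar>\<^sup>2 \<le> (1 + \<bar>?e\<bar>)\<^sup>2" for \<omega>
      using bound[of "D i \<omega>"] by (intro power_mono) linarith+
    then show "AE \<omega> in M. norm ((?W i \<omega>)\<^sup>2) \<le> (1 + \<bar>?e\<bar>)\<^sup>2" by simp
  qed (use that in auto)
  have mean: "expectation (?W i) = 0" if "i \<in> {..<n}" for i
    using expectation_D[of i "\<lambda>x. g x - ?e"] that g_int by (simp add: \<nu>.prob_space[simplified])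
  have var: "expectation (\<lambda>\<omega>. (?W i \<omega>)\<^sup>2) = (\<integral>x. (g x)\<^sup>2 \<partial>\<nu>) - ?e\<^sup>2" if "i < n" for i
  proof -
    have "expectation (\<lambda>\<omega>. (?W i \<omega>)\<^sup>2) = (\<integral>x. (g x - ?e)\<^sup>2 \<partial>\<nu>)"
      using expectation_D[of i "\<lambda>x. (g x - ?e)\<^sup>2"] that by simp
    also have "\<dots> = (\<integral>x. (g x)\<^sup>2 - 2 * ?e * g x + ?e\<^sup>2 \<partial>\<nu>)"
      by (simp add: power2_diff algebra_simps)
    also have "\<dots> = (\<integral>x. (g x)\<^sup>2 \<partial>\<nu>) - ?e\<^sup>2"
      using g_int g2_int \<nu>.prob_space by (simp add: power2_eq_square)
    finally show ?thesis .
  qed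
  have eq: "1 / n * (\<Sum>i<n. g (D i \<omega>)) - ?e = 1 / n * (\<Sum>i<n. ?W i \<omega>)" for \<omega>
    using n_pos by (simp add: sum_subtractf field_simps)
  note S = integral_square_sum_centred[OF finite_lessThan W sq mean]
  show "integrable M (\<lambda>\<omega>. (1 / n * (\<Sum>i<n. g (D i \<omega>)) - ?e)\<^sup>2)"
    unfolding eq power_mult_distrib using S by auto
  have "expectation (\<lambda>\<omega>. (1 / n * (\<Sum>i<n. g (D i \<omega>)) - ?e)\<^sup>2) = (1 / n)\<^sup>2 * (\<Sum>i<n. expectation (\<lambda>\<omega>. (?W i \<omega>)\<^sup>2))"
    unfolding eq power_mult_distrib using S by simp
  also have "\<dots> = (1 / n)\<^sup>2 * (n * ((\<integral>x. (g x)\<^sup>2 \<partial>\<nu>) - ?e\<^sup>2))"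
    using var by simp
  finally show "expectation (\<lambda>\<omega>. (1 / n * (\<Sum>i<n. g (D i \<omega>)) - ?e)\<^sup>2) = 1 / n * ((\<integral>x. (g x)\<^sup>2 \<partial>\<nu>) - ?e\<^sup>2)"
    using n_pos by (simp add: power2_eq_square)
qed

text \<open>
  Since \<open>cos\<^sup>2 + sin\<^sup>2 = 1\<close>, the variances of the real and the imaginary part add up to \<open>(1 - |\<psi>|\<^sup>2) / n\<close> where \<open>\<psi>\<close> is the
  characteristic function of \<open>\<nu>\<close>.
\<close>

lemma emp_mean_square:
  "(\<integral>\<^sup>+\<omega>. ennreal ((cmod (emp u \<omega> - char \<nu> u))\<^sup>2) \<partial>M) = ennreal ((1 - (cmod (char \<nu> u))\<^sup>2) / n)"
proof -
  let ?c = "\<lambda>x. cos (u * x)" and ?s = "\<lambda>x. sin (u * x)"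
  have c: "?c \<in> borel_measurable borel" "\<And>x. \<bar>?c x\<bar> \<le> 1" and s: "?s \<in> borel_measurable borel" "\<And>x. \<bar>?s x\<bar> \<le> 1"
    by auto
  have sq: "(cmod (emp u \<omega> - char \<nu> u))\<^sup>2 =
     (1 / n * (\<Sum>i<n. ?c (D i \<omega>)) - (\<integral>x. ?c x \<partial>\<nu>))\<^sup>2 + (1 / n * (\<Sum>i<n. ?s (D i \<omega>)) - (\<integral>x. ?s x \<partial>\<nu>))\<^sup>2" for \<omega>
    unfolding cmod_power2 by (simp only: minus_complex.simps Re_emp Im_emp Re_char_\<nu> Im_char_\<nu>)
  have int: "integrable M (\<lambda>\<omega>. (cmod (emp u \<omega> - char \<nu> u))\<^sup>2)"
    unfolding sq by (intro Bochner_Integration.integrable_add expectation_square_mean(1) c s)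
  have "expectation (\<lambda>\<omega>. (cmod (emp u \<omega> - char \<nu> u))\<^sup>2) =
     1 / n * ((\<integral>x. (?c x)\<^sup>2 \<partial>\<nu>) - (\<integral>x. ?c x \<partial>\<nu>)\<^sup>2) + 1 / n * ((\<integral>x. (?s x)\<^sup>2 \<partial>\<nu>) - (\<integral>x. ?s x \<partial>\<nu>)\<^sup>2)"
    unfolding sq
    by (subst Bochner_Integration.integral_add) (simp_all only: expectation_square_mean[OF c] expectation_square_mean[OF s])
  also have "\<dots> = 1 / n * ((\<integral>x. (?c x)\<^sup>2 \<partial>\<nu>) + (\<integral>x. (?s x)\<^sup>2 \<partial>\<nu>) - (cmod (char \<nu> u))\<^sup>2)"
    unfolding cmod_power2 Re_char_\<nu> Im_char_\<nu> by (simp add: algebra_simps diff_divide_distrib add_divide_distrib)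
  also have "(\<integral>x. (?c x)\<^sup>2 \<partial>\<nu>) + (\<integral>x. (?s x)\<^sup>2 \<partial>\<nu>) = (\<integral>x. (?c x)\<^sup>2 + (?s x)\<^sup>2 \<partial>\<nu>)"
    by (rule Bochner_Integration.integral_add[symmetric]; rule \<nu>.integrable_const_bound[of _ 1])
       (auto simp: abs_square_le_1)
  also have "\<dots> = 1" using \<nu>.prob_space by simp
  finally show ?thesis
    by (subst nn_integral_eq_integral[OF int]) auto
qed

lemma mean_deviation_le:
  assumes g [measurable]: "g \<in> borel_measurable borel" and bound: "\<And>x. \<bar>g x\<bar> \<le> (1::real)" and "0 \<le> (\<epsilon>::real)"
  shows "prob {\<omega> \<in> space M. \<epsilon> \<le> \<bar>1 / n * (\<Sum>i<n. g (D i \<omega>)) - (\<integral>x. g x \<partial>\<nu>)\<bar>} \<le> 2 * exp (- real n * \<epsilon>\<^sup>2 / 2)"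
proof -
  let ?e = "\<integral>x. g x \<partial>\<nu>"
  interpret H: Hoeffding_ineq M "{..<n}" "\<lambda>i \<omega>. g (D i \<omega>)" "\<lambda>_. -1" "\<lambda>_. 1" "n * ?e"
  proof unfold_locales
    show "indep_vars (\<lambda>_. borel) (\<lambda>i \<omega>. g (D i \<omega>)) {..<n}"
      using indep by (rule indep_vars_compose2) measurable
    show "AE \<omega> in M. g (D i \<omega>) \<in> {-1..1}" for i
      using bound by (auto simp: abs_le_iff minus_le_iff)
    show "n * ?e \<equiv> \<Sum>i<n. expectation (\<lambda>\<omega>. g (D i \<omega>))"
      using expectation_D[OF _ g] by simp
  qed auto
  have "prob {\<omega> \<in> space M. real n * \<epsilon> \<le> \<bar>(\<Sum>i<n. g (D i \<omega>)) - n * ?e\<bar>} \<le> 2 * exp (-2 * (real n * \<epsilon>)\<^sup>2 / (\<Sum>i<n. (1 - - 1)\<^sup>2))"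
    using n_pos assms(3) by (intro H.Hoeffding_ineq_abs_ge) auto
  also have "-2 * (real n * \<epsilon>)\<^sup>2 / (\<Sum>i<n. (1 - - 1)\<^sup>2) = - real n * \<epsilon>\<^sup>2 / 2"
    using n_pos by (simp add: power2_eq_square field_simps)
  also have "{\<omega> \<in> space M. real n * \<epsilon> \<le> \<bar>(\<Sum>i<n. g (D i \<omega>)) - n * ?e\<bar>} =
     {\<omega> \<in> space M. \<epsilon> \<le> \<bar>1 / n * (\<Sum>i<n. g (D i \<omega>)) - ?e\<bar>}"
  proof -
    have "real n * \<epsilon> \<le> \<bar>s - n * ?e\<bar> \<longleftrightarrow> \<epsilon> \<le> \<bar>1 / n * s - ?e\<bar>" for s
    proof -
      have "\<bar>1 / n * s - ?e\<bar> = 1 / n * \<bar>s - n * ?e\<bar>"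
      proof -
        have "1 / n * s - ?e = (s - n * ?e) / n" using n_pos by (simp add: field_simps)
        then show ?thesis by simp
      qed
      then show ?thesis using n_pos by (simp add: field_simps)
    qed
    then show ?thesis by simp
  qed
  finally show ?thesis .
qed

text \<open>
  One of the real and the imaginary part deviates by at least \<open>\<epsilon> / 2\<close>; Hoeffding's inequality applies to each.
\<close>

lemma emp_deviation_le:
  assumes "0 \<le> (\<epsilon>::real)"
  shows "prob {\<omega> \<in> space M. \<epsilon> \<le> cmod (emp u \<omega> - char \<nu> u)} \<le> 4 * exp (- real n * \<epsilon>\<^sup>2 / 8)"
proof -
  let ?A = "\<lambda>g. {\<omega> \<in> space M. \<epsilon> / 2 \<le> \<bar>1 / n * (\<Sum>i<n. g (D i \<omega>)) - (\<integral>x. g x \<partial>\<nu>)\<bar>}"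
  let ?c = "\<lambda>x. cos (u * x)" and ?s = "\<lambda>x. sin (u * x)"
  have "{\<omega> \<in> space M. \<epsilon> \<le> cmod (emp u \<omega> - char \<nu> u)} \<subseteq> ?A ?c \<union> ?A ?s"
  proof
    fix \<omega> assume w: "\<omega> \<in> {\<omega> \<in> space M. \<epsilon> \<le> cmod (emp u \<omega> - char \<nu> u)}"
    have "\<epsilon> \<le> \<bar>Re (emp u \<omega> - char \<nu> u)\<bar> + \<bar>Im (emp u \<omega> - char \<nu> u)\<bar>"
      using w cmod_le[of "emp u \<omega> - char \<nu> u"] by auto
    then have "\<epsilon> \<le> \<bar>1 / n * (\<Sum>i<n. ?c (D i \<omega>)) - (\<integral>x. ?c x \<partial>\<nu>)\<bar> + \<bar>1 / n * (\<Sum>i<n. ?s (D i \<omega>)) - (\<integral>x. ?s x \<partial>\<nu>)\<bar>"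
      by (simp only: minus_complex.simps Re_emp Im_emp Re_char_\<nu> Im_char_\<nu>)
    then show "\<omega> \<in> ?A ?c \<union> ?A ?s" using w by auto
  qed
  then have "prob {\<omega> \<in> space M. \<epsilon> \<le> cmod (emp u \<omega> - char \<nu> u)} \<le> prob (?A ?c \<union> ?A ?s)"
    by (intro finite_measure_mono) (auto intro!: sets.Un)
  also have "\<dots> \<le> prob (?A ?c) + prob (?A ?s)"
    by (intro measure_Un_le) auto
  also have "\<dots> \<le> 2 * exp (- real n * (\<epsilon> / 2)\<^sup>2 / 2) + 2 * exp (- real n * (\<epsilon> / 2)\<^sup>2 / 2)"
    using assms by (intro add_mono mean_deviation_le) auto
  finally show ?thesis by (simp add: power2_eq_square field_simps)
qed

lemma emp_minus: "emp (- u) \<omega> = cnj (emp u \<omega>)"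
  by (simp add: emp_def exp_cnj)

lemma emp_lipschitz: "cmod (emp u \<omega> - emp v \<omega>) \<le> 1 / n * (\<Sum>i<n. \<bar>D i \<omega>\<bar>) * \<bar>u - v\<bar>"
proof -
  have "emp u \<omega> - emp v \<omega> = complex_of_real (1 / n) * (\<Sum>i<n. iexp (u * D i \<omega>) - iexp (v * D i \<omega>))"
    by (simp add: emp_def sum_subtractf right_diff_distrib)
  also have "cmod \<dots> = 1 / n * cmod (\<Sum>i<n. iexp (u * D i \<omega>) - iexp (v * D i \<omega>))"
    by (simp only: norm_mult norm_of_real) simp
  also have "\<dots> \<le> 1 / n * (\<Sum>i<n. \<bar>D i \<omega>\<bar> * \<bar>u - v\<bar>)"
    by (intro mult_left_mono sum_norm_le cmod_iexp_diff_le) simp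
  finally show ?thesis by (simp only: sum_distrib_right mult.assoc)
qed

end

section \<open>Moments of the Poisson distribution\<close>

lemma sums_poisson_moments:
  fixes T :: real
  shows "(\<lambda>k. T ^ k / fact k) sums exp T"
    and "(\<lambda>k. real k * (T ^ k / fact k)) sums (T * exp T)"
    and "(\<lambda>k. real k * (real k - 1) * (T ^ k / fact k)) sums (T\<^sup>2 * exp T)"
proof -
  show 0: "(\<lambda>k. T ^ k / fact k) sums exp T"
    using exp_converges[of T] by (simp add: field_simps)
  have shift: "real (Suc k) * (T ^ Suc k / fact (Suc k)) = T * (T ^ k / fact k)" for k
    by (simp add: fact_Suc del: of_nat_Suc)
  have "(\<lambda>k. real (Suc k) * (T ^ Suc k / fact (Suc k))) sums (T * exp T)"
    unfolding shift by (rule sums_mult[OF 0])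
  then show 1: "(\<lambda>k. real k * (T ^ k / fact k)) sums (T * exp T)"
    by (subst (asm) sums_Suc_iff) simp
  have shift2: "real (Suc k) * (real (Suc k) - 1) * (T ^ Suc k / fact (Suc k)) = T * (real k * (T ^ k / fact k))" for k
  proof -
    have "real (Suc k) * (real (Suc k) - 1) * (T ^ Suc k / fact (Suc k)) = real k * (real (Suc k) * (T ^ Suc k / fact (Suc k)))"
      by (simp only: of_nat_Suc add_diff_cancel_left' mult_ac)
    also have "\<dots> = T * (real k * (T ^ k / fact k))"
      unfolding shift by (simp only: mult.left_commute)
    finally show ?thesis .
  qed
  have "(\<lambda>k. real (Suc k) * (real (Suc k) - 1) * (T ^ Suc k / fact (Suc k))) sums (T * (T * exp T))"
    unfolding shift2 by (rule sums_mult[OF 1])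
  then show "(\<lambda>k. real k * (real k - 1) * (T ^ k / fact k)) sums (T\<^sup>2 * exp T)"
    by (subst (asm) sums_Suc_iff) (simp add: power2_eq_square mult.assoc)
qed

lemma nn_integral_poisson_quadratic:
  assumes "0 < T" "0 \<le> \<alpha>" "0 \<le> \<beta>"
  shows "(\<integral>\<^sup>+k. ennreal (real k * \<alpha> + (real k - T)\<^sup>2 * \<beta>) \<partial>measure_pmf (poisson_pmf T)) = ennreal (T * (\<alpha> + \<beta>))"
proof -
  let ?f = "\<lambda>k. T ^ k / fact k * exp (- T) * (real k * \<alpha> + (real k - T)\<^sup>2 * \<beta>)"
  have "(\<lambda>k. exp (- T) * (\<beta> * (real k * (real k - 1) * (T ^ k / fact k)) + (\<alpha> + \<beta> - 2 * T * \<beta>) * (real k * (T ^ k / fact k))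
        + T\<^sup>2 * \<beta> * (T ^ k / fact k)))
      sums (exp (- T) * (\<beta> * (T\<^sup>2 * exp T) + (\<alpha> + \<beta> - 2 * T * \<beta>) * (T * exp T) + T\<^sup>2 * \<beta> * exp T))"
    by (intro sums_mult sums_add sums_poisson_moments)
  also have "(exp (- T) * (\<beta> * (T\<^sup>2 * exp T) + (\<alpha> + \<beta> - 2 * T * \<beta>) * (T * exp T) + T\<^sup>2 * \<beta> * exp T)) = T * (\<alpha> + \<beta>)"
  proof -
    have "\<beta> * (T\<^sup>2 * exp T) + (\<alpha> + \<beta> - 2 * T * \<beta>) * (T * exp T) + T\<^sup>2 * \<beta> * exp T = exp T * (T * (\<alpha> + \<beta>))"
      by (simp add: algebra_simps power2_eq_square)
    then show ?thesis by (simp add: mult.assoc[symmetric] flip: exp_add)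
  qed
  also have "(\<lambda>k. exp (- T) * (\<beta> * (real k * (real k - 1) * (T ^ k / fact k)) + (\<alpha> + \<beta> - 2 * T * \<beta>) * (real k * (T ^ k / fact k))
        + T\<^sup>2 * \<beta> * (T ^ k / fact k))) = ?f"
  proof
    fix k
    define p where "p = T ^ k / fact k"
    show "exp (- T) * (\<beta> * (real k * (real k - 1) * (T ^ k / fact k)) + (\<alpha> + \<beta> - 2 * T * \<beta>) * (real k * (T ^ k / fact k))
        + T\<^sup>2 * \<beta> * (T ^ k / fact k)) = ?f k"
      unfolding p_def[symmetric] by (simp add: algebra_simps power2_eq_square)
  qed
  finally have sums: "?f sums (T * (\<alpha> + \<beta>))" .
  have nonneg: "0 \<le> ?f k" for k using assms by simp
  have "(\<integral>\<^sup>+k. ennreal (real k * \<alpha> + (real k - T)\<^sup>2 * \<beta>) \<partial>measure_pmf (poisson_pmf T)) = (\<Sum>k. ennreal (?f k))"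
  proof -
    have "ennreal (pmf (poisson_pmf T) k) * ennreal (real k * \<alpha> + (real k - T)\<^sup>2 * \<beta>) = ennreal (?f k)" for k
      using assms by (subst ennreal_mult'[symmetric]) simp_all
    then show ?thesis
      by (simp only: nn_integral_measure_pmf nn_integral_count_space_nat)
  qed
  also have "\<dots> = ennreal (T * (\<alpha> + \<beta>))"
    by (rule suminf_ennreal_eq[OF nonneg sums])
  finally show ?thesis .
qed

lemma integral_poisson_power:
  assumes "0 < T" "cmod z \<le> 1"
  shows "(\<integral>k. z ^ k \<partial>measure_pmf (poisson_pmf T)) = exp (of_real T * (z - 1))"
proof -
  have sums: "(\<lambda>k. exp (- of_real T) * ((of_real T * z) ^ k /\<^sub>R fact k)) sums (exp (- of_real T) * exp (of_real T * z))"
    by (intro sums_mult exp_converges)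
  have f: "pmf (poisson_pmf T) k *\<^sub>R z ^ k = exp (- of_real T) * ((of_real T * z) ^ k /\<^sub>R fact k)" for k
  proof -
    have "exp (- complex_of_real T) = of_real (exp (- T))"
      by (metis exp_of_real of_real_minus)
    then show ?thesis
      using assms(1) by (simp add: scaleR_conv_of_real power_mult_distrib divide_inverse mult_ac)
  qed
  have int: "integrable (count_space UNIV) (\<lambda>k. pmf (poisson_pmf T) k *\<^sub>R z ^ k)"
  proof -
    have "integrable (measure_pmf (poisson_pmf T)) (\<lambda>k. z ^ k)"
      by (rule measure_pmf.integrable_const_bound[of _ 1]) (use assms(2) in \<open>auto simp: norm_power power_le_one\<close>)
    then show ?thesis
      unfolding measure_pmf_eq_density by (subst (asm) integrable_density) auto
  qed
  have "(\<integral>k. z ^ k \<partial>measure_pmf (poisson_pmf T)) = (\<integral>k. pmf (poisson_pmf T) k *\<^sub>R z ^ k \<partial>count_space UNIV)"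
    unfolding measure_pmf_eq_density by (subst integral_density) auto
  also have "\<dots> = (\<Sum>k. pmf (poisson_pmf T) k *\<^sub>R z ^ k)"
    by (rule integral_count_space_nat[OF int])
  also have "\<dots> = exp (- of_real T) * exp (of_real T * z)"
    using sums unfolding f by (rule sums_unique[symmetric])
  finally show ?thesis
    by (simp add: algebra_simps flip: exp_add)
qed

section \<open>Increments of a compound Poisson process\<close>

context compound_poisson
begin

(* The jumps are indexed by {1..}; rewriting 1 to Suc 0 would hide the index set of PX. *)
declare One_nat_def [simp del]

lemma X_measurable [measurable]: "1 \<le> j \<Longrightarrow> random_variable borel (X j)"
  using X_indep by (auto simp: indep_vars_def)

abbreviation PN :: "(real \<Rightarrow> nat) measure" where "PN \<equiv> \<Pi>\<^sub>M t\<in>{0..}. count_space UNIV"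
abbreviation PX :: "(nat \<Rightarrow> real) measure" where "PX \<equiv> \<Pi>\<^sub>M j\<in>{1..}. borel"

definition N_path :: "'a \<Rightarrow> real \<Rightarrow> nat" where "N_path \<omega> = (\<lambda>t\<in>{0..}. N t \<omega>)"
definition X_seq :: "'a \<Rightarrow> nat \<Rightarrow> real" where "X_seq \<omega> = (\<lambda>j\<in>{1..}. X j \<omega>)"

lemma N_path_measurable [measurable]: "N_path \<in> measurable M PN"
  unfolding N_path_def[abs_def] by (intro measurable_restrict N_measurable) simp

lemma X_seq_measurable [measurable]: "X_seq \<in> measurable M PX"
  unfolding X_seq_def[abs_def] by (intro measurable_restrict X_measurable) simp

lemma distr_N_X:
  "distr M PN N_path \<Otimes>\<^sub>M distr M PX X_seq = distr M (PN \<Otimes>\<^sub>M PX) (\<lambda>\<omega>. (N_path \<omega>, X_seq \<omega>))"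
proof (rule pair_measure_eqI)
  interpret NN: prob_space "distr M PN N_path" by (rule prob_space_distr) simp
  interpret XX: prob_space "distr M PX X_seq" by (rule prob_space_distr) simp
  show "sigma_finite_measure (distr M PN N_path)" "sigma_finite_measure (distr M PX X_seq)" ..
  show "sets (distr M PN N_path \<Otimes>\<^sub>M distr M PX X_seq) = sets (distr M (PN \<Otimes>\<^sub>M PX) (\<lambda>\<omega>. (N_path \<omega>, X_seq \<omega>)))"
    by simp
  fix A B assume "A \<in> sets (distr M PN N_path)" "B \<in> sets (distr M PX X_seq)"
  then have AB [measurable]: "A \<in> sets PN" "B \<in> sets PX" by auto
  have funs: "(\<lambda>\<omega>. \<lambda>t\<in>{0..}. N t \<omega>) = N_path" "(\<lambda>\<omega>. \<lambda>j\<in>{1..}. X j \<omega>) = X_seq"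
    by (simp_all add: N_path_def[abs_def] X_seq_def[abs_def])
  have "prob ((N_path -` A \<inter> space M) \<inter> (X_seq -` B \<inter> space M)) = prob (N_path -` A \<inter> space M) * prob (X_seq -` B \<inter> space M)"
    using N_X_indep AB unfolding funs
    by (intro indep_setD[OF N_X_indep[unfolded funs]] in_vimage_algebra) auto
  also have "(N_path -` A \<inter> space M) \<inter> (X_seq -` B \<inter> space M) = (\<lambda>\<omega>. (N_path \<omega>, X_seq \<omega>)) -` (A \<times> B) \<inter> space M"
    by auto
  finally show "emeasure (distr M PN N_path) A * emeasure (distr M PX X_seq) B =
     emeasure (distr M (PN \<Otimes>\<^sub>M PX) (\<lambda>\<omega>. (N_path \<omega>, X_seq \<omega>))) (A \<times> B)"
    using AB by (simp add: emeasure_distr emeasure_eq_measure ennreal_mult')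
qed

text \<open>
  Conditioning on the Poisson process, in the form of Fubini's theorem: an independent copy \<open>\<omega>'\<close> of the sample
  point drives the jumps, while \<open>\<omega>\<close> and hence the number of jumps is held fixed in the inner integral.
\<close>

lemma decouple_nn_integral:
  assumes g: "(\<lambda>(p, x). g p x) \<in> borel_measurable (PN \<Otimes>\<^sub>M PX)"
  shows "(\<integral>\<^sup>+\<omega>. g (N_path \<omega>) (X_seq \<omega>) \<partial>M) = (\<integral>\<^sup>+\<omega>. (\<integral>\<^sup>+\<omega>'. g (N_path \<omega>) (X_seq \<omega>') \<partial>M) \<partial>M)"
proof -
  interpret XX: prob_space "distr M PX X_seq" by (rule prob_space_distr) simp
  have [measurable]: "(\<lambda>(p, x). g p x) \<in> borel_measurable (distr M PN N_path \<Otimes>\<^sub>M distr M PX X_seq)"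
    using g by simp
  have gp': "g p \<in> borel_measurable (distr M PX X_seq)" if "p \<in> space PN" for p
    using measurable_Pair2[OF g that] by simp
  note [measurable] = g
  have "(\<integral>\<^sup>+\<omega>. g (N_path \<omega>) (X_seq \<omega>) \<partial>M) =
      (\<integral>\<^sup>+z. (\<lambda>(p, x). g p x) z \<partial>distr M (PN \<Otimes>\<^sub>M PX) (\<lambda>\<omega>. (N_path \<omega>, X_seq \<omega>)))"
    using g by (subst nn_integral_distr) auto
  also have "\<dots> = (\<integral>\<^sup>+p. (\<integral>\<^sup>+x. g p x \<partial>distr M PX X_seq) \<partial>distr M PN N_path)"
    unfolding distr_N_X[symmetric] by (subst XX.nn_integral_fst[symmetric]) auto
  also have "\<dots> = (\<integral>\<^sup>+\<omega>. (\<integral>\<^sup>+x. g (N_path \<omega>) x \<partial>distr M PX X_seq) \<partial>M)"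
    by (rule nn_integral_distr) auto
  also have "\<dots> = (\<integral>\<^sup>+\<omega>. (\<integral>\<^sup>+\<omega>'. g (N_path \<omega>) (X_seq \<omega>') \<partial>M) \<partial>M)"
  proof (rule nn_integral_cong)
    fix \<omega> assume "\<omega> \<in> space M"
    from nn_integral_distr[OF X_seq_measurable gp'[OF measurable_space[OF N_path_measurable this]]]
    show "(\<integral>\<^sup>+x. g (N_path \<omega>) x \<partial>distr M PX X_seq) = (\<integral>\<^sup>+\<omega>'. g (N_path \<omega>) (X_seq \<omega>') \<partial>M)" .
  qed
  finally show ?thesis .
qed

lemma decouple_integral:
  fixes g :: "_ \<Rightarrow> _ \<Rightarrow> complex"
  assumes g: "(\<lambda>(p, x). g p x) \<in> borel_measurable (PN \<Otimes>\<^sub>M PX)" and bound: "\<And>p x. cmod (g p x) \<le> B"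
  shows "(\<integral>\<omega>. g (N_path \<omega>) (X_seq \<omega>) \<partial>M) = (\<integral>\<omega>. (\<integral>\<omega>'. g (N_path \<omega>) (X_seq \<omega>') \<partial>M) \<partial>M)"
proof -
  interpret NN: prob_space "distr M PN N_path" by (rule prob_space_distr) simp
  interpret XX: prob_space "distr M PX X_seq" by (rule prob_space_distr) simp
  interpret NX: pair_prob_space "distr M PN N_path" "distr M PX X_seq" ..
  have g': "(\<lambda>(p, x). g p x) \<in> borel_measurable (distr M PN N_path \<Otimes>\<^sub>M distr M PX X_seq)"
    using g by simp
  have int: "integrable (distr M PN N_path \<Otimes>\<^sub>M distr M PX X_seq) (\<lambda>(p, x). g p x)"
    by (rule NX.integrable_const_bound[OF _ g', of B]) (use bound in auto)
  have gp: "g p \<in> borel_measurable PX" if "p \<in> space PN" for p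
    using measurable_Pair2[OF g that] by simp
  note [measurable] = g
  have "(\<integral>\<omega>. g (N_path \<omega>) (X_seq \<omega>) \<partial>M) =
      (\<integral>z. (\<lambda>(p, x). g p x) z \<partial>distr M (PN \<Otimes>\<^sub>M PX) (\<lambda>\<omega>. (N_path \<omega>, X_seq \<omega>)))"
    using g by (subst integral_distr) auto
  also have "\<dots> = (\<integral>p. (\<integral>x. g p x \<partial>distr M PX X_seq) \<partial>distr M PN N_path)"
    unfolding distr_N_X[symmetric] by (subst NX.integral_fst'[OF int, symmetric]) auto
  also have "\<dots> = (\<integral>\<omega>. (\<integral>x. g (N_path \<omega>) x \<partial>distr M PX X_seq) \<partial>M)"
    by (rule integral_distr) auto
  also have "\<dots> = (\<integral>\<omega>. (\<integral>\<omega>'. g (N_path \<omega>) (X_seq \<omega>') \<partial>M) \<partial>M)"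
  proof (rule Bochner_Integration.integral_cong[OF refl])
    fix \<omega> assume "\<omega> \<in> space M"
    from integral_distr[OF X_seq_measurable gp[OF measurable_space[OF N_path_measurable this]]]
    show "(\<integral>x. g (N_path \<omega>) x \<partial>distr M PX X_seq) = (\<integral>\<omega>'. g (N_path \<omega>) (X_seq \<omega>') \<partial>M)" .
  qed
  finally show ?thesis .
qed

text \<open>
  The sum over the jumps in the time interval from \<open>s\<close> to \<open>t\<close> as a function of a path \<open>p\<close> of the Poisson process and
  a sequence \<open>x\<close> of jumps, the two arguments that get decoupled. The function \<open>h\<close> is the identity for the increments
  and the absolute value for the total variation.
\<close>

definition block_sum :: "(real \<Rightarrow> real) \<Rightarrow> real \<Rightarrow> real \<Rightarrow> (real \<Rightarrow> nat) \<Rightarrow> (nat \<Rightarrow> real) \<Rightarrow> real" where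
  "block_sum h s t p x = (\<Sum>l\<in>{p s<..p t}. h (x l))"

lemma block_sum_measurable [measurable]:
  assumes st: "0 \<le> s" "0 \<le> t" and h [measurable]: "h \<in> borel_measurable borel"
  shows "(\<lambda>(p, x). block_sum h s t p x) \<in> borel_measurable (PN \<Otimes>\<^sub>M PX)"
proof -
  have comp: "(\<lambda>z. h (snd z l)) \<in> borel_measurable (PN \<Otimes>\<^sub>M PX)" if "1 \<le> l" for l
    by (rule measurable_compose[OF _ h], rule measurable_compose[OF measurable_snd],
        rule measurable_component_singleton) (use that in simp)
  have fixed: "(\<lambda>z. \<Sum>l\<in>{a<..b}. h (snd z l)) \<in> borel_measurable (PN \<Otimes>\<^sub>M PX)" for a b :: nat
    by (intro borel_measurable_sum comp) auto
  have cnt: "(\<lambda>z. fst z r) \<in> measurable (PN \<Otimes>\<^sub>M PX) (count_space UNIV)" if "0 \<le> r" for r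
    by (rule measurable_compose[OF measurable_fst], rule measurable_component_singleton) (use that in simp)
  have 1: "(\<lambda>z. \<Sum>l\<in>{a<..fst z t}. h (snd z l)) \<in> borel_measurable (PN \<Otimes>\<^sub>M PX)" for a
    by (rule measurable_compose_countable[where f = "\<lambda>b z. \<Sum>l\<in>{a<..b}. h (snd z l)", OF fixed cnt[OF st(2)]])
  have "(\<lambda>z. \<Sum>l\<in>{fst z s<..fst z t}. h (snd z l)) \<in> borel_measurable (PN \<Otimes>\<^sub>M PX)"
    by (rule measurable_compose_countable[where f = "\<lambda>a z. \<Sum>l\<in>{a<..fst z t}. h (snd z l)", OF 1 cnt[OF st(1)]])
  then show ?thesis by (simp add: block_sum_def case_prod_beta')
qed

definition jumps :: "(real \<Rightarrow> real) \<Rightarrow> real \<Rightarrow> real \<Rightarrow> 'a \<Rightarrow> real" where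
  "jumps h s t \<omega> = (\<Sum>l\<in>{N s \<omega><..N t \<omega>}. h (X l \<omega>))"

lemma jumps_eq: "0 \<le> s \<Longrightarrow> 0 \<le> t \<Longrightarrow> jumps h s t \<omega> = block_sum h s t (N_path \<omega>) (X_seq \<omega>)"
  unfolding jumps_def block_sum_def by (rule sum.cong) (auto simp: N_path_def X_seq_def)

lemma block_sum_fixed: "0 \<le> s \<Longrightarrow> 0 \<le> t \<Longrightarrow>
   block_sum h s t (N_path \<omega>) (X_seq \<omega>') = (\<Sum>l\<in>{N s \<omega><..N t \<omega>}. h (X l \<omega>'))"
  unfolding block_sum_def by (rule sum.cong) (auto simp: N_path_def X_seq_def)

lemma jumps_measurable [measurable]:
  assumes "0 \<le> s" "0 \<le> t" and h [measurable]: "h \<in> borel_measurable borel"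
  shows "random_variable borel (jumps h s t)"
proof -
  have "(\<lambda>\<omega>. (\<lambda>(p, x). block_sum h s t p x) (N_path \<omega>, X_seq \<omega>)) \<in> borel_measurable M"
    using assms by measurable
  moreover have "(\<lambda>\<omega>. (\<lambda>(p, x). block_sum h s t p x) (N_path \<omega>, X_seq \<omega>)) = jumps h s t"
    using assms by (simp add: jumps_eq fun_eq_iff)
  ultimately show ?thesis by simp
qed

definition \<phi> :: "real \<Rightarrow> complex" where "\<phi> = char (distr M borel (X 1))"

definition jump_law :: "nat \<Rightarrow> real measure" where
  "jump_law k = distr M borel (\<lambda>\<omega>. \<Sum>l\<in>{1..k}. X l \<omega>)"

lemma char_block: "char (distr M borel (\<lambda>\<omega>. \<Sum>l\<in>{a<..b}. X l \<omega>)) u = \<phi> u ^ (b - a)"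
proof -
  have "indep_vars (\<lambda>_. borel) X {a<..b}"
    using X_indep by (rule indep_vars_subset) auto
  from char_distr_sum[OF this, of u]
  have "char (distr M borel (\<lambda>\<omega>. \<Sum>l\<in>{a<..b}. X l \<omega>)) u = (\<Prod>l\<in>{a<..b}. char (distr M borel (X l)) u)" .
  also have "\<dots> = (\<Prod>l\<in>{a<..b}. \<phi> u)"
    unfolding \<phi>_def by (intro prod.cong refl arg_cong[where f = "\<lambda>D. char D u"] X_ident) auto
  finally show ?thesis by simp
qed

text \<open>
  The characteristic function of either side is a power of \<open>\<phi>\<close> with exponent \<open>b - a\<close>.
\<close>

lemma block_law: "distr M borel (\<lambda>\<omega>. \<Sum>l\<in>{a<..b}. X l \<omega>) = jump_law (b - a)"
proof (rule Levy_uniqueness)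
  have eq: "{1..b - a} = {0<..b - a}" by auto
  show "char (distr M borel (\<lambda>\<omega>. \<Sum>l\<in>{a<..b}. X l \<omega>)) = char (jump_law (b - a))"
    by (rule ext) (simp only: jump_law_def eq char_block diff_zero)
  have m: "random_variable borel (\<lambda>\<omega>. \<Sum>l\<in>{a<..b}. X l \<omega>)" for a b
    by (intro borel_measurable_sum X_measurable) auto
  show "real_distribution (distr M borel (\<lambda>\<omega>. \<Sum>l\<in>{a<..b}. X l \<omega>))"
    by (rule real_distribution_distr[OF m])
  show "real_distribution (jump_law (b - a))"
    unfolding jump_law_def eq by (rule real_distribution_distr[OF m])
qed

lemma char_jumps:
  assumes "0 \<le> s" "0 \<le> t"
  shows "char (distr M borel (jumps (\<lambda>x. x) s t)) u = (\<integral>\<omega>. \<phi> u ^ (N t \<omega> - N s \<omega>) \<partial>M)"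
proof -
  have meas: "(\<lambda>(p, x). iexp (u * block_sum (\<lambda>x. x) s t p x)) \<in> borel_measurable (PN \<Otimes>\<^sub>M PX)"
    using block_sum_measurable[OF assms, of "\<lambda>x. x"] by (simp add: case_prod_beta')
  have "char (distr M borel (jumps (\<lambda>x. x) s t)) u = (\<integral>\<omega>. iexp (u * jumps (\<lambda>x. x) s t \<omega>) \<partial>M)"
    unfolding char_def using assms by (subst integral_distr) auto
  also have "\<dots> = (\<integral>\<omega>. (\<integral>\<omega>'. iexp (u * block_sum (\<lambda>x. x) s t (N_path \<omega>) (X_seq \<omega>')) \<partial>M) \<partial>M)"
    unfolding jumps_eq[OF assms] by (rule decouple_integral[OF meas, of 1]) simp
  also have "\<dots> = (\<integral>\<omega>. \<phi> u ^ (N t \<omega> - N s \<omega>) \<partial>M)"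
  proof (rule Bochner_Integration.integral_cong[OF refl])
    fix \<omega>
    have "(\<integral>\<omega>'. iexp (u * block_sum (\<lambda>x. x) s t (N_path \<omega>) (X_seq \<omega>')) \<partial>M) =
        char (distr M borel (\<lambda>\<omega>'. \<Sum>l\<in>{N s \<omega><..N t \<omega>}. X l \<omega>')) u"
      unfolding char_def block_sum_fixed[OF assms]
      by (subst integral_distr) (auto intro!: borel_measurable_sum X_measurable)
    then show "(\<integral>\<omega>'. iexp (u * block_sum (\<lambda>x. x) s t (N_path \<omega>) (X_seq \<omega>')) \<partial>M) = \<phi> u ^ (N t \<omega> - N s \<omega>)"
      by (simp add: char_block)
  qed
  finally show ?thesis .
qed

lemma N_mono_AE: "AE \<omega> in M. \<forall>s t. 0 \<le> s \<longrightarrow> s \<le> t \<longrightarrow> N s \<omega> \<le> N t \<omega>"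
  using N_paths by eventually_elim (auto simp: mono_on_def)

lemma count_distr:
  assumes "0 \<le> s" "s < t"
  shows "distr M (count_space UNIV) (\<lambda>\<omega>. N t \<omega> - N s \<omega>) = measure_pmf (poisson_pmf (rate * (t - s)))"
proof -
  have [measurable]: "N t \<in> measurable M (count_space UNIV)" "N s \<in> measurable M (count_space UNIV)"
    using assms by (auto intro: N_measurable)
  have "(\<lambda>\<omega>. N t \<omega> - N s \<omega>) = (\<lambda>\<omega>. nat (int (N t \<omega>) - int (N s \<omega>)))"
    by (simp add: fun_eq_iff nat_minus_as_int)
  then have "distr M (count_space UNIV) (\<lambda>\<omega>. N t \<omega> - N s \<omega>) =
     distr (distr M (count_space UNIV) (\<lambda>\<omega>. int (N t \<omega>) - int (N s \<omega>))) (count_space UNIV) nat"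
    by (subst distr_distr) (auto simp: comp_def)
  also have "\<dots> = measure_pmf (map_pmf nat (map_pmf int (poisson_pmf (rate * (t - s)))))"
    unfolding N_increment_distr[OF assms] map_pmf_rep_eq[of nat] ..
  finally show ?thesis by (simp add: map_pmf_comp)
qed

lemma nn_integral_count:
  assumes "0 \<le> s" "s < t"
  shows "(\<integral>\<^sup>+\<omega>. g (N t \<omega> - N s \<omega>) \<partial>M) = (\<integral>\<^sup>+k. g k \<partial>measure_pmf (poisson_pmf (rate * (t - s))))"
proof -
  have [measurable]: "N t \<in> measurable M (count_space UNIV)" "N s \<in> measurable M (count_space UNIV)"
    using assms by (auto intro: N_measurable)
  show ?thesis unfolding count_distr[OF assms, symmetric] by (subst nn_integral_distr) auto
qed

lemma integral_count:
  fixes g :: "nat \<Rightarrow> complex"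
  assumes "0 \<le> s" "s < t"
  shows "(\<integral>\<omega>. g (N t \<omega> - N s \<omega>) \<partial>M) = (\<integral>k. g k \<partial>measure_pmf (poisson_pmf (rate * (t - s))))"
proof -
  have [measurable]: "N t \<in> measurable M (count_space UNIV)" "N s \<in> measurable M (count_space UNIV)"
    using assms by (auto intro: N_measurable)
  show ?thesis unfolding count_distr[OF assms, symmetric] by (subst integral_distr) auto
qed

text \<open>
  Given the Poisson process, the increments over the intervals between successive multiples of \<open>\<Delta>\<close> are sums over
  disjoint blocks of the jumps. They are therefore independent and, by \<open>block_law\<close>, depend on the Poisson process
  only through the lengths of the blocks. These lengths are independent Poisson variables in turn. The right-hand
  side is a product of terms that do not depend on the position of the interval, so both the independence and the
  equality in law of the increments can be read off.
\<close>

lemma emeasure_blocks_prod: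
  assumes I: "finite I" and h: "0 < (\<Delta>::real)" and A: "\<And>i. i \<in> I \<Longrightarrow> A i \<in> sets borel"
  shows "emeasure M {\<omega> \<in> space M. \<forall>i\<in>I. jumps (\<lambda>x. x) (real i * \<Delta>) (real (Suc i) * \<Delta>) \<omega> \<in> A i} =
    (\<Prod>i\<in>I. \<integral>\<^sup>+k. emeasure (jump_law k) (A i) \<partial>measure_pmf (poisson_pmf (rate * \<Delta>)))"
proof -
  define \<tau> where "\<tau> i = real i * \<Delta>" for i
  have \<tau>: "0 \<le> \<tau> i" "\<tau> i < \<tau> (Suc i)" "\<tau> (Suc i) - \<tau> i = \<Delta>" for i
    using h by (auto simp: \<tau>_def algebra_simps)
  have mono_\<tau>: "mono \<tau>" using h by (auto simp: \<tau>_def mono_def)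
  let ?B = "\<lambda>i p x. block_sum (\<lambda>x. x) (\<tau> i) (\<tau> (Suc i)) p x"
  define g where "g p x = (\<Prod>i\<in>I. indicator (A i) (?B i p x) :: ennreal)" for p x
  have B_meas: "(\<lambda>z. ?B i (fst z) (snd z)) \<in> borel_measurable (PN \<Otimes>\<^sub>M PX)" for i
    using block_sum_measurable[OF \<tau>(1) \<tau>(1), of "\<lambda>x. x" i "Suc i"] by (simp add: case_prod_beta')
  have "(\<lambda>z. g (fst z) (snd z)) \<in> borel_measurable (PN \<Otimes>\<^sub>M PX)"
    unfolding g_def
    by (intro borel_measurable_prod_ennreal measurable_compose[OF B_meas] borel_measurable_indicator A)
  then have g_meas: "(\<lambda>(p, x). g p x) \<in> borel_measurable (PN \<Otimes>\<^sub>M PX)"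
    by (simp add: case_prod_beta')
  have J_meas: "random_variable borel (jumps (\<lambda>x. x) (\<tau> i) (\<tau> (Suc i)))" for i
    by (intro jumps_measurable \<tau>) simp
  have "{\<omega> \<in> space M. jumps (\<lambda>x. x) (\<tau> i) (\<tau> (Suc i)) \<omega> \<in> A i} \<in> events" if "i \<in> I" for i
    using measurable_sets[OF J_meas A[OF that], of i] by (simp add: vimage_def Int_def conj_commute)
  then have "{\<omega> \<in> space M. \<forall>i\<in>I. jumps (\<lambda>x. x) (\<tau> i) (\<tau> (Suc i)) \<omega> \<in> A i} \<in> events"
    using I by (intro sets.sets_Collect_finite_All)
  then have "emeasure M {\<omega> \<in> space M. \<forall>i\<in>I. jumps (\<lambda>x. x) (\<tau> i) (\<tau> (Suc i)) \<omega> \<in> A i} =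
      (\<integral>\<^sup>+\<omega>. indicator {\<omega> \<in> space M. \<forall>i\<in>I. jumps (\<lambda>x. x) (\<tau> i) (\<tau> (Suc i)) \<omega> \<in> A i} \<omega> \<partial>M)"
    by simp
  also have "\<dots> = (\<integral>\<^sup>+\<omega>. g (N_path \<omega>) (X_seq \<omega>) \<partial>M)"
  proof (rule nn_integral_cong)
    fix \<omega> assume "\<omega> \<in> space M"
    then show "indicator {\<omega> \<in> space M. \<forall>i\<in>I. jumps (\<lambda>x. x) (\<tau> i) (\<tau> (Suc i)) \<omega> \<in> A i} \<omega> = g (N_path \<omega>) (X_seq \<omega>)"
      unfolding g_def jumps_eq[OF \<tau>(1) \<tau>(1)] using I
      by (auto simp: indicator_def prod_zero_iff intro!: prod.neutral[symmetric] prod_zero[symmetric])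
  qed
  also have "\<dots> = (\<integral>\<^sup>+\<omega>. (\<integral>\<^sup>+\<omega>'. g (N_path \<omega>) (X_seq \<omega>') \<partial>M) \<partial>M)"
    by (rule decouple_nn_integral[OF g_meas])
  also have "\<dots> = (\<integral>\<^sup>+\<omega>. (\<Prod>i\<in>I. emeasure (jump_law (N (\<tau> (Suc i)) \<omega> - N (\<tau> i) \<omega>)) (A i)) \<partial>M)"
  proof (rule nn_integral_cong_AE, use N_mono_AE in eventually_elim)
    case (elim \<omega>)
    define k where "k i = N (\<tau> i) \<omega>" for i
    have mono_k: "mono k"
      unfolding mono_def k_def using elim \<tau>(1) mono_\<tau> by (auto simp: mono_def)
    define K where "K i = {k i<..k (Suc i)}" for i
    have disj: "disjoint_family_on K I"
      unfolding disjoint_family_on_def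
    proof (intro ballI impI)
      fix i j assume "i \<in> I" "j \<in> I" "i \<noteq> j"
      then consider "Suc i \<le> j" | "Suc j \<le> i" by linarith
      then show "K i \<inter> K j = {}"
        by cases (use monoD[OF mono_k] in \<open>fastforce simp: K_def\<close>)+
    qed
    have sub: "K i \<subseteq> {1..}" for i by (auto simp: K_def)
    have ind0: "indep_vars (\<lambda>i. PiM (K i) (\<lambda>_. borel)) (\<lambda>i \<omega>. restrict (\<lambda>l. X l \<omega>) (K i)) I"
      by (rule indep_vars_restrict[OF X_indep sub disj])
    have ind: "indep_vars (\<lambda>_. borel) (\<lambda>i \<omega>'. indicator (A i) (\<Sum>l\<in>K i. restrict (\<lambda>l. X l \<omega>') (K i) l) :: ennreal) I"
      by (rule indep_vars_compose2[OF ind0, where Y = "\<lambda>i x. indicator (A i) (\<Sum>l\<in>K i. x l)"])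
         (auto intro!: measurable_compose[OF _ borel_measurable_indicator[OF A]] borel_measurable_sum)
    have "(\<integral>\<^sup>+\<omega>'. g (N_path \<omega>) (X_seq \<omega>') \<partial>M) = (\<integral>\<^sup>+\<omega>'. (\<Prod>i\<in>I. indicator (A i) (\<Sum>l\<in>K i. restrict (\<lambda>l. X l \<omega>') (K i) l)) \<partial>M)"
      unfolding g_def block_sum_fixed[OF \<tau>(1) \<tau>(1)] by (simp add: K_def k_def)
    also have "\<dots> = (\<Prod>i\<in>I. \<integral>\<^sup>+\<omega>'. indicator (A i) (\<Sum>l\<in>K i. restrict (\<lambda>l. X l \<omega>') (K i) l) \<partial>M)"
      by (rule indep_vars_nn_integral[OF I ind]) simp
    also have "\<dots> = (\<Prod>i\<in>I. emeasure (jump_law (k (Suc i) - k i)) (A i))"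
    proof (rule prod.cong[OF refl])
      fix i assume i: "i \<in> I"
      have m: "(\<lambda>\<omega>'. \<Sum>l\<in>K i. X l \<omega>') \<in> borel_measurable M"
        by (intro borel_measurable_sum X_measurable) (auto simp: K_def)
      have "(\<integral>\<^sup>+\<omega>'. indicator (A i) (\<Sum>l\<in>K i. restrict (\<lambda>l. X l \<omega>') (K i) l) \<partial>M) =
          (\<integral>\<^sup>+x. indicator (A i) x \<partial>distr M borel (\<lambda>\<omega>'. \<Sum>l\<in>K i. X l \<omega>'))"
        using m A[OF i] by (subst nn_integral_distr) auto
      also have "\<dots> = emeasure (jump_law (k (Suc i) - k i)) (A i)"
        using A[OF i] unfolding K_def block_law by (simp add: jump_law_def)
      finally show "(\<integral>\<^sup>+\<omega>'. indicator (A i) (\<Sum>l\<in>K i. restrict (\<lambda>l. X l \<omega>') (K i) l) \<partial>M) = \<dots>" .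
    qed
    finally show ?case by (simp add: k_def)
  qed
  also have "\<dots> = (\<Prod>i\<in>I. \<integral>\<^sup>+\<omega>. emeasure (jump_law (N (\<tau> (Suc i)) \<omega> - N (\<tau> i) \<omega>)) (A i) \<partial>M)"
  proof (rule indep_vars_nn_integral[OF I])
    have "indep_vars (\<lambda>_. count_space UNIV) (\<lambda>i \<omega>. int (N (\<tau> (Suc i)) \<omega>) - int (N (\<tau> i) \<omega>)) I"
      by (rule indep_vars_subset[OF N_indep_increments[OF \<tau>(1) mono_\<tau>]]) simp
    from indep_vars_compose2[OF this, of "\<lambda>i z. emeasure (jump_law (nat z)) (A i)" "\<lambda>_. borel"]
    show "indep_vars (\<lambda>_. borel) (\<lambda>i \<omega>. emeasure (jump_law (N (\<tau> (Suc i)) \<omega> - N (\<tau> i) \<omega>)) (A i)) I"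
      by (simp add: nat_minus_as_int)
  qed simp
  also have "\<dots> = (\<Prod>i\<in>I. \<integral>\<^sup>+k. emeasure (jump_law k) (A i) \<partial>measure_pmf (poisson_pmf (rate * \<Delta>)))"
    by (intro prod.cong refl trans[OF nn_integral_count[OF \<tau>(1) \<tau>(2), where g = "\<lambda>k. emeasure (jump_law k) (A _)"]])
       (simp add: \<tau>(3))
  finally show ?thesis by (simp add: \<tau>_def)
qed

definition incr :: "real \<Rightarrow> nat \<Rightarrow> 'a \<Rightarrow> real" where
  "incr \<Delta> i = jumps (\<lambda>x. x) (real i * \<Delta>) (real (Suc i) * \<Delta>)"

lemma incr_measurable [measurable]: "0 < \<Delta> \<Longrightarrow> random_variable borel (incr \<Delta> i)"
  unfolding incr_def by (intro jumps_measurable) auto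

lemma emeasure_incr_prod:
  assumes "finite I" "0 < \<Delta>" "\<And>i. i \<in> I \<Longrightarrow> A i \<in> sets borel"
  shows "emeasure M {\<omega> \<in> space M. \<forall>i\<in>I. incr \<Delta> i \<omega> \<in> A i} = (\<Prod>i\<in>I. emeasure M (incr \<Delta> i -` A i \<inter> space M))"
proof -
  have "emeasure M (incr \<Delta> i -` A i \<inter> space M) =
      (\<integral>\<^sup>+k. emeasure (jump_law k) (A i) \<partial>measure_pmf (poisson_pmf (rate * \<Delta>)))" if "i \<in> I" for i
  proof -
    have "incr \<Delta> i -` A i \<inter> space M = {\<omega> \<in> space M. \<forall>i\<in>{i}. incr \<Delta> i \<omega> \<in> A i}" by auto
    then show ?thesis
      using emeasure_blocks_prod[of "{i}" \<Delta> A] assms that by (simp add: incr_def)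
  qed
  then show ?thesis
    using emeasure_blocks_prod[of I \<Delta> A] assms by (simp add: incr_def)
qed

lemma indep_incr:
  assumes "0 < \<Delta>" "0 < n"
  shows "indep_vars (\<lambda>_. borel) (incr \<Delta>) {..<n}"
proof (subst indep_vars_finite[where E = "\<lambda>_. sets borel"])
  show "\<forall>A\<in>{..<n} \<rightarrow> sets borel. prob (\<Inter>j\<in>{..<n}. incr \<Delta> j -` A j \<inter> space M) = (\<Prod>j<n. prob (incr \<Delta> j -` A j \<inter> space M))"
  proof
    fix A :: "nat \<Rightarrow> real set" assume A: "A \<in> {..<n} \<rightarrow> sets borel"
    have "(\<Inter>j\<in>{..<n}. incr \<Delta> j -` A j \<inter> space M) = {\<omega> \<in> space M. \<forall>i\<in>{..<n}. incr \<Delta> i \<omega> \<in> A i}"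
      using assms by auto
    then have "emeasure M (\<Inter>j\<in>{..<n}. incr \<Delta> j -` A j \<inter> space M) = (\<Prod>j<n. emeasure M (incr \<Delta> j -` A j \<inter> space M))"
      using A assms by (simp add: emeasure_incr_prod Pi_iff)
    then show "prob (\<Inter>j\<in>{..<n}. incr \<Delta> j -` A j \<inter> space M) = (\<Prod>j<n. prob (incr \<Delta> j -` A j \<inter> space M))"
      by (simp add: emeasure_eq_measure prod_ennreal prod_nonneg)
  qed
qed (use assms in \<open>auto simp: Int_stable_def sets.sigma_sets_eq[of borel, simplified]\<close>)

lemma distr_incr_eq:
  assumes "0 < \<Delta>"
  shows "distr M borel (incr \<Delta> i) = distr M borel (incr \<Delta> j)"
proof (rule measure_eqI)
  fix A assume "A \<in> sets (distr M borel (incr \<Delta> i))"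
  then have A: "A \<in> sets borel" by simp
  have "emeasure M (incr \<Delta> l -` A \<inter> space M) =
      (\<integral>\<^sup>+k. emeasure (jump_law k) A \<partial>measure_pmf (poisson_pmf (rate * \<Delta>)))" for l
  proof -
    have "incr \<Delta> l -` A \<inter> space M = {\<omega> \<in> space M. \<forall>i\<in>{l}. incr \<Delta> i \<omega> \<in> A}" by auto
    then show ?thesis
      using emeasure_blocks_prod[of "{l}" \<Delta> "\<lambda>_. A"] assms A by (simp add: incr_def)
  qed
  then show "emeasure (distr M borel (incr \<Delta> i)) A = emeasure (distr M borel (incr \<Delta> j)) A"
    using A assms by (simp add: emeasure_distr)
qed simp

lemma compound_sum_AE_eq: "0 \<le> t \<Longrightarrow> AE \<omega> in M. compound_sum N X t \<omega> = jumps (\<lambda>x. x) 0 t \<omega>"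
  using N_paths by eventually_elim (auto simp: compound_sum_def jumps_def intro!: sum.cong)

text \<open>
  The sample paths of the Poisson process are monotone almost surely, so that a difference of two partial sums of
  the jumps is the sum over a block.
\<close>

lemma increment_AE_eq:
  assumes "0 < \<Delta>"
  shows "AE \<omega> in M. \<forall>i. increment (compound_sum N X) \<Delta> \<omega> (Suc i) = incr \<Delta> i \<omega>"
  using N_mono_AE
proof eventually_elim
  case (elim \<omega>)
  show ?case
  proof
    fix i
    have le: "N (real i * \<Delta>) \<omega> \<le> N (real (Suc i) * \<Delta>) \<omega>"
      using elim assms by simp
    then have "{1..N (real (Suc i) * \<Delta>) \<omega>} = {1..N (real i * \<Delta>) \<omega>} \<union> {N (real i * \<Delta>) \<omega><..N (real (Suc i) * \<Delta>) \<omega>}"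
      by auto
    then have "compound_sum N X (real (Suc i) * \<Delta>) \<omega> = compound_sum N X (real i * \<Delta>) \<omega> + incr \<Delta> i \<omega>"
      unfolding compound_sum_def incr_def jumps_def by (simp only:) (rule sum.union_disjoint, auto)
    then show "increment (compound_sum N X) \<Delta> \<omega> (Suc i) = incr \<Delta> i \<omega>"
      by (simp add: increment_def)
  qed
qed

lemma char_incr:
  assumes "0 < \<Delta>"
  shows "char (distr M borel (incr \<Delta> i)) u = exp (of_real (rate * \<Delta>) * (\<phi> u - 1))"
proof -
  interpret X1: real_distribution "distr M borel (X 1)" by (rule real_distribution_distr) simp
  have "char (distr M borel (incr \<Delta> i)) u = (\<integral>k. \<phi> u ^ k \<partial>measure_pmf (poisson_pmf (rate * \<Delta>)))"
    unfolding distr_incr_eq[OF assms, of i 0] unfolding incr_def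
    using assms integral_count[of 0 \<Delta> "\<lambda>k. \<phi> u ^ k"] by (simp add: char_jumps)
  also have "\<dots> = exp (of_real (rate * \<Delta>) * (\<phi> u - 1))"
    using assms rate_pos X1.cmod_char_le_1 by (intro integral_poisson_power) (auto simp: \<phi>_def)
  finally show ?thesis .
qed

lemma char_compound_sum:
  assumes "0 < \<Delta>"
  shows "char (distr M borel (compound_sum N X \<Delta>)) u = exp (of_real (rate * \<Delta>) * (\<phi> u - 1))"
proof -
  have "random_variable borel (compound_sum N X \<Delta>)"
  proof -
    have 1: "(\<lambda>\<omega>. \<Sum>j\<in>{1..k}. X j \<omega>) \<in> borel_measurable M" for k :: nat
      by (intro borel_measurable_sum X_measurable) simp
    show ?thesis unfolding compound_sum_def[abs_def]
      by (rule measurable_compose_countable[where f = "\<lambda>k \<omega>. \<Sum>j\<in>{1..k}. X j \<omega>", OF 1 N_measurable])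
         (use assms in simp)
  qed
  moreover have "AE \<omega> in M. compound_sum N X \<Delta> \<omega> = incr \<Delta> 0 \<omega>"
    using compound_sum_AE_eq[of \<Delta>] assms by (simp add: incr_def)
  ultimately have "distr M borel (compound_sum N X \<Delta>) = distr M borel (incr \<Delta> 0)"
    using assms by (intro distr_cong_AE) auto
  then show ?thesis using char_incr[OF assms] by simp
qed

lemma expectation_X_eq:
  assumes "1 \<le> l" "g \<in> borel_measurable borel"
  shows "expectation (\<lambda>\<omega>. g (X l \<omega>) :: real) = expectation (\<lambda>\<omega>. g (X 1 \<omega>))"
proof -
  have "expectation (\<lambda>\<omega>. g (X l \<omega>)) = (\<integral>x. g x \<partial>distr M borel (X l))"
    using assms by (intro integral_distr[symmetric]) auto
  also have "\<dots> = (\<integral>x. g x \<partial>distr M borel (X 1))" by (simp only: X_ident[OF assms(1)])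
  also have "\<dots> = expectation (\<lambda>\<omega>. g (X 1 \<omega>))"
    using assms by (intro integral_distr) auto
  finally show ?thesis .
qed

lemma integrable_X_eq:
  assumes "1 \<le> l" "g \<in> borel_measurable borel" "integrable M (\<lambda>\<omega>. g (X 1 \<omega>) :: real)"
  shows "integrable M (\<lambda>\<omega>. g (X l \<omega>))"
proof -
  have "integrable (distr M borel (X l)) g"
    unfolding X_ident[OF assms(1)] using assms by (subst integrable_distr_eq) auto
  then show ?thesis using assms by (subst (asm) integrable_distr_eq) auto
qed

text \<open>
  Given that there are \<open>k\<close> jumps, the total variation is a sum of \<open>k\<close> independent variables with mean \<open>\<mu>\<close> and variance
  \<open>v\<close>, so the conditional mean square is \<open>k v + (k - T)\<^sup>2 \<mu>\<^sup>2\<close>. Mean and variance of \<open>k\<close> are both equal to \<open>T\<close>.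
\<close>

lemma total_variation_variance:
  assumes X2: "integrable M (\<lambda>\<omega>. (X 1 \<omega>)\<^sup>2)" and t: "0 < t"
  defines "\<mu> \<equiv> expectation (\<lambda>\<omega>. \<bar>X 1 \<omega>\<bar>)"
  shows "(\<integral>\<^sup>+\<omega>. ennreal ((jumps abs 0 t \<omega> - rate * t * \<mu>)\<^sup>2) \<partial>M) = ennreal (rate * t * expectation (\<lambda>\<omega>. (X 1 \<omega>)\<^sup>2))"
proof -
  let ?T = "rate * t"
  let ?c = "?T * \<mu>"
  have T: "0 < ?T" using rate_pos t by simp
  have X1: "integrable M (\<lambda>\<omega>. \<bar>X 1 \<omega>\<bar>)"
    by (intro integrable_abs square_integrable_imp_integrable[OF _ X2]) simp
  define v where "v = expectation (\<lambda>\<omega>. (X 1 \<omega>)\<^sup>2) - \<mu>\<^sup>2"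
  have v: "expectation (\<lambda>\<omega>. (\<bar>X 1 \<omega>\<bar> - \<mu>)\<^sup>2) = v"
    using variance_eq[OF X1] X2 by (simp add: v_def \<mu>_def)
  have v_nonneg: "0 \<le> v" unfolding v[symmetric] by simp
  have "integrable M (\<lambda>\<omega>. (X 1 \<omega>)\<^sup>2 - 2 * \<mu> * \<bar>X 1 \<omega>\<bar> + \<mu>\<^sup>2)"
    using X1 X2 by auto
  then have W2: "integrable M (\<lambda>\<omega>. (\<bar>X 1 \<omega>\<bar> - \<mu>)\<^sup>2)"
    by (simp add: power2_diff algebra_simps)
  have lin: "expectation (\<lambda>\<omega>. f \<omega> + c * g \<omega> + d) = expectation f + c * expectation g + d"
    if "integrable M f" "integrable M g" for f g :: "'a \<Rightarrow> real" and c d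
    using that by (simp add: prob_space)
  have inner: "(\<integral>\<^sup>+\<omega>'. ennreal (((\<Sum>l\<in>{a<..b}. \<bar>X l \<omega>'\<bar>) - ?c)\<^sup>2) \<partial>M) =
     ennreal (real (b - a) * v + (real (b - a) - ?T)\<^sup>2 * \<mu>\<^sup>2)" for a b
  proof -
    let ?W = "\<lambda>l \<omega>. \<bar>X l \<omega>\<bar> - \<mu>"
    let ?d = "real (b - a) * \<mu> - ?c"
    have ind: "indep_vars (\<lambda>_. borel) ?W {a<..b}"
      by (rule indep_vars_compose2[OF indep_vars_subset[OF X_indep]]) auto
    have sq: "integrable M (\<lambda>\<omega>. (?W l \<omega>)\<^sup>2)" if "l \<in> {a<..b}" for l
      using that W2 by (intro integrable_X_eq[of l "\<lambda>x. (\<bar>x\<bar> - \<mu>)\<^sup>2"]) auto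
    have mean: "expectation (?W l) = 0" if "l \<in> {a<..b}" for l
      using that X1 expectation_X_eq[of l "\<lambda>x. \<bar>x\<bar> - \<mu>"] by (simp add: \<mu>_def prob_space)
    have W_int: "integrable M (?W l)" if "l \<in> {a<..b}" for l
      using that X1 by (intro integrable_X_eq[of l "\<lambda>x. \<bar>x\<bar> - \<mu>"]) auto
    have var: "expectation (\<lambda>\<omega>. (?W l \<omega>)\<^sup>2) = v" if "l \<in> {a<..b}" for l
      using that v expectation_X_eq[of l "\<lambda>x. (\<bar>x\<bar> - \<mu>)\<^sup>2"] by simp
    note S = integral_square_sum_centred[OF _ ind sq mean, simplified]
    have S_int: "integrable M (\<lambda>\<omega>. \<Sum>l\<in>{a<..b}. ?W l \<omega>)"
      by (intro Bochner_Integration.integrable_sum W_int)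
    have S_mean: "expectation (\<lambda>\<omega>. \<Sum>l\<in>{a<..b}. ?W l \<omega>) = 0"
      using mean W_int by (subst Bochner_Integration.integral_sum) auto
    have eq: "((\<Sum>l\<in>{a<..b}. \<bar>X l \<omega>\<bar>) - ?c)\<^sup>2 = (\<Sum>l\<in>{a<..b}. ?W l \<omega>)\<^sup>2 + 2 * ?d * (\<Sum>l\<in>{a<..b}. ?W l \<omega>) + ?d\<^sup>2" for \<omega>
      by (simp add: sum_subtractf power2_eq_square algebra_simps)
    have S1: "integrable M (\<lambda>\<omega>. (\<Sum>l\<in>{a<..b}. ?W l \<omega>)\<^sup>2)"
      and S2: "expectation (\<lambda>\<omega>. (\<Sum>l\<in>{a<..b}. ?W l \<omega>)\<^sup>2) = real (b - a) * v"
      using S var by auto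
    have int: "integrable M (\<lambda>\<omega>. ((\<Sum>l\<in>{a<..b}. \<bar>X l \<omega>\<bar>) - ?c)\<^sup>2)"
      unfolding eq using S1 S_int by (intro Bochner_Integration.integrable_add integrable_mult_right integrable_const)
    have "expectation (\<lambda>\<omega>. ((\<Sum>l\<in>{a<..b}. \<bar>X l \<omega>\<bar>) - ?c)\<^sup>2) = real (b - a) * v + 2 * ?d * 0 + ?d\<^sup>2"
      unfolding eq lin[OF S1 S_int] S2 S_mean ..
    also have "?d\<^sup>2 = (real (b - a) - ?T)\<^sup>2 * \<mu>\<^sup>2"
      by (simp add: power_mult_distrib flip: left_diff_distrib)
    finally show ?thesis
      by (subst nn_integral_eq_integral[OF int]) auto
  qed
  have meas: "(\<lambda>(p, x). ennreal ((block_sum abs 0 t p x - ?c)\<^sup>2)) \<in> borel_measurable (PN \<Otimes>\<^sub>M PX)"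
    using block_sum_measurable[of 0 t abs] t by (simp add: case_prod_beta')
  have "(\<integral>\<^sup>+\<omega>. ennreal ((jumps abs 0 t \<omega> - ?c)\<^sup>2) \<partial>M) =
     (\<integral>\<^sup>+\<omega>. (\<integral>\<^sup>+\<omega>'. ennreal ((block_sum abs 0 t (N_path \<omega>) (X_seq \<omega>') - ?c)\<^sup>2) \<partial>M) \<partial>M)"
    using decouple_nn_integral[OF meas] t by (simp add: jumps_eq)
  also have "\<dots> = (\<integral>\<^sup>+\<omega>. ennreal (real (N t \<omega> - N 0 \<omega>) * v + (real (N t \<omega> - N 0 \<omega>) - ?T)\<^sup>2 * \<mu>\<^sup>2) \<partial>M)"
    using t by (simp add: block_sum_fixed inner)
  also have "\<dots> = (\<integral>\<^sup>+k. ennreal (real k * v + (real k - ?T)\<^sup>2 * \<mu>\<^sup>2) \<partial>measure_pmf (poisson_pmf ?T))"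
    using t by (subst nn_integral_count) auto
  also have "\<dots> = ennreal (?T * (v + \<mu>\<^sup>2))"
    using T v_nonneg by (intro nn_integral_poisson_quadratic) auto
  finally show ?thesis by (simp add: v_def)
qed

text \<open>
  Chebyshev's inequality with deviation \<open>T\<close> from the mean.
\<close>

lemma prob_total_variation_le:
  assumes X2: "integrable M (\<lambda>\<omega>. (X 1 \<omega>)\<^sup>2)" and t: "0 < t"
  defines "\<mu> \<equiv> expectation (\<lambda>\<omega>. \<bar>X 1 \<omega>\<bar>)"
  shows "emeasure M {\<omega> \<in> space M. rate * t * (\<mu> + 1) < jumps abs 0 t \<omega>} \<le> ennreal (expectation (\<lambda>\<omega>. (X 1 \<omega>)\<^sup>2) / (rate * t))"
proof -
  let ?T = "rate * t"
  have T: "0 < ?T" using rate_pos t by simp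
  have [measurable]: "random_variable borel (jumps abs 0 t)" using t by (intro jumps_measurable) auto
  have "emeasure M {\<omega> \<in> space M. ?T * (\<mu> + 1) < jumps abs 0 t \<omega>} = (\<integral>\<^sup>+\<omega>. indicator {\<omega> \<in> space M. ?T * (\<mu> + 1) < jumps abs 0 t \<omega>} \<omega> \<partial>M)"
    by simp
  also have "\<dots> \<le> (\<integral>\<^sup>+\<omega>. ennreal (1 / ?T\<^sup>2) * ennreal ((jumps abs 0 t \<omega> - ?T * \<mu>)\<^sup>2) \<partial>M)"
  proof (rule nn_integral_mono)
    fix \<omega>
    have "1 \<le> 1 / ?T\<^sup>2 * (jumps abs 0 t \<omega> - ?T * \<mu>)\<^sup>2" if "?T * (\<mu> + 1) < jumps abs 0 t \<omega>"
    proof -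
      have "?T \<le> jumps abs 0 t \<omega> - ?T * \<mu>" using that by (simp add: algebra_simps)
      then have "?T\<^sup>2 \<le> (jumps abs 0 t \<omega> - ?T * \<mu>)\<^sup>2" using T by (intro power_mono) auto
      then have "1 \<le> (jumps abs 0 t \<omega> - ?T * \<mu>)\<^sup>2 / ?T\<^sup>2"
        by (simp only: le_divide_eq_1_pos zero_less_power T)
      then show ?thesis by simp
    qed
    then show "indicator {\<omega> \<in> space M. ?T * (\<mu> + 1) < jumps abs 0 t \<omega>} \<omega> \<le> ennreal (1 / ?T\<^sup>2) * ennreal ((jumps abs 0 t \<omega> - ?T * \<mu>)\<^sup>2)"
      by (auto simp: indicator_def simp flip: ennreal_mult' intro: ennreal_leI[of 1, simplified])
  qed
  also have "\<dots> = ennreal (1 / ?T\<^sup>2) * ennreal (?T * expectation (\<lambda>\<omega>. (X 1 \<omega>)\<^sup>2))"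
    using total_variation_variance[OF X2 t] by (subst nn_integral_cmult) (auto simp: \<mu>_def)
  also have "\<dots> = ennreal (expectation (\<lambda>\<omega>. (X 1 \<omega>)\<^sup>2) / ?T)"
    using T by (simp add: power2_eq_square flip: ennreal_mult')
  finally show ?thesis .
qed

lemma sum_abs_incr_le:
  "AE \<omega> in M. \<forall>n. (\<Sum>i<n. \<bar>incr \<Delta> i \<omega>\<bar>) \<le> jumps abs 0 (real n * \<Delta>) \<omega>" if "0 < \<Delta>"
  using N_mono_AE
proof eventually_elim
  case (elim \<omega>)
  have "(\<Sum>i<n. \<bar>incr \<Delta> i \<omega>\<bar>) \<le> jumps abs 0 (real n * \<Delta>) \<omega>" for n
  proof (induction n)
    case (Suc n)
    have 1: "N 0 \<omega> \<le> N (real n * \<Delta>) \<omega>" "N (real n * \<Delta>) \<omega> \<le> N (real (Suc n) * \<Delta>) \<omega>"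
      using elim that by auto
    then have "{N 0 \<omega><..N (real (Suc n) * \<Delta>) \<omega>} = {N 0 \<omega><..N (real n * \<Delta>) \<omega>} \<union> {N (real n * \<Delta>) \<omega><..N (real (Suc n) * \<Delta>) \<omega>}"
      by auto
    then have "jumps abs 0 (real (Suc n) * \<Delta>) \<omega> = jumps abs 0 (real n * \<Delta>) \<omega> + jumps abs (real n * \<Delta>) (real (Suc n) * \<Delta>) \<omega>"
      unfolding jumps_def by (simp only:) (rule sum.union_disjoint, auto)
    moreover have "\<bar>incr \<Delta> n \<omega>\<bar> \<le> jumps abs (real n * \<Delta>) (real (Suc n) * \<Delta>) \<omega>"
      unfolding incr_def jumps_def by (rule sum_abs)
    ultimately show ?case using Suc by simp
  qed (simp add: jumps_def sum_nonneg)
  then show ?case by blast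
qed

end

section \<open>The distinguished logarithm of the empirical characteristic function\<close>

lemma emp_char_has_vector_derivative:
  "(emp_char y n has_vector_derivative emp_char' y n u) (at u within S)"
proof -
  have *: "((\<lambda>u. iexp (u * y j)) has_vector_derivative \<i> * y j * iexp (u * y j)) (at u within S)" for j
  proof -
    have "((\<lambda>u. complex_of_real u * (\<i> * y j)) has_vector_derivative 1 * (\<i> * y j)) (at u within S)"
      by (intro has_vector_derivative_mult_left has_vector_derivative_of_real) (auto intro: derivative_eq_intros)
    from field_vector_diff_chain_within[OF this, of exp "exp (complex_of_real u * (\<i> * y j))"]
    show ?thesis by (simp add: comp_def DERIV_exp has_field_derivative_at_within mult_ac)
  qed
  show ?thesis
    unfolding emp_char_def[abs_def] emp_char'_def
    by (intro has_vector_derivative_mult_right has_vector_derivative_sum *)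
qed

lemma continuous_emp_char: "continuous_on S (emp_char y n)"
  and continuous_emp_char': "continuous_on S (emp_char' y n)"
  unfolding emp_char_def[abs_def] emp_char'_def[abs_def] by (intro continuous_intros)+

lemma emp_char_0: "0 < n \<Longrightarrow> emp_char y n 0 = 1"
  by (simp add: emp_char_def)

context
  fixes y :: "nat \<Rightarrow> real" and n :: nat and u :: real
  assumes n: "0 < n" and nz: "\<And>z. z \<in> closed_segment 0 u \<Longrightarrow> emp_char y n z \<noteq> 0"
begin

lemma emp_Log_has_vector_derivative:
  assumes "v \<in> closed_segment 0 u"
  shows "(emp_Log y n has_vector_derivative emp_char' y n v / emp_char y n v) (at v within closed_segment 0 u)"
proof -
  have seg: "closed_segment 0 u = {min 0 u..max 0 u}"
    by (simp add: closed_segment_eq_real_ivl min_def max_def)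
  have "continuous_on {min 0 u..max 0 u} (\<lambda>z. emp_char' y n z / emp_char y n z)"
    using nz unfolding seg by (intro continuous_intros continuous_emp_char continuous_emp_char') auto
  from interval_integral_FTC2[OF _ _ this, of 0 v] show ?thesis
    using assms unfolding seg emp_Log_def[abs_def] by simp
qed

text \<open>
  The product of the empirical characteristic function and \<open>exp (- emp_Log)\<close> has derivative \<open>0\<close>.
\<close>

lemma exp_emp_Log:
  assumes v: "v \<in> closed_segment 0 u"
  shows "exp (emp_Log y n v) = emp_char y n v"
proof -
  let ?S = "closed_segment 0 u" and ?E = "emp_char y n" and ?E' = "emp_char' y n" and ?L = "emp_Log y n"
  have der: "((\<lambda>z. ?E z * exp (- ?L z)) has_vector_derivative 0) (at z within ?S)" if z: "z \<in> ?S" for z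
  proof -
    have "((\<lambda>z. - ?L z) has_vector_derivative - (?E' z / ?E z)) (at z within ?S)"
      by (intro has_vector_derivative_minus emp_Log_has_vector_derivative z)
    from field_vector_diff_chain_within[OF this, of exp "exp (- ?L z)"]
    have "((\<lambda>z. exp (- ?L z)) has_vector_derivative - (?E' z / ?E z) * exp (- ?L z)) (at z within ?S)"
      by (simp add: comp_def DERIV_exp has_field_derivative_at_within)
    from has_vector_derivative_mult[OF emp_char_has_vector_derivative this, of y n]
    show ?thesis using nz[OF z] by simp
  qed
  from has_vector_derivative_zero_constant[OF convex_closed_segment der]
  obtain c where c: "\<And>z. z \<in> ?S \<Longrightarrow> ?E z * exp (- ?L z) = c" by auto
  have "?L 0 = 0" unfolding emp_Log_def by (rule interval_integral_endpoints_same)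
  then have "c = 1" using c[of 0] emp_char_0[OF n] by simp
  then show ?thesis using c[OF v] by (simp add: exp_minus field_simps)
qed

text \<open>
  The difference \<open>h\<close> of the two sides is continuous along the segment, and \<open>exp h = 1\<close> everywhere. So \<open>h\<close> takes values
  in the discrete set of the multiples of \<open>2 \<pi> \<i>\<close> and keeps its value \<open>0\<close> at the origin. The hypothesis that the quotient
  stays in the unit disc around \<open>1\<close> makes the principal logarithm continuous.
\<close>

lemma emp_Log_eq:
  assumes \<psi>: "continuous_on (closed_segment 0 u) \<psi>" "\<psi> 0 = 0"
    and near: "\<And>v. v \<in> closed_segment 0 u \<Longrightarrow> cmod (emp_char y n v / exp (\<psi> v) - 1) < 1"
  shows "emp_Log y n u = \<psi> u + Ln (emp_char y n u / exp (\<psi> u))"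
proof -
  let ?S = "closed_segment 0 u" and ?E = "emp_char y n" and ?L = "emp_Log y n"
  define R where "R v = ?E v / exp (\<psi> v)" for v
  define h where "h v = ?L v - \<psi> v - Ln (R v)" for v
  have R_slit: "R v \<notin> \<real>\<^sub>\<le>\<^sub>0" if "v \<in> ?S" for v
  proof -
    have "\<bar>Re (R v - 1)\<bar> < 1" using near[OF that] abs_Re_le_cmod[of "R v - 1"] by (simp add: R_def)
    then have "0 < Re (R v)" by simp
    then show ?thesis by (auto simp: complex_nonpos_Reals_iff)
  qed
  have R_cont: "continuous_on ?S R"
    unfolding R_def by (intro continuous_intros continuous_emp_char \<psi>) auto
  have L_cont: "continuous_on ?S ?L"
    unfolding continuous_on_eq_continuous_within
    using emp_Log_has_vector_derivative has_vector_derivative_continuous by blast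
  have h_cont: "continuous_on ?S h"
    unfolding h_def using R_slit by (intro continuous_intros L_cont \<psi> R_cont) auto
  have exp_h: "exp (h v) = 1" if v: "v \<in> ?S" for v
  proof -
    have "R v \<noteq> 0" using R_slit[OF v] by auto
    then have "exp (h v) = ?E v / exp (\<psi> v) / R v"
      by (simp add: h_def exp_diff exp_emp_Log[OF v])
    then show ?thesis using \<open>R v \<noteq> 0\<close> by (simp add: R_def)
  qed
  have "h constant_on ?S"
  proof (rule continuous_discrete_range_constant[OF connected_segment(1) h_cont])
    fix x assume x: "x \<in> ?S"
    have "1 \<le> cmod (h z - h x)" if z: "z \<in> ?S" "h z \<noteq> h x" for z
    proof -
      have "exp (h z - h x) = 1" using exp_h[OF x] exp_h[OF z(1)] by (simp add: exp_diff)
      then obtain k :: int where k: "Re (h z - h x) = 0" "Im (h z - h x) = of_int (2 * k) * pi"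
        unfolding exp_eq_1 by blast
      have "k \<noteq> 0" using k z(2) by (auto simp: complex_eq_iff)
      then have "1 \<le> \<bar>of_int k :: real\<bar>" by linarith
      then have "1 * 1 \<le> \<bar>of_int (2 * k)\<bar> * pi" using pi_gt3 by (intro mult_mono) auto
      also have "\<dots> = \<bar>Im (h z - h x)\<bar>" unfolding k abs_mult by simp
      also have "\<dots> \<le> cmod (h z - h x)" by (rule abs_Im_le_cmod)
      finally show ?thesis by simp
    qed
    then show "\<exists>e>0. \<forall>z. z \<in> ?S \<and> h z \<noteq> h x \<longrightarrow> e \<le> norm (h z - h x)"
      by (intro exI[of _ 1]) auto
  qed
  then have "h u = h 0" unfolding constant_on_def by auto
  also have "h 0 = 0"
  proof -
    have "?L 0 = 0" unfolding emp_Log_def by (rule interval_integral_endpoints_same)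
    then show ?thesis by (simp add: h_def R_def \<psi> emp_char_0[OF n])
  qed
  finally show ?thesis by (simp add: h_def R_def algebra_simps)
qed

end

lemma cmod_phi_tilde_le: "cmod (phi_tilde \<Delta> y n u) \<le> 4"
  by (simp add: phi_tilde_def)

lemma phi_tilde_error_crude:
  assumes "cmod w \<le> 1" shows "(cmod (phi_tilde \<Delta> y n u - w))\<^sup>2 \<le> 25"
proof -
  have "cmod (phi_tilde \<Delta> y n u - w) \<le> 4 + 1"
    using cmod_phi_tilde_le[of \<Delta> y n u] assms norm_triangle_ineq4[of "phi_tilde \<Delta> y n u" w] by linarith
  then have "(cmod (phi_tilde \<Delta> y n u - w))\<^sup>2 \<le> (4 + 1)\<^sup>2" by (rule power_mono) simp
  then show ?thesis by simp
qed

text \<open>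
  From \<open>|Ln (1 + z) - z| \<le> |z|\<^sup>2 / (1 - |z|)\<close> one gets \<open>|Ln (1 + z)| \<le> |z| / (1 - |z|)\<close>, and \<open>1 / (1 - 2/5) = 5/3\<close>. The radius
  \<open>2/5\<close> is chosen so that \<open>(5/3)\<^sup>2 * 4 / (2 \<pi>) \<le> 2\<close>, the constant in front of the variance term.
\<close>

lemma cmod_Ln_le:
  assumes "cmod (w - 1) \<le> 2 / 5" shows "cmod (Ln w) \<le> 5 / 3 * cmod (w - 1)"
proof -
  let ?r = "cmod (w - 1)"
  have "cmod (Ln w) \<le> cmod (Ln (1 + (w - 1)) - (w - 1)) + ?r"
    using norm_triangle_sub[of "Ln w" "w - 1"] by simp
  also have "cmod (Ln (1 + (w - 1)) - (w - 1)) \<le> ?r\<^sup>2 / (1 - ?r)"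
    using assms by (intro Ln_approx_linear) simp
  also have "?r\<^sup>2 / (1 - ?r) \<le> 2 / 3 * ?r"
  proof -
    have "?r * ?r \<le> 2 / 3 * ?r * (1 - ?r)"
    proof -
      have "?r * ?r \<le> ?r * (2 / 3 * (1 - ?r))" using assms by (intro mult_left_mono) auto
      then show ?thesis by (simp only: mult_ac)
    qed
    then show ?thesis using assms by (simp add: pos_divide_le_eq power2_eq_square)
  qed
  finally show ?thesis by simp
qed

text \<open>
  The truncation does no harm: where it is active, \<open>phi_hat\<close> is further than \<open>3\<close> from \<open>\<phi>\<close>, whereas \<open>0\<close> is within \<open>1\<close>.
\<close>

lemma phi_tilde_error_good:
  assumes "0 < n" "0 < \<Delta>" and \<phi>: "\<And>v. isCont \<phi> v" "\<phi> 0 = 1" "\<And>v. cmod (\<phi> v) \<le> 1"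
  defines "\<phi>\<^sub>\<Delta> \<equiv> \<lambda>v. exp (complex_of_real \<Delta> * (\<phi> v - 1))"
  assumes good: "\<And>v. v \<in> closed_segment 0 u \<Longrightarrow> cmod (emp_char y n v - \<phi>\<^sub>\<Delta> v) \<le> 2 / 5 * cmod (\<phi>\<^sub>\<Delta> v)"
  shows "(cmod (phi_tilde \<Delta> y n u - \<phi> u))\<^sup>2 \<le> 25 / (9 * \<Delta>\<^sup>2) * ((cmod (emp_char y n u - \<phi>\<^sub>\<Delta> u))\<^sup>2 / (cmod (\<phi>\<^sub>\<Delta> u))\<^sup>2)"
proof -
  let ?E = "emp_char y n"
  have ratio: "cmod (?E v / \<phi>\<^sub>\<Delta> v - 1) = cmod (?E v - \<phi>\<^sub>\<Delta> v) / cmod (\<phi>\<^sub>\<Delta> v)" for v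
  proof -
    have "?E v / \<phi>\<^sub>\<Delta> v - 1 = (?E v - \<phi>\<^sub>\<Delta> v) / \<phi>\<^sub>\<Delta> v" by (simp add: \<phi>\<^sub>\<Delta>_def field_simps)
    then show ?thesis by (simp add: norm_divide)
  qed
  have pos: "0 < cmod (\<phi>\<^sub>\<Delta> v)" for v by (simp add: \<phi>\<^sub>\<Delta>_def)
  have near: "cmod (?E v / \<phi>\<^sub>\<Delta> v - 1) \<le> 2 / 5" if "v \<in> closed_segment 0 u" for v
    unfolding ratio using good[OF that] pos[of v] by (simp add: pos_divide_le_eq)
  have nz: "?E v \<noteq> 0" if "v \<in> closed_segment 0 u" for v
    using near[OF that] by auto
  have "emp_Log y n u = complex_of_real \<Delta> * (\<phi> u - 1) + Ln (?E u / exp (complex_of_real \<Delta> * (\<phi> u - 1)))"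
  proof (rule emp_Log_eq[where \<psi> = "\<lambda>v. complex_of_real \<Delta> * (\<phi> v - 1)"])
    show "continuous_on (closed_segment 0 u) (\<lambda>v. complex_of_real \<Delta> * (\<phi> v - 1))"
      by (intro continuous_intros continuous_at_imp_continuous_on ballI \<phi>(1))
    show "cmod (?E v / exp (complex_of_real \<Delta> * (\<phi> v - 1)) - 1) < 1" if "v \<in> closed_segment 0 u" for v
      using near[OF that] by (simp add: \<phi>\<^sub>\<Delta>_def)
  qed (use \<open>0 < n\<close> nz \<phi> in auto)
  then have hat: "phi_hat \<Delta> y n u - \<phi> u = Ln (?E u / \<phi>\<^sub>\<Delta> u) / \<Delta>"
    using \<open>0 < \<Delta>\<close> by (simp add: phi_hat_def \<phi>\<^sub>\<Delta>_def field_simps)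
  have "cmod (phi_tilde \<Delta> y n u - \<phi> u) \<le> cmod (phi_hat \<Delta> y n u - \<phi> u)"
  proof (cases "cmod (phi_hat \<Delta> y n u) \<le> 4")
    case True
    then show ?thesis using nz by (auto simp: phi_tilde_def)
  next
    case False
    then have "1 \<le> cmod (phi_hat \<Delta> y n u - \<phi> u)"
      using \<phi>(3)[of u] norm_triangle_ineq2[of "phi_hat \<Delta> y n u" "\<phi> u"] by linarith
    then show ?thesis using False \<phi>(3)[of u] by (auto simp: phi_tilde_def)
  qed
  also have "\<dots> = cmod (Ln (?E u / \<phi>\<^sub>\<Delta> u)) / \<Delta>"
    unfolding hat using \<open>0 < \<Delta>\<close> by (simp add: norm_divide)
  also have "\<dots> \<le> 5 / 3 * cmod (?E u / \<phi>\<^sub>\<Delta> u - 1) / \<Delta>"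
    using near[of u] \<open>0 < \<Delta>\<close> by (intro divide_right_mono cmod_Ln_le) auto
  finally have "(cmod (phi_tilde \<Delta> y n u - \<phi> u))\<^sup>2 \<le> (5 / 3 * cmod (?E u / \<phi>\<^sub>\<Delta> u - 1) / \<Delta>)\<^sup>2"
    by (rule power_mono) simp
  also have "\<dots> = 25 / (9 * \<Delta>\<^sup>2) * ((cmod (?E u - \<phi>\<^sub>\<Delta> u))\<^sup>2 / (cmod (\<phi>\<^sub>\<Delta> u))\<^sup>2)"
    unfolding ratio by (simp add: power_divide power_mult_distrib)
  finally show ?thesis .
qed

text \<open>
  The points that can be reached from \<open>0\<close> without meeting a zero form an interval, and \<open>emp_Log\<close> is a parameter
  integral.
\<close>

lemma phi_tilde_measurable: "phi_tilde \<Delta> y n \<in> borel_measurable borel"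
proof -
  let ?E = "emp_char y n" and ?g = "\<lambda>z. emp_char' y n z / emp_char y n z"
  have [measurable]: "?E \<in> borel_measurable borel" "emp_char' y n \<in> borel_measurable borel"
    by (intro borel_measurable_continuous_onI continuous_emp_char continuous_emp_char')+
  have Log: "emp_Log y n u = (if 0 \<le> u then (\<integral>z. (if 0 < z \<and> z < u then ?g z else 0) \<partial>lborel)
      else - (\<integral>z. (if u < z \<and> z < 0 then ?g z else 0) \<partial>lborel))" for u
    unfolding emp_Log_def interval_lebesgue_integral_def set_lebesgue_integral_def
    by (auto intro!: Bochner_Integration.integral_cong simp: indicator_def)
  have [measurable]: "emp_Log y n \<in> borel_measurable borel"
    unfolding Log[abs_def] by measurable
  have [measurable]: "phi_hat \<Delta> y n \<in> borel_measurable borel"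
    unfolding phi_hat_def[abs_def] by measurable
  have "is_interval {u. \<forall>z\<in>closed_segment 0 u. ?E z \<noteq> 0}"
    unfolding is_interval_1
  proof (intro ballI allI impI)
    fix a b x assume "a \<in> {u. \<forall>z\<in>closed_segment 0 u. ?E z \<noteq> 0}" "b \<in> {u. \<forall>z\<in>closed_segment 0 u. ?E z \<noteq> 0}" "a \<le> x \<and> x \<le> b"
    moreover have "closed_segment 0 x \<subseteq> closed_segment 0 a \<union> closed_segment 0 b" if "a \<le> x \<and> x \<le> b"
      using that by (auto simp: closed_segment_eq_real_ivl)
    ultimately show "x \<in> {u. \<forall>z\<in>closed_segment 0 u. ?E z \<noteq> 0}" by blast
  qed
  then have "{u. \<forall>z\<in>closed_segment 0 u. ?E z \<noteq> 0} \<in> sets borel"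
    by (rule real_interval_borel_measurable)
  moreover have "{u. \<exists>z\<in>closed_segment 0 u. ?E z = 0} = UNIV - {u. \<forall>z\<in>closed_segment 0 u. ?E z \<noteq> 0}" by auto
  ultimately have [measurable]: "Measurable.pred borel (\<lambda>u. \<exists>z\<in>closed_segment 0 u. ?E z = 0)"
    by (simp add: pred_def)
  show ?thesis unfolding phi_tilde_def[abs_def] by measurable
qed

section \<open>The risk bound\<close>

locale decompounding = compound_poisson M 1 N X
  for M :: "'a measure" and N :: "real \<Rightarrow> 'a \<Rightarrow> nat" and X :: "nat \<Rightarrow> 'a \<Rightarrow> real" +
  fixes f :: "real \<Rightarrow> real"
  assumes f_nonneg: "\<And>x. 0 \<le> f x"
    and f_density: "distributed M lborel (X 1) (\<lambda>x. ennreal (f x))"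
    and X_square: "integrable M (\<lambda>\<omega>. (X 1 \<omega>)\<^sup>2)"
begin

sublocale X1: real_distribution "distr M borel (X 1)"
  by (rule real_distribution_distr) simp

definition \<mu> :: real where "\<mu> = expectation (\<lambda>\<omega>. \<bar>X 1 \<omega>\<bar>)"

lemma \<mu>_nonneg: "0 \<le> \<mu>" by (simp add: \<mu>_def)

lemma abs_integrable: "integrable (distr M borel (X 1)) (\<lambda>x. \<bar>x\<bar>)"
  using square_integrable_imp_integrable[OF X_measurable X_square] by (simp add: integrable_distr_eq)

lemma abs_expectation: "(\<integral>x. \<bar>x\<bar> \<partial>distr M borel (X 1)) = \<mu>"
  by (simp add: integral_distr \<mu>_def)

lemma f_meas [measurable]: "f \<in> borel_measurable borel"
  using distributed_real_measurable[OF _ f_density] f_nonneg by simp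

lemma distr_X1: "distr M lborel (X 1) = density lborel (\<lambda>x. ennreal (f x))"
  using f_density by (rule distributed_distr_eq_density)

sublocale F: density_transform f \<phi>
proof
  have "integrable M (\<lambda>\<omega>. 1 :: real)" by simp
  then have "integrable (distr M lborel (X 1)) (\<lambda>x. 1 :: real)"
    by (simp add: integrable_distr_eq)
  then show "integrable lborel f"
    unfolding distr_X1 using f_nonneg by (simp add: integrable_density)
  show "\<phi> u = (\<integral>x. complex_of_real (f x) * iexp (u * x) \<partial>lborel)" for u
  proof -
    have "\<phi> u = (\<integral>x. iexp (u * x) \<partial>distr M lborel (X 1))"
      unfolding \<phi>_def char_def by (simp add: integral_distr)
    also have "\<dots> = (\<integral>x. complex_of_real (f x) * iexp (u * x) \<partial>lborel)"
      unfolding distr_X1 using f_nonneg by (subst integral_density) (auto simp: scaleR_conv_of_real)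
    finally show ?thesis .
  qed
  show "isCont \<phi> u" "cmod (\<phi> u) \<le> 1" for u
    unfolding \<phi>_def by (rule X1.isCont_char X1.cmod_char_le_1)+
qed

lemma Re_\<phi>_bounded_below:
  assumes f2: "integrable lborel (\<lambda>x. (f x)\<^sup>2)"
  shows "\<exists>\<delta>>0. \<forall>u. \<delta> - 1 \<le> Re (\<phi> u)"
proof -
  have "(\<integral>\<^sup>+u. ennreal ((cmod (\<phi> u))\<^sup>2) * indicator {-m<..<m} u \<partial>lborel) \<le> ennreal (2 * pi * (\<integral>x. (f x)\<^sup>2 \<partial>lborel))" for m
  proof -
    interpret bounded_support "F.cut m \<phi>" m 1 by (rule F.cutoff_phi)
    have "(\<integral>\<^sup>+u. ennreal ((cmod (\<phi> u))\<^sup>2) * indicator {-m<..<m} u \<partial>lborel) = (\<integral>\<^sup>+u. ennreal ((cmod (F.cut m \<phi> u))\<^sup>2) \<partial>lborel)"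
      by (intro nn_integral_cong) (auto simp: indicator_def)
    also have "\<dots> = ennreal (\<integral>u. (cmod (F.cut m \<phi> u))\<^sup>2 \<partial>lborel)"
      by (rule nn_integral_eq_integral[OF integrable_H_sq]) simp
    also have "\<dots> \<le> ennreal (2 * pi * (\<integral>x. (f x)\<^sup>2 \<partial>lborel))"
      by (intro ennreal_leI F.integral_phi_sq_le f2)
    finally show ?thesis .
  qed
  then show ?thesis
    using X1.Re_char_bounded_below[OF abs_integrable] unfolding \<phi>_def by blast
qed

definition \<phi>\<^sub>\<Delta> :: "real \<Rightarrow> real \<Rightarrow> complex" where
  "\<phi>\<^sub>\<Delta> \<Delta> u = exp (complex_of_real \<Delta> * (\<phi> u - 1))"

lemma cmod_\<phi>\<^sub>\<Delta>: "cmod (\<phi>\<^sub>\<Delta> \<Delta> u) = exp (\<Delta> * (Re (\<phi> u) - 1))"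
  by (simp add: \<phi>\<^sub>\<Delta>_def)

lemma \<phi>\<^sub>\<Delta>_continuous: "continuous_on S (\<phi>\<^sub>\<Delta> \<Delta>)"
  unfolding \<phi>\<^sub>\<Delta>_def by (intro continuous_intros continuous_at_imp_continuous_on ballI F.\<phi>_cont)

lemma \<phi>\<^sub>\<Delta>_measurable [measurable]: "\<phi>\<^sub>\<Delta> \<Delta> \<in> borel_measurable borel"
  by (rule borel_measurable_continuous_onI[OF \<phi>\<^sub>\<Delta>_continuous])

lemma \<phi>\<^sub>\<Delta>_lipschitz: "0 \<le> \<Delta> \<Longrightarrow> cmod (\<phi>\<^sub>\<Delta> \<Delta> u - \<phi>\<^sub>\<Delta> \<Delta> v) \<le> \<Delta> * \<mu> * \<bar>u - v\<bar>"
proof -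
  assume \<Delta>: "0 \<le> \<Delta>"
  have "Re (complex_of_real \<Delta> * (\<phi> u - 1)) \<le> 0" for u
    using \<Delta> F.\<phi>_bound[of u] complex_Re_le_cmod[of "\<phi> u"] by (simp add: mult_nonneg_nonpos)
  then have "cmod (\<phi>\<^sub>\<Delta> \<Delta> u - \<phi>\<^sub>\<Delta> \<Delta> v) \<le> cmod (complex_of_real \<Delta> * (\<phi> u - 1) - complex_of_real \<Delta> * (\<phi> v - 1))"
    unfolding \<phi>\<^sub>\<Delta>_def by (intro exp_lipschitz_left_halfplane)
  also have "\<dots> = \<Delta> * cmod (\<phi> u - \<phi> v)"
    using \<Delta> by (simp add: norm_mult flip: right_diff_distrib)
  also have "\<dots> \<le> \<Delta> * (\<mu> * \<bar>u - v\<bar>)"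
    using X1.char_lipschitz[OF abs_integrable, of u v] \<Delta> unfolding \<phi>_def abs_expectation
    by (intro mult_left_mono)
  finally show ?thesis by (simp add: mult.assoc)
qed

text \<open>
  This factor \<open>\<Delta>\<close> turns the rate \<open>1 / (n \<Delta>\<^sup>2)\<close> of the crude variance bound into \<open>1 / (n \<Delta>)\<close>.
\<close>

lemma one_minus_cmod_\<phi>\<^sub>\<Delta>_sq: "0 \<le> \<Delta> \<Longrightarrow> 1 - (cmod (\<phi>\<^sub>\<Delta> \<Delta> u))\<^sup>2 \<le> 4 * \<Delta>"
proof -
  assume \<Delta>: "0 \<le> \<Delta>"
  have "1 + 2 * (\<Delta> * (Re (\<phi> u) - 1)) \<le> exp (2 * (\<Delta> * (Re (\<phi> u) - 1)))" by (rule exp_ge_add_one_self)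
  also have "\<dots> = (cmod (\<phi>\<^sub>\<Delta> \<Delta> u))\<^sup>2" by (simp add: cmod_\<phi>\<^sub>\<Delta> exp_double)
  finally have "1 - (cmod (\<phi>\<^sub>\<Delta> \<Delta> u))\<^sup>2 \<le> 2 * \<Delta> * (1 - Re (\<phi> u))" by (simp add: algebra_simps)
  also have "\<dots> \<le> 2 * \<Delta> * 2"
    using \<Delta> F.\<phi>_bound[of u] abs_Re_le_cmod[of "\<phi> u"] by (intro mult_left_mono) auto
  finally show ?thesis by simp
qed

lemma iid_increments:
  assumes "0 < \<Delta>" "0 < n" shows "iid_sample M (incr \<Delta>) n (distr M borel (incr \<Delta> 0))"
  using indep_incr[OF assms] distr_incr_eq[OF assms(1)] assms(2) by unfold_locales auto

lemma char_incr_\<phi>\<^sub>\<Delta>: "0 < \<Delta> \<Longrightarrow> char (distr M borel (incr \<Delta> i)) = \<phi>\<^sub>\<Delta> \<Delta>"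
  using char_incr[of \<Delta> i] by (simp add: fun_eq_iff \<phi>\<^sub>\<Delta>_def)

text \<open>
  The bound for one sample size, under conditions on a lower bound \<open>s\<close> of \<open>|\<phi>\<^sub>\<Delta>|\<close> and a grid width \<open>h\<close>. Half of
  the admissible deviation \<open>2/5 s\<close> is granted at the grid points, where by the last condition Hoeffding's inequality
  leaves a probability of at most \<open>h / T\<^sup>2\<close> per point, and half to the oscillation over one grid cell. There are at most
  \<open>m / h\<close> grid points, so the bad event has probability at most \<open>E X\<^sup>2 / T + m / T\<^sup>2\<close>. On it the squared error is at most
  \<open>25\<close>, and integrating over an interval of length \<open>2 m\<close> gives the two remainder terms.
\<close>

lemma risk_bound:
  assumes \<Delta>: "0 < \<Delta>" and n: "0 < n" and m: "0 \<le> m"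
    and s: "0 < s" "\<And>u. s \<le> cmod (\<phi>\<^sub>\<Delta> \<Delta> u)"
    and h: "0 < h" "\<Delta> * (2 * \<mu> + 1) * h \<le> s / 5"
    and p: "4 * exp (- real n * (s / 5)\<^sup>2 / 8) * (real n * \<Delta>)\<^sup>2 \<le> h"
  shows "(\<integral>\<^sup>+\<omega>. L2_norm_sq (\<lambda>x. f_hat \<Delta> (increment (compound_sum N X) \<Delta> \<omega>) n m x - complex_of_real (f x)) \<partial>M)
      \<le> L2_norm_sq (\<lambda>x. fourier_cutoff \<phi> m x - complex_of_real (f x))
        + ennreal (2 / (real n * \<Delta>) * (LBINT u=-m..m. 1 / (cmod (\<phi>\<^sub>\<Delta> \<Delta> u))\<^sup>2)
                   + 2 * 5\<^sup>2 * (\<integral>\<omega>. (X 1 \<omega>)\<^sup>2 \<partial>M) * (m / (real n * \<Delta>))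
                   + 2 ^ 3 * 5\<^sup>2 * (m\<^sup>2 / (real n * \<Delta>)\<^sup>2))"
proof -
  define \<nu> where "\<nu> = distr M borel (incr \<Delta> 0)"
  interpret S: iid_sample M "incr \<Delta>" n \<nu>
    unfolding \<nu>_def by (rule iid_increments[OF \<Delta> n])
  have char_\<nu>: "char \<nu> = \<phi>\<^sub>\<Delta> \<Delta>" unfolding \<nu>_def by (rule char_incr_\<phi>\<^sub>\<Delta>[OF \<Delta>])
  define T where "T = real n * \<Delta>"
  have T: "0 < T" using n \<Delta> by (simp add: T_def)
  define E2 where "E2 = expectation (\<lambda>\<omega>. (X 1 \<omega>)\<^sup>2)"
  have E2: "0 \<le> E2" by (simp add: E2_def)
  define K where "K = nat \<lfloor>m / h\<rfloor>"
  have K: "real K \<le> m / h" using m h by (simp add: K_def)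
  define W where "W = {\<omega> \<in> space M. T * (\<mu> + 1) < jumps abs 0 T \<omega>}"
  define A where "A k = {\<omega> \<in> space M. s / 5 \<le> cmod (S.emp (real k * h) \<omega> - \<phi>\<^sub>\<Delta> \<Delta> (real k * h))}" for k :: nat
  define Bad where "Bad = W \<union> (\<Union>k\<in>{1..K}. A k)"
  have W_sets [measurable]: "W \<in> events"
  proof -
    have [measurable]: "random_variable borel (jumps abs 0 T)"
      using T by (intro jumps_measurable) auto
    show ?thesis unfolding W_def by measurable
  qed
  have A_sets [measurable]: "A k \<in> events" for k unfolding A_def by measurable
  have Bad_sets [measurable]: "Bad \<in> events" unfolding Bad_def by measurable
  have W_prob: "emeasure M W \<le> ennreal (E2 / T)"
    using prob_total_variation_le[OF X_square T] by (simp add: W_def E2_def \<mu>_def)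
  have A_prob: "emeasure M (A k) \<le> ennreal (h / T\<^sup>2)" for k
  proof -
    have "prob (A k) \<le> 4 * exp (- real n * (s / 5)\<^sup>2 / 8)"
      using S.emp_deviation_le[of "s / 5" "real k * h"] s by (simp add: A_def char_\<nu>)
    also have "\<dots> \<le> h / T\<^sup>2" using p T unfolding T_def[symmetric] by (subst pos_le_divide_eq) auto
    finally show ?thesis by (simp add: emeasure_eq_measure ennreal_leI)
  qed
  have Bad_prob: "emeasure M Bad \<le> ennreal (E2 / T + m / T\<^sup>2)"
  proof -
    have "emeasure M Bad \<le> emeasure M W + emeasure M (\<Union>k\<in>{1..K}. A k)"
      unfolding Bad_def by (intro emeasure_subadditive) measurable
    also have "emeasure M (\<Union>k\<in>{1..K}. A k) \<le> (\<Sum>k\<in>{1..K}. emeasure M (A k))"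
      by (intro emeasure_subadditive_finite) auto
    also have "\<dots> \<le> (\<Sum>k\<in>{1..K}. ennreal (h / T\<^sup>2))" by (intro sum_mono A_prob)
    also have "\<dots> = ennreal (real K * (h / T\<^sup>2))"
      using h T by (subst sum_ennreal) auto
    also have "\<dots> \<le> ennreal (m / h * (h / T\<^sup>2))"
      using h K by (intro ennreal_leI mult_right_mono) auto
    also have "m / h * (h / T\<^sup>2) = m / T\<^sup>2" using h by simp
    finally have "emeasure M Bad \<le> emeasure M W + ennreal (m / T\<^sup>2)"
      by (simp add: add_left_mono)
    also have "\<dots> \<le> ennreal (E2 / T) + ennreal (m / T\<^sup>2)"
      by (intro add_right_mono W_prob)
    finally show ?thesis using E2 T m by simp
  qed
  have good: "cmod (S.emp v \<omega> - \<phi>\<^sub>\<Delta> \<Delta> v) \<le> 2 / 5 * cmod (\<phi>\<^sub>\<Delta> \<Delta> v)"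
    if \<omega>: "\<omega> \<in> space M" "\<omega> \<notin> Bad" "(\<Sum>i<n. \<bar>incr \<Delta> i \<omega>\<bar>) \<le> jumps abs 0 T \<omega>" and v: "\<bar>v\<bar> \<le> m" for v \<omega>
  proof -
    have "1 / n * (\<Sum>i<n. \<bar>incr \<Delta> i \<omega>\<bar>) \<le> 1 / n * (T * (\<mu> + 1))"
      using \<omega> by (intro mult_left_mono) (auto simp: Bad_def W_def)
    also have "\<dots> = \<Delta> * (\<mu> + 1)" using n by (simp add: T_def)
    finally have slope: "1 / n * (\<Sum>i<n. \<bar>incr \<Delta> i \<omega>\<bar>) \<le> \<Delta> * (\<mu> + 1)" .
    (* Grid points are needed on the positive half-line only: negative arguments are reached by conjugation. *)
    have pos: "cmod (S.emp w \<omega> - \<phi>\<^sub>\<Delta> \<Delta> w) \<le> 2 / 5 * s" if w: "0 \<le> w" "w \<le> m" for w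
    proof -
      define k where "k = nat \<lfloor>w / h\<rfloor>"
      have k: "real k * h \<le> w" "w \<le> real k * h + h"
      proof -
        have "real k \<le> w / h" "w / h \<le> real k + 1"
          using w h by (simp_all add: k_def)
        then show "real k * h \<le> w" "w \<le> real k * h + h"
          using h by (simp_all add: field_simps)
      qed
      have "k \<le> K" using w h unfolding k_def K_def by (intro nat_mono floor_mono divide_right_mono) auto
      have grid: "cmod (S.emp (real k * h) \<omega> - \<phi>\<^sub>\<Delta> \<Delta> (real k * h)) \<le> s / 5"
      (* The deviation vanishes at the origin, so the bad event need not include a grid point there. *)
      proof (cases "k = 0")
        case True
        have "S.emp 0 \<omega> = 1" using n by (simp add: S.emp_def)
        moreover have "\<phi>\<^sub>\<Delta> \<Delta> 0 = 1" by (simp add: \<phi>\<^sub>\<Delta>_def \<phi>_def X1.char_zero)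
        ultimately show ?thesis using True s by simp
      next
        case False
        then have "\<omega> \<notin> A k" using \<omega> \<open>k \<le> K\<close> by (auto simp: Bad_def)
        then show ?thesis using \<omega> by (simp add: A_def)
      qed
      have dist: "\<bar>w - real k * h\<bar> \<le> h" using k by simp
      have 1: "cmod (S.emp w \<omega> - S.emp (real k * h) \<omega>) \<le> \<Delta> * (\<mu> + 1) * h"
      proof -
        have "cmod (S.emp w \<omega> - S.emp (real k * h) \<omega>) \<le> 1 / n * (\<Sum>i<n. \<bar>incr \<Delta> i \<omega>\<bar>) * \<bar>w - real k * h\<bar>"
          by (rule S.emp_lipschitz)
        also have "\<dots> \<le> \<Delta> * (\<mu> + 1) * h"
          using \<Delta> \<mu>_nonneg by (intro mult_mono slope dist) auto
        finally show ?thesis .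
      qed
      have 2: "cmod (\<phi>\<^sub>\<Delta> \<Delta> (real k * h) - \<phi>\<^sub>\<Delta> \<Delta> w) \<le> \<Delta> * \<mu> * h"
      proof -
        have "cmod (\<phi>\<^sub>\<Delta> \<Delta> (real k * h) - \<phi>\<^sub>\<Delta> \<Delta> w) \<le> \<Delta> * \<mu> * \<bar>real k * h - w\<bar>"
          using \<Delta> by (intro \<phi>\<^sub>\<Delta>_lipschitz) simp
        also have "\<dots> \<le> \<Delta> * \<mu> * h"
          using \<Delta> \<mu>_nonneg dist by (intro mult_left_mono) auto
        finally show ?thesis .
      qed
      have "S.emp w \<omega> - \<phi>\<^sub>\<Delta> \<Delta> w = (S.emp w \<omega> - S.emp (real k * h) \<omega>)
          + (S.emp (real k * h) \<omega> - \<phi>\<^sub>\<Delta> \<Delta> (real k * h)) + (\<phi>\<^sub>\<Delta> \<Delta> (real k * h) - \<phi>\<^sub>\<Delta> \<Delta> w)" by simp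
      then have "cmod (S.emp w \<omega> - \<phi>\<^sub>\<Delta> \<Delta> w) \<le> \<Delta> * (\<mu> + 1) * h + s / 5 + \<Delta> * \<mu> * h"
        using 1 2 grid by (smt (verit) norm_triangle_ineq)
      also have "\<dots> = \<Delta> * (2 * \<mu> + 1) * h + s / 5" by (simp add: algebra_simps)
      also have "\<dots> \<le> 2 / 5 * s" using h by simp
      finally show ?thesis .
    qed
    have "cmod (S.emp v \<omega> - \<phi>\<^sub>\<Delta> \<Delta> v) \<le> 2 / 5 * s"
    proof (cases "0 \<le> v")
      case True
      then show ?thesis using pos[of v] v by simp
    next
      case False
      have "S.emp v \<omega> - \<phi>\<^sub>\<Delta> \<Delta> v = cnj (S.emp (- v) \<omega> - \<phi>\<^sub>\<Delta> \<Delta> (- v))"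
        unfolding char_\<nu>[symmetric] by (simp add: S.emp_minus S.\<nu>.char_minus)
      then show ?thesis using pos[of "- v"] v False by (simp only: complex_mod_cnj)
    qed
    also have "\<dots> \<le> 2 / 5 * cmod (\<phi>\<^sub>\<Delta> \<Delta> v)" using s by simp
    finally show ?thesis .
  qed
  define Q where "Q u \<omega> = 25 / (9 * \<Delta>\<^sup>2) * ((cmod (S.emp u \<omega> - \<phi>\<^sub>\<Delta> \<Delta> u))\<^sup>2 / (cmod (\<phi>\<^sub>\<Delta> \<Delta> u))\<^sup>2)" for u \<omega>
  have Q_nonneg: "0 \<le> Q u \<omega>" for u \<omega> by (simp add: Q_def)
  let ?J = "{-m<..<m}"
  let ?B = "L2_norm_sq (\<lambda>x. fourier_cutoff \<phi> m x - complex_of_real (f x))"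
  let ?Y = "increment (compound_sum N X) \<Delta>"
  have pointwise: "AE \<omega> in M. L2_norm_sq (\<lambda>x. f_hat \<Delta> (?Y \<omega>) n m x - complex_of_real (f x)) \<le>
     ?B + ennreal (1 / (2 * pi)) * ((\<integral>\<^sup>+u. ennreal (Q u \<omega>) * indicator ?J u \<partial>lborel) + ennreal (50 * m) * indicator Bad \<omega>)"
    using increment_AE_eq[OF \<Delta>] sum_abs_incr_le[OF \<Delta>] AE_space
  proof eventually_elim
    case (elim \<omega>)
    have emp: "emp_char (?Y \<omega>) n u = S.emp u \<omega>" for u
      unfolding emp_char_def S.emp_def One_nat_def sum.atLeast1_atMost_eq using elim(1) by simp
    have le: "(cmod (phi_tilde \<Delta> (?Y \<omega>) n u - \<phi> u))\<^sup>2 \<le> Q u \<omega> + 25 * indicator Bad \<omega>" if u: "u \<in> ?J" for u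
    proof (cases "\<omega> \<in> Bad")
      case True
      have "(cmod (phi_tilde \<Delta> (?Y \<omega>) n u - \<phi> u))\<^sup>2 \<le> 25"
        by (rule phi_tilde_error_crude[OF F.\<phi>_bound])
      also have "\<dots> \<le> Q u \<omega> + 25" using Q_nonneg by simp
      finally show ?thesis using True by simp
    next
      case False
      have "(cmod (phi_tilde \<Delta> (?Y \<omega>) n u - \<phi> u))\<^sup>2 \<le> Q u \<omega>"
        unfolding Q_def emp[symmetric] \<phi>\<^sub>\<Delta>_def
      proof (rule phi_tilde_error_good[OF n \<Delta> F.\<phi>_cont _ F.\<phi>_bound])
        show "\<phi> 0 = 1" by (simp add: \<phi>_def X1.char_zero)
        fix v assume "v \<in> closed_segment 0 u"
        then have "\<bar>v\<bar> \<le> m" using u by (auto simp: closed_segment_eq_real_ivl split: if_splits)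
        then show "cmod (emp_char (?Y \<omega>) n v - exp (complex_of_real \<Delta> * (\<phi> v - 1)))
            \<le> 2 / 5 * cmod (exp (complex_of_real \<Delta> * (\<phi> v - 1)))"
          using good[of \<omega> v] False elim(2,3) unfolding emp \<phi>\<^sub>\<Delta>_def[symmetric] T_def by blast
      qed
      then show ?thesis using False by simp
    qed
    have Q_m [measurable]: "(\<lambda>u. Q u \<omega>) \<in> borel_measurable borel"
      unfolding Q_def S.emp_def by measurable
    have "L2_norm_sq (\<lambda>x. f_hat \<Delta> (?Y \<omega>) n m x - complex_of_real (f x)) \<le>
        ?B + ennreal (1 / (2 * pi)) * (\<integral>\<^sup>+u. ennreal ((cmod (phi_tilde \<Delta> (?Y \<omega>) n u - \<phi> u))\<^sup>2) * indicator ?J u \<partial>lborel)"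
      unfolding f_hat_def by (rule F.L2_risk_le[OF m phi_tilde_measurable cmod_phi_tilde_le])
    also have "(\<integral>\<^sup>+u. ennreal ((cmod (phi_tilde \<Delta> (?Y \<omega>) n u - \<phi> u))\<^sup>2) * indicator ?J u \<partial>lborel)
       \<le> (\<integral>\<^sup>+u. ennreal (Q u \<omega>) * indicator ?J u + ennreal (25 * indicator Bad \<omega>) * indicator ?J u \<partial>lborel)"
    proof (rule nn_integral_mono)
      fix u
      show "ennreal ((cmod (phi_tilde \<Delta> (?Y \<omega>) n u - \<phi> u))\<^sup>2) * indicator ?J u
          \<le> ennreal (Q u \<omega>) * indicator ?J u + ennreal (25 * indicator Bad \<omega>) * indicator ?J u"
        using ennreal_leI[OF le[of u]] Q_nonneg by (cases "u \<in> ?J") (auto simp: ennreal_plus)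
    qed
    also have "\<dots> = (\<integral>\<^sup>+u. ennreal (Q u \<omega>) * indicator ?J u \<partial>lborel) + ennreal (25 * indicator Bad \<omega>) * ennreal (2 * m)"
      using m by (subst nn_integral_add) (auto simp: nn_integral_cmult_indicator)
    also have "ennreal (25 * indicator Bad \<omega>) * ennreal (2 * m) = ennreal (50 * m) * indicator Bad \<omega>"
      by (subst ennreal_mult'[symmetric]) (auto simp: indicator_def)
    finally show ?case by (simp add: mult_left_mono add_left_mono)
  qed
  have Q_joint: "(\<lambda>(u, \<omega>). ennreal (Q u \<omega>) * indicator ?J u) \<in> borel_measurable (lborel \<Otimes>\<^sub>M M)"
    unfolding Q_def S.emp_def by measurable
  interpret LM: pair_sigma_finite lborel M ..
  have Q_mean: "(\<integral>\<^sup>+\<omega>. (\<integral>\<^sup>+u. ennreal (Q u \<omega>) * indicator ?J u \<partial>lborel) \<partial>M)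
      \<le> ennreal (100 / (9 * T) * (LBINT u=-m..m. 1 / (cmod (\<phi>\<^sub>\<Delta> \<Delta> u))\<^sup>2))"
  proof -
    let ?q = "\<lambda>u. 1 / (cmod (\<phi>\<^sub>\<Delta> \<Delta> u))\<^sup>2"
    have Eu: "(\<integral>\<^sup>+\<omega>. ennreal (Q u \<omega>) \<partial>M) \<le> ennreal (100 / (9 * T) * ?q u)" for u
    proof -
      have "(\<integral>\<^sup>+\<omega>. ennreal (Q u \<omega>) \<partial>M) = (\<integral>\<^sup>+\<omega>. ennreal (25 / (9 * \<Delta>\<^sup>2) * ?q u) * ennreal ((cmod (S.emp u \<omega> - char \<nu> u))\<^sup>2) \<partial>M)"
        unfolding Q_def char_\<nu> by (intro nn_integral_cong) (simp flip: ennreal_mult')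
      also have "\<dots> = ennreal (25 / (9 * \<Delta>\<^sup>2) * ?q u) * ennreal ((1 - (cmod (\<phi>\<^sub>\<Delta> \<Delta> u))\<^sup>2) / n)"
        unfolding char_\<nu>[symmetric] S.emp_mean_square[symmetric] by (rule nn_integral_cmult) measurable
      also have "\<dots> = ennreal (25 / (9 * \<Delta>\<^sup>2) * ?q u * ((1 - (cmod (\<phi>\<^sub>\<Delta> \<Delta> u))\<^sup>2) / n))"
        by (rule ennreal_mult'[symmetric]) simp
      also have "\<dots> \<le> ennreal (25 / (9 * \<Delta>\<^sup>2) * ?q u * (4 * \<Delta> / n))"
        using \<Delta> by (intro ennreal_leI mult_left_mono divide_right_mono one_minus_cmod_\<phi>\<^sub>\<Delta>_sq) auto
      also have "25 / (9 * \<Delta>\<^sup>2) * ?q u * (4 * \<Delta> / n) = 100 / (9 * T) * ?q u"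
        using \<Delta> n by (simp add: T_def power2_eq_square)
      finally show ?thesis .
    qed
    have q_int: "integrable lborel (\<lambda>u. indicator ?J u * ?q u)"
    proof (rule Bochner_Integration.integrable_bound[OF integrable_mult_right[OF integrable_indicator_Icc, of "1 / s\<^sup>2" "-m" m]])
      show "AE u in lborel. norm (indicator ?J u * ?q u) \<le> norm (1 / s\<^sup>2 * indicator {-m..m} u)"
      proof (rule AE_I2)
        fix u
        have "?q u \<le> 1 / s\<^sup>2"
          using s less_le_trans[OF s(1) s(2)[of u]] by (intro divide_left_mono power_mono) auto
        then show "norm (indicator ?J u * ?q u) \<le> norm (1 / s\<^sup>2 * indicator {-m..m} u)"
          by (auto simp: indicator_def)
      qed
    qed measurable
    have "(\<integral>\<^sup>+\<omega>. (\<integral>\<^sup>+u. ennreal (Q u \<omega>) * indicator ?J u \<partial>lborel) \<partial>M) = (\<integral>\<^sup>+u. (\<integral>\<^sup>+\<omega>. ennreal (Q u \<omega>) * indicator ?J u \<partial>M) \<partial>lborel)"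
      by (rule LM.Fubini'[OF Q_joint])
    also have "\<dots> = (\<integral>\<^sup>+u. (\<integral>\<^sup>+\<omega>. ennreal (Q u \<omega>) \<partial>M) * indicator ?J u \<partial>lborel)"
      by (intro nn_integral_cong) (simp add: nn_integral_multc Q_def)
    also have "\<dots> \<le> (\<integral>\<^sup>+u. ennreal (100 / (9 * T) * ?q u) * indicator ?J u \<partial>lborel)"
      by (intro nn_integral_mono mult_right_mono Eu) simp
    also have "\<dots> = (\<integral>\<^sup>+u. ennreal (100 / (9 * T) * (indicator ?J u * ?q u)) \<partial>lborel)"
      by (intro nn_integral_cong) (auto simp: indicator_def)
    also have "\<dots> = ennreal (\<integral>u. 100 / (9 * T) * (indicator ?J u * ?q u) \<partial>lborel)"
      using T by (intro nn_integral_eq_integral integrable_mult_right q_int) auto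
    also have "(\<integral>u. 100 / (9 * T) * (indicator ?J u * ?q u) \<partial>lborel) = 100 / (9 * T) * (LBINT u=-m..m. ?q u)"
      unfolding integral_mult_right_zero using m
      by (simp add: interval_lebesgue_integral_def set_lebesgue_integral_def)
    finally show ?thesis .
  qed
  let ?I = "LBINT u=-m..m. 1 / (cmod (\<phi>\<^sub>\<Delta> \<Delta> u))\<^sup>2"
  have I: "0 \<le> ?I"
    using m by (simp add: interval_lebesgue_integral_def set_lebesgue_integral_def)
  have inner_meas [measurable]: "(\<lambda>\<omega>. \<integral>\<^sup>+u. ennreal (Q u \<omega>) * indicator ?J u \<partial>lborel) \<in> borel_measurable M"
  proof (rule lborel.borel_measurable_nn_integral)
    show "(\<lambda>(\<omega>, u). ennreal (Q u \<omega>) * indicator ?J u) \<in> borel_measurable (M \<Otimes>\<^sub>M lborel)"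
      unfolding Q_def S.emp_def by measurable
  qed
  have "(\<integral>\<^sup>+\<omega>. L2_norm_sq (\<lambda>x. f_hat \<Delta> (?Y \<omega>) n m x - complex_of_real (f x)) \<partial>M) \<le>
     (\<integral>\<^sup>+\<omega>. ?B + ennreal (1 / (2 * pi)) * ((\<integral>\<^sup>+u. ennreal (Q u \<omega>) * indicator ?J u \<partial>lborel) + ennreal (50 * m) * indicator Bad \<omega>) \<partial>M)"
    by (rule nn_integral_mono_AE[OF pointwise])
  also have "\<dots> = ?B + ennreal (1 / (2 * pi)) * ((\<integral>\<^sup>+\<omega>. (\<integral>\<^sup>+u. ennreal (Q u \<omega>) * indicator ?J u \<partial>lborel) \<partial>M) + ennreal (50 * m) * emeasure M Bad)"
    by (simp add: nn_integral_add nn_integral_cmult nn_integral_cmult_indicator emeasure_space_1)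
  also have "\<dots> \<le> ?B + ennreal (1 / (2 * pi)) * (ennreal (100 / (9 * T) * ?I) + ennreal (50 * m) * ennreal (E2 / T + m / T\<^sup>2))"
    by (intro add_left_mono mult_left_mono add_mono Q_mean Bad_prob) auto
  also have "ennreal (1 / (2 * pi)) * (ennreal (100 / (9 * T) * ?I) + ennreal (50 * m) * ennreal (E2 / T + m / T\<^sup>2))
     = ennreal (1 / (2 * pi) * (100 / (9 * T) * ?I + 50 * m * (E2 / T + m / T\<^sup>2)))"
  proof -
    have "ennreal a * (ennreal b + ennreal c * ennreal d) = ennreal (a * (b + c * d))"
      if "0 \<le> a" "0 \<le> b" "0 \<le> c" "0 \<le> d" for a b c d
      using that by (simp only: ennreal_mult ennreal_plus mult_nonneg_nonneg add_nonneg_nonneg)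
    then show ?thesis
      by this (use I m E2 T in \<open>auto intro!: mult_nonneg_nonneg divide_nonneg_nonneg\<close>)
  qed
  also have "\<dots> \<le> ennreal (2 / T * ?I + 2 * 5\<^sup>2 * E2 * (m / T) + 2 ^ 3 * 5\<^sup>2 * (m\<^sup>2 / T\<^sup>2))"
  proof (rule ennreal_leI)
    (* Replacing pi by 3 is affordable: 100/54 < 2. *)
    have pi: "1 / (2 * pi) \<le> 1 / 6" using pi_gt3 by (intro divide_left_mono) auto
    have "1 / (2 * pi) * (100 / (9 * T) * ?I + 50 * m * (E2 / T + m / T\<^sup>2))
       \<le> 1 / 6 * (100 / (9 * T) * ?I + 50 * m * (E2 / T + m / T\<^sup>2))"
      using I m E2 T by (intro mult_right_mono pi) auto
    also have "\<dots> = 100 / 54 * (?I / T) + 50 / 6 * (E2 * (m / T)) + 50 / 6 * (m\<^sup>2 / T\<^sup>2)"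
      using T by (simp add: field_simps power2_eq_square)
    also have "\<dots> \<le> 2 * (?I / T) + 50 * (E2 * (m / T)) + 200 * (m\<^sup>2 / T\<^sup>2)"
      using I m E2 T by (intro add_mono mult_right_mono) auto
    also have "\<dots> = 2 / T * ?I + 2 * 5\<^sup>2 * E2 * (m / T) + 2 ^ 3 * 5\<^sup>2 * (m\<^sup>2 / T\<^sup>2)" by simp
    finally show "1 / (2 * pi) * (100 / (9 * T) * ?I + 50 * m * (E2 / T + m / T\<^sup>2)) \<le> \<dots>" .
  qed
  finally show ?thesis
    unfolding T_def E2_def by (simp add: add_left_mono)
qed

end

lemma hoeffding_rate_asymp:
  fixes c :: real assumes "0 < c"
  shows "((\<lambda>T::real. C * ln T * T powr (5 / 2) * exp (- (T powr c) / (50 * ln T))) \<longlongrightarrow> 0) at_top"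
  using assms by real_asymp

text \<open>
  With \<open>s = exp (- (2 - \<delta>) \<Delta>)\<close> the hypothesis \<open>\<Delta> \<le> ln T / 4\<close> gives
  \<open>n s\<^sup>2 = (T / \<Delta>) exp (- (4 - 2 \<delta>) \<Delta>) \<ge> 4 T powr (\<delta> / 2) / ln T\<close>: the exponent in Hoeffding's inequality grows like
  a positive power of \<open>T\<close>, whereas \<open>1 / s\<close>, \<open>\<Delta>\<close> and \<open>T\<^sup>2\<close> cost only a fixed power and a logarithm.
\<close>

lemma (in decompounding) deviation_level:
  assumes \<Delta>: "0 < \<Delta>" and n: "0 < n" and \<delta>: "0 < \<delta>" "\<delta> \<le> 1"
    and T: "1 < real n * \<Delta>" and \<Delta>_le: "\<Delta> \<le> 1 / 4 * ln (real n * \<Delta>)"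
    and small: "5 * (2 * \<mu> + 1) * ln (real n * \<Delta>) * (real n * \<Delta>) powr (5 / 2)
      * exp (- ((real n * \<Delta>) powr (\<delta> / 2)) / (50 * ln (real n * \<Delta>))) \<le> 1"
  defines "s \<equiv> exp (- ((2 - \<delta>) * \<Delta>))"
  shows "4 * exp (- real n * (s / 5)\<^sup>2 / 8) * (real n * \<Delta>)\<^sup>2 \<le> s / (5 * \<Delta> * (2 * \<mu> + 1))"
proof -
  define T where "T = real n * \<Delta>"
  note T = T[folded T_def] and \<Delta>_le = \<Delta>_le[folded T_def] and small = small[folded T_def]
  have lnT: "0 < ln T" using T by simp
  have "4 * T powr (\<delta> / 2) / ln T \<le> real n * s\<^sup>2"
  proof -
    have "(4 - 2 * \<delta>) * \<Delta> \<le> (4 - 2 * \<delta>) * (1 / 4 * ln T)"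
      using \<delta> \<Delta>_le by (intro mult_left_mono) auto
    then have "T powr (\<delta> / 2 - 1) \<le> exp (- ((4 - 2 * \<delta>) * \<Delta>))"
      using T by (simp add: powr_def algebra_simps)
    also have "\<dots> = s\<^sup>2"
      unfolding s_def by (simp add: algebra_simps flip: exp_double)
    finally have s2: "T powr (\<delta> / 2 - 1) \<le> s\<^sup>2" .
    have "4 / ln T \<le> 1 / \<Delta>" using \<Delta> \<Delta>_le lnT by (simp add: field_simps)
    then have "4 / ln T * T \<le> 1 / \<Delta> * T" using T by (intro mult_right_mono) auto
    also have "\<dots> = real n" using \<Delta> by (simp add: T_def)
    finally have "(4 / ln T * T) * T powr (\<delta> / 2 - 1) \<le> real n * s\<^sup>2"
      using T s2 by (intro mult_mono) auto
    moreover have "T * T powr (\<delta> / 2 - 1) = T powr (\<delta> / 2)"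
      using T by (simp add: powr_diff)
    ultimately show ?thesis by (simp add: mult.assoc)
  qed
  then have expo: "exp (- real n * (s / 5)\<^sup>2 / 8) \<le> exp (- (T powr (\<delta> / 2)) / (50 * ln T))"
    using lnT by (simp add: power_divide field_simps)
  have s_inv: "1 / s \<le> T powr (1 / 2)"
  proof -
    have "(2 - \<delta>) * \<Delta> \<le> 2 * (1 / 4 * ln T)"
      using \<delta> \<Delta> \<Delta>_le by (intro mult_mono) auto
    then have "exp ((2 - \<delta>) * \<Delta>) \<le> T powr (1 / 2)" using T by (simp add: powr_def)
    moreover have "1 / s = exp ((2 - \<delta>) * \<Delta>)" unfolding s_def exp_minus by (simp add: divide_inverse)
    ultimately show ?thesis by simp
  qed
  have "4 * exp (- real n * (s / 5)\<^sup>2 / 8) * T\<^sup>2 * ((5 * \<Delta> * (2 * \<mu> + 1)) * (1 / s))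
     \<le> 4 * exp (- (T powr (\<delta> / 2)) / (50 * ln T)) * T\<^sup>2 * ((5 * (1 / 4 * ln T) * (2 * \<mu> + 1)) * T powr (1 / 2))"
    using \<mu>_nonneg \<Delta> lnT by (intro mult_mono expo s_inv \<Delta>_le) (auto simp: s_def)
  also have "\<dots> = 5 * (2 * \<mu> + 1) * ln T * (T\<^sup>2 * T powr (1 / 2)) * exp (- (T powr (\<delta> / 2)) / (50 * ln T))"
    by simp
  also have "T\<^sup>2 * T powr (1 / 2) = T powr (5 / 2)"
    using T by (simp flip: powr_numeral powr_add)
  also note small
  finally have "4 * exp (- real n * (s / 5)\<^sup>2 / 8) * T\<^sup>2 * ((5 * \<Delta> * (2 * \<mu> + 1)) * (1 / s)) \<le> 1" .
  moreover have "0 < s" "0 < 5 * \<Delta> * (2 * \<mu> + 1)"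
    using \<mu>_nonneg \<Delta> by (auto simp: s_def)
  ultimately show ?thesis unfolding T_def by (simp add: field_simps)
qed

theorem theorem3p1:
  fixes M :: "'a measure" and N :: "real \<Rightarrow> 'a \<Rightarrow> nat" and X :: "nat \<Rightarrow> 'a \<Rightarrow> real"
    and f :: "real \<Rightarrow> real" and \<Delta> :: "nat \<Rightarrow> real"
  defines "Z \<equiv> compound_sum N X"
    and "\<phi> \<equiv> char (distr M borel (X 1))"
  defines "\<phi>\<^sub>\<Delta> \<equiv> (\<lambda>n. char (distr M borel (Z (\<Delta> n))))"
  assumes "compound_poisson M 1 N X"
    and "\<And>x. 0 \<le> f x"
    and "distributed M lborel (X 1) (\<lambda>x. ennreal (f x))"
    and "integrable M (\<lambda>\<omega>. (X 1 \<omega>)\<^sup>2)"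
    and "\<And>n. 0 < \<Delta> n"
    and "\<forall>\<^sub>F n in sequentially. \<Delta> n \<le> 1 / 4 * ln (real n * \<Delta> n)"
    and "filterlim (\<lambda>n. real n * \<Delta> n) at_top sequentially"
  shows "\<forall>\<^sub>F n in sequentially. \<forall>m\<ge>0.
    (\<integral>\<^sup>+\<omega>. L2_norm_sq (\<lambda>x. f_hat (\<Delta> n) (increment Z (\<Delta> n) \<omega>) n m x - complex_of_real (f x)) \<partial>M)
      \<le> L2_norm_sq (\<lambda>x. fourier_cutoff \<phi> m x - complex_of_real (f x))
        + ennreal (2 / (real n * \<Delta> n) * (LBINT u=-m..m. 1 / (cmod (\<phi>\<^sub>\<Delta> n u))\<^sup>2)
                   + 2 * 5\<^sup>2 * (\<integral>\<omega>. (X 1 \<omega>)\<^sup>2 \<partial>M) * (m / (real n * \<Delta> n))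
                   + 2 ^ 3 * 5\<^sup>2 * (m\<^sup>2 / (real n * \<Delta> n)\<^sup>2))"
proof -
  interpret C: decompounding M N X f
    using assms(4-7) by (simp add: decompounding_def decompounding_axioms_def)
  have \<phi>_eq: "\<phi> = C.\<phi>" by (simp add: \<phi>_def C.\<phi>_def)
  have \<phi>\<^sub>\<Delta>_eq: "\<phi>\<^sub>\<Delta> n = C.\<phi>\<^sub>\<Delta> (\<Delta> n)" for n
    unfolding \<phi>\<^sub>\<Delta>_def Z_def using C.char_compound_sum[OF assms(8), of n]
    by (simp add: fun_eq_iff C.\<phi>\<^sub>\<Delta>_def)
  show ?thesis
  proof (cases "integrable lborel (\<lambda>x. (f x)\<^sup>2)")
    case False
    then show ?thesis by (simp add: \<phi>_eq C.F.L2_not_finite)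
  next
    case True
    from C.Re_\<phi>_bounded_below[OF True] obtain \<delta>' where "0 < \<delta>'" and \<delta>': "\<And>u. \<delta>' - 1 \<le> Re (C.\<phi> u)"
      by blast
    define \<delta> where "\<delta> = min \<delta>' 1"
    have \<delta>: "0 < \<delta>" "\<delta> \<le> 1" and Re_\<phi>: "\<delta> - 1 \<le> Re (C.\<phi> u)" for u
      using \<open>0 < \<delta>'\<close> \<delta>'[of u] by (auto simp: \<delta>_def)
    have "\<forall>\<^sub>F T in at_top. 5 * (2 * C.\<mu> + 1) * ln T * T powr (5 / 2) * exp (- (T powr (\<delta> / 2)) / (50 * ln T)) < 1"
      using hoeffding_rate_asymp[of "\<delta> / 2" "5 * (2 * C.\<mu> + 1)"] \<delta> by (intro order_tendstoD(2)) auto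
    from filterlim_iff[THEN iffD1, rule_format, OF assms(10) this]
      filterlim_iff[THEN iffD1, rule_format, OF assms(10) eventually_gt_at_top[of 1]] assms(9)
    show ?thesis
    proof eventually_elim
      case (elim n)
      have n: "0 < n" using elim(2) by (cases n) auto
      let ?s = "exp (- ((2 - \<delta>) * \<Delta> n))"
      show ?case
        unfolding Z_def \<phi>_eq \<phi>\<^sub>\<Delta>_eq
      proof (intro allI impI)
        fix m :: real assume m: "0 \<le> m"
        show "(\<integral>\<^sup>+\<omega>. L2_norm_sq (\<lambda>x. f_hat (\<Delta> n) (increment (compound_sum N X) (\<Delta> n) \<omega>) n m x - complex_of_real (f x)) \<partial>M)
          \<le> L2_norm_sq (\<lambda>x. fourier_cutoff C.\<phi> m x - complex_of_real (f x))
        + ennreal (2 / (real n * \<Delta> n) * (LBINT u=-m..m. 1 / (cmod (C.\<phi>\<^sub>\<Delta> (\<Delta> n) u))\<^sup>2)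
                   + 2 * 5\<^sup>2 * (\<integral>\<omega>. (X 1 \<omega>)\<^sup>2 \<partial>M) * (m / (real n * \<Delta> n))
                   + 2 ^ 3 * 5\<^sup>2 * (m\<^sup>2 / (real n * \<Delta> n)\<^sup>2))"
        proof (rule C.risk_bound[OF assms(8) n m, where s = ?s and h = "?s / (5 * \<Delta> n * (2 * C.\<mu> + 1))"])
          show "?s \<le> cmod (C.\<phi>\<^sub>\<Delta> (\<Delta> n) u)" for u
          proof -
            have "\<Delta> n * (\<delta> - 2) \<le> \<Delta> n * (Re (C.\<phi> u) - 1)"
              using Re_\<phi>[of u] assms(8)[of n] by (intro mult_left_mono) auto
            then show ?thesis by (simp add: C.cmod_\<phi>\<^sub>\<Delta> algebra_simps)
          qed
          show "0 < ?s / (5 * \<Delta> n * (2 * C.\<mu> + 1))"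
            using assms(8)[of n] C.\<mu>_nonneg by (intro divide_pos_pos mult_pos_pos) auto
          have "0 < \<Delta> n" "0 < 2 * C.\<mu> + 1" using assms(8)[of n] C.\<mu>_nonneg by auto
          then have "\<Delta> n * (2 * C.\<mu> + 1) \<noteq> 0" by simp
          from nonzero_mult_div_cancel_left[OF this, of "?s / 5"]
          show "\<Delta> n * (2 * C.\<mu> + 1) * (?s / (5 * \<Delta> n * (2 * C.\<mu> + 1))) \<le> ?s / 5"
            by (simp only: times_divide_eq_right times_divide_eq_left divide_divide_eq_left mult_ac order_refl)
          show "4 * exp (- real n * (?s / 5)\<^sup>2 / 8) * (real n * \<Delta> n)\<^sup>2 \<le> ?s / (5 * \<Delta> n * (2 * C.\<mu> + 1))"
            using elim by (intro C.deviation_level[OF assms(8) n \<delta>]) auto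
        qed simp
      qed
    qed
  qed
qed

end
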